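(* Let $M$ be a closed oriented smooth $4$-manifold with a Riemannian metric $g$ and a compatible almost-complex structure $J$, with the induced $Spin^{\mathbb{C}}$-structure. Let $\varphi\in\Gamma(\mathcal{W}^+)$ be a self-dual spinor field, let $(\mathcal{B}^{A}\varphi)_XY=Y\bullet\overline\nabla^{A}_X\varphi$, and vary $A$ among unitary connections on $K^*$. Let $A_0$ be a unitary connection on $K^*$ and $x\in M$. Then: A. $\mathcal{B}^{A_0}\varphi|_x$ is minimal in $T_M^*\otimes T_M^*\otimes T_M|_x$ if and only if, for all $X\in T_M|_x$, $$\langle\overline\nabla^{A_0}_X\varphi,\ i\varphi\rangle|_x=0.$$ B. $\mathrm{Sym}\,\mathcal{B}^{A_0}\varphi|_x$ is minimal in $T_M^*\otimes T_M^*\otimes T_M|_x$ if and only if, for all $X\in T_M|_x$, $$\langle\mathcal{D}^{A_0}\varphi,\ i\varphi(X)\rangle|_x=6\,\langle\overline\nabla^{A_0}_X\varphi,\ i\varphi\rangle|_x.$$ C. $\mathrm{Alt}\,\mathcal{B}^{A_0}\varphi|_x$ is minimal in $T_M^*\otimes T_M^*\otimes T_M|_x$ if and only if, for all $X\in T_M|_x$, $$\langle\mathcal{D}^{A_0}\varphi,\ i\varphi(X)\rangle|_x=-2\,\langle\overline\nabla^{A_0}_X\varphi,\ i\varphi\rangle|_x.$$ D. $g\otimes\tfrac14\mathrm{tr}(\mathcal{B}^{A_0}\varphi|_x)=g\otimes\tfrac14\mathcal{D}^{A_0}\varphi|_x$ is minimal in $T_M^*\otimes T_M^*\otimes T_M|_x$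 if and only if $\mathcal{D}^{A_0}\varphi|_x=0$.
   Context: Compatible means $J$ is $g$-orthogonal and induces the orientation. $\nabla$ is the Levi-Civita connection of $g$ and $K^*=\det_{\mathbb{C}}(T_M,J)$. All inner products are real-valued. For the $Spin^{\mathbb{C}}$-structure induced by $J$, one identifies $\mathcal{W}^-=(T_M,J)$ with metric $g$, and $\mathcal{W}^+=PSO^+(T_M)\subset\mathrm{Hom}(T_M,T_M)$, the rank-$4$ real bundle of fiber maps which, under an orientation-preserving isometry $T_M|_x\cong\mathbb{H}$ (oriented by $1,i,j,k$), are left multiplications by quaternions; complex structure $i\varphi=J\circ\varphi$; real inner product normalized by $g(\varphi v,\psi v)=\langle\varphi,\psi\rangle g(v,v)$. Clifford multiplication is $v\bullet\varphi=\varphi(v)$. Spinorial connections. In a U(2)-chart (local isometric orientation-preserving trivialization $T_M|_U\cong U\times\mathbb{H}$ in which $J$ is left multiplication by $i$; it also trivializes $K^*$ by the frame $1\wedge_{\mathbb{C}}j$), write $\nabla v=\partial v+\mathfrak{a}_+v-v\,\mathfrak{a}_-$ with $\mathfrak{a}_\pm$ $\mathrm{Im}\,\mathbb{H}$-valued $1$-forms, and a unitary connection $A$ on $K^*$ as $Az=\partial z+2i\alpha z$ with $\alpha$ a real $1$-form. Then $\widetilde\nabla^{A}w=\partial w+i\alpha w-w\,\mathfrak{a}_-$ is the induced connection on $\mathcal{W}^-=T_M$, and the induced connection on $\mathcal{W}^+$ is $(\overline\nabla^{A}_X\varphi)(Y)=\widetilde\nabla^{A}_X(\varphi Y)-\varphi(\nabla_XY)$.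 $(\mathcal{B}^{A}\varphi)_XY=(\overline\nabla^{A}_X\varphi)(Y)$ is a section of $T_M^*\otimes T_M^*\otimes T_M$; $(\mathrm{Alt}\,\mathcal{B}^A\varphi)_XY=\frac12((\mathcal{B}^A\varphi)_XY-(\mathcal{B}^A\varphi)_YX)$, $(\mathrm{Sym}\,\mathcal{B}^A\varphi)_XY=\frac12((\mathcal{B}^A\varphi)_XY+(\mathcal{B}^A\varphi)_YX)$, and $\mathcal{D}^A\varphi=\mathrm{tr}(\mathcal{B}^A\varphi)=\sum_k(\mathcal{B}^A\varphi)_{e_k}e_k$ ($g$-orthonormal frame) is the Dirac operator. For $\mathcal{T}^A$ one of the tensors $\mathcal{B}^A\varphi$, $\mathrm{Sym}\,\mathcal{B}^A\varphi$, $\mathrm{Alt}\,\mathcal{B}^A\varphi$, $g\otimes\frac14\mathrm{tr}(\mathcal{B}^A\varphi)$, "$\mathcal{T}^{A_0}|_x$ is minimal" means that $\|\mathcal{T}^{A_0}|_x\|\le\|\mathcal{T}^{A}|_x\|$ for all unitary connections $A$ on $K^*$, for the norm from $\langle T_1,T_2\rangle=\sum_{j,k}g(T_1(e_j,e_k),T_2(e_j,e_k))$.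
   Formalization: Part D is false where φ|_x = 0 (there D^Aφ|_x does not depend on A and may be nonzero); the equivalence in D is proved for φ|_x ≠ 0, together with the unconditional direction that D^{A_0}φ|_x = 0 implies minimality. *)

theory Defs
  imports "HOL-Analysis.Analysis" "HOL-Library.Function_Algebras"
begin

section \<open>Pointwise scalar multiplication of functions\<close>

instantiation "fun" :: (type, real_vector) real_vector
begin

definition scaleR_fun :: "real \<Rightarrow> ('a \<Rightarrow> 'b) \<Rightarrow> 'a \<Rightarrow> 'b" where
  "scaleR_fun r f = (\<lambda>x. r *\<^sub>R f x)"

instance
  by standard (simp_all add: scaleR_fun_def fun_eq_iff scaleR_add_right scaleR_add_left)

end

lemma scaleR_fun_apply [simp]: "(r *\<^sub>R f) x = r *\<^sub>R f x" for f :: "'a \<Rightarrow> 'b::real_vector"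
  by (simp add: scaleR_fun_def)

text \<open>Linearity on a linear subspace of an ambient vector space.\<close>

definition lin_on :: "'v::real_vector set \<Rightarrow> ('v \<Rightarrow> 'w::real_vector) \<Rightarrow> bool" where
  "lin_on V f \<longleftrightarrow> (\<forall>u\<in>V. \<forall>v\<in>V. f (u + v) = f u + f v) \<and> (\<forall>r. \<forall>u\<in>V. f (r *\<^sub>R u) = r *\<^sub>R f u)"


section \<open>Quaternions\<close>


text \<open>The quaternion \<open>a + b i + c j + d k\<close> is the vector \<open>(a, b, c, d)\<close>; the inner product of
  \<open>real ^ 4\<close> is the standard one of the quaternions, and the standard orientation of \<open>real ^ 4\<close>
  is the one in which \<open>1, i, j, k\<close> is positive.\<close>

type_synonym quat = "real ^ 4"

definition qmult :: "quat \<Rightarrow> quat \<Rightarrow> quat" where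
  "qmult p q = vector
    [p$1 * q$1 - p$2 * q$2 - p$3 * q$3 - p$4 * q$4,
     p$1 * q$2 + p$2 * q$1 + p$3 * q$4 - p$4 * q$3,
     p$1 * q$3 - p$2 * q$4 + p$3 * q$1 + p$4 * q$2,
     p$1 * q$4 + p$2 * q$3 - p$3 * q$2 + p$4 * q$1]"

definition q_one :: quat where "q_one = vector [1, 0, 0, 0]"
definition q_i :: quat where "q_i = vector [0, 1, 0, 0]"
definition q_j :: quat where "q_j = vector [0, 0, 1, 0]"

definition im_quat :: "quat set" where
  "im_quat = {q. q $ 1 = 0}"


section \<open>Oriented smooth 4-manifolds\<close>

text \<open>\<open>C\<^sup>k\<close> and smooth maps; only used for open domains \<open>S\<close> in a Euclidean space.\<close>

primrec Ck_on :: "nat \<Rightarrow> 'a::real_normed_vector set \<Rightarrow> ('a \<Rightarrow> 'b::real_normed_vector) \<Rightarrow> bool" where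
  "Ck_on 0 S f \<longleftrightarrow> continuous_on S f"
| "Ck_on (Suc k) S f \<longleftrightarrow>
     f differentiable_on S \<and> (\<forall>v. Ck_on k S (\<lambda>p. frechet_derivative f (at p) v))"

definition smooth_on :: "'a::real_normed_vector set \<Rightarrow> ('a \<Rightarrow> 'b::real_normed_vector) \<Rightarrow> bool" where
  "smooth_on S f \<longleftrightarrow> (\<forall>k. Ck_on k S f)"

text \<open>A chart is a pair of its domain and its coordinate map.\<close>

type_synonym 'a chart = "'a set \<times> ('a \<Rightarrow> real ^ 4)"

definition chart_inv :: "'a chart \<Rightarrow> real ^ 4 \<Rightarrow> 'a" where
  "chart_inv c = inv_into (fst c) (snd c)"

definition is_chart :: "'a::topological_space chart \<Rightarrow> bool" where
  "is_chart c \<longleftrightarrow> open (fst c) \<and> open (snd c ` fst c) \<and>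
     homeomorphism (fst c) (snd c ` fst c) (snd c) (chart_inv c)"

definition transition :: "'a chart \<Rightarrow> 'a chart \<Rightarrow> real ^ 4 \<Rightarrow> real ^ 4" where
  "transition c d = snd d \<circ> chart_inv c"

text \<open>An oriented smooth structure on the whole type \<open>'a\<close>, given by a (not necessarily maximal)
  atlas of positively oriented charts.\<close>

definition oriented_atlas :: "'a::topological_space chart set \<Rightarrow> bool" where
  "oriented_atlas \<A> \<longleftrightarrow> (\<forall>c\<in>\<A>. is_chart c) \<and> (\<Union>c\<in>\<A>. fst c) = UNIV \<and>
     (\<forall>c\<in>\<A>. \<forall>d\<in>\<A>. smooth_on (snd c ` (fst c \<inter> fst d)) (transition c d) \<and>
        (\<forall>p \<in> snd c ` (fst c \<inter> fst d).
           0 < det (matrix (frechet_derivative (transition c d) (at p)))))"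

text \<open>A tangent vector at \<open>x\<close> is the family of its coordinate vectors in all charts around \<open>x\<close>,
  extended by \<open>0\<close> to the remaining charts.\<close>

type_synonym 'a tvec = "'a chart \<Rightarrow> real ^ 4"

definition tangent_space :: "'a chart set \<Rightarrow> 'a \<Rightarrow> 'a tvec set" where
  "tangent_space \<A> x = {v.
     (\<forall>c. \<not> (c \<in> \<A> \<and> x \<in> fst c) \<longrightarrow> v c = 0) \<and>
     (\<forall>c\<in>\<A>. \<forall>d\<in>\<A>. x \<in> fst c \<inter> fst d \<longrightarrow>
        v d = frechet_derivative (transition c d) (at (snd c x)) (v c))}"

definition smooth_fun :: "'a chart set \<Rightarrow> 'a set \<Rightarrow> ('a \<Rightarrow> 'b::real_normed_vector) \<Rightarrow> bool" where
  "smooth_fun \<A> U f \<longleftrightarrow> (\<forall>c\<in>\<A>. smooth_on (snd c ` (U \<inter> fst c)) (f \<circ> chart_inv c))"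

text \<open>The derivative of \<open>f\<close> at \<open>x\<close> in direction \<open>v\<close>; it does not depend on the chart.\<close>

definition dir_deriv :: "'a chart set \<Rightarrow> ('a \<Rightarrow> 'b::real_normed_vector) \<Rightarrow> 'a \<Rightarrow> 'a tvec \<Rightarrow> 'b" where
  "dir_deriv \<A> f x v = (let c = (SOME c. c \<in> \<A> \<and> x \<in> fst c) in
     frechet_derivative (f \<circ> chart_inv c) (at (snd c x)) (v c))"

definition vector_field :: "'a chart set \<Rightarrow> 'a set \<Rightarrow> ('a \<Rightarrow> 'a tvec) \<Rightarrow> bool" where
  "vector_field \<A> U X \<longleftrightarrow> (\<forall>x\<in>U. X x \<in> tangent_space \<A> x) \<and>
     (\<forall>c\<in>\<A>. smooth_on (snd c ` (U \<inter> fst c)) (\<lambda>p. X (chart_inv c p) c))"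

definition lie_bracket :: "'a chart set \<Rightarrow> ('a \<Rightarrow> 'a tvec) \<Rightarrow> ('a \<Rightarrow> 'a tvec) \<Rightarrow> 'a \<Rightarrow> 'a tvec" where
  "lie_bracket \<A> X Y x = (\<lambda>c. if c \<in> \<A> \<and> x \<in> fst c
     then frechet_derivative (\<lambda>p. Y (chart_inv c p) c) (at (snd c x)) (X x c)
        - frechet_derivative (\<lambda>p. X (chart_inv c p) c) (at (snd c x)) (Y x c)
     else 0)"

definition endomorphism_field ::
  "'a::topological_space chart set \<Rightarrow> ('a \<Rightarrow> 'a tvec \<Rightarrow> 'a tvec) \<Rightarrow> bool" where
  "endomorphism_field \<A> F \<longleftrightarrow>
     (\<forall>x. F x ` tangent_space \<A> x \<subseteq> tangent_space \<A> x \<and> lin_on (tangent_space \<A> x) (F x)) \<and>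
     (\<forall>U X. open U \<and> vector_field \<A> U X \<longrightarrow> vector_field \<A> U (\<lambda>x. F x (X x)))"

text \<open>The \<open>k\<close>-th row of the determinant is the coordinate vector of the \<open>k\<close>-th basis vector.\<close>

definition positive_basis :: "'a chart set \<Rightarrow> 'a \<Rightarrow> ('a tvec) ^ 4 \<Rightarrow> bool" where
  "positive_basis \<A> x e \<longleftrightarrow> (\<forall>k. e $ k \<in> tangent_space \<A> x) \<and>
     (\<forall>c\<in>\<A>. x \<in> fst c \<longrightarrow> 0 < det (\<chi> k. (e $ k) c))"


section \<open>Metric and almost-complex structure\<close>

type_synonym 'a metric = "'a \<Rightarrow> 'a tvec \<Rightarrow> 'a tvec \<Rightarrow> real"

definition riemannian_metric :: "'a::topological_space chart set \<Rightarrow> 'a metric \<Rightarrow> bool" where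
  "riemannian_metric \<A> g \<longleftrightarrow>
     (\<forall>x. \<forall>u\<in>tangent_space \<A> x. lin_on (tangent_space \<A> x) (g x u)) \<and>
     (\<forall>x. \<forall>u\<in>tangent_space \<A> x. \<forall>v\<in>tangent_space \<A> x. g x u v = g x v u) \<and>
     (\<forall>x. \<forall>u\<in>tangent_space \<A> x. u \<noteq> 0 \<longrightarrow> 0 < g x u u) \<and>
     (\<forall>U X Y. open U \<and> vector_field \<A> U X \<and> vector_field \<A> U Y \<longrightarrow>
        smooth_fun \<A> U (\<lambda>x. g x (X x) (Y x)))"

definition orthonormal_basis :: "'a chart set \<Rightarrow> 'a metric \<Rightarrow> 'a \<Rightarrow> ('a tvec) ^ 4 \<Rightarrow> bool" where
  "orthonormal_basis \<A> g x e \<longleftrightarrow> (\<forall>k. e $ k \<in> tangent_space \<A> x) \<and>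
     (\<forall>j k. g x (e $ j) (e $ k) = (if j = k then 1 else 0))"

type_synonym 'a endo = "'a \<Rightarrow> 'a tvec \<Rightarrow> 'a tvec"

definition almost_complex_structure :: "'a::topological_space chart set \<Rightarrow> 'a endo \<Rightarrow> bool" where
  "almost_complex_structure \<A> J \<longleftrightarrow> endomorphism_field \<A> J \<and>
     (\<forall>x. \<forall>v\<in>tangent_space \<A> x. J x (J x v) = - v)"

text \<open>The orientation induced by \<open>J\<close> is the one in which every basis \<open>u, J u, v, J v\<close> is positive.\<close>

definition compatible :: "'a chart set \<Rightarrow> 'a metric \<Rightarrow> 'a endo \<Rightarrow> bool" where
  "compatible \<A> g J \<longleftrightarrow>
     (\<forall>x. \<forall>u\<in>tangent_space \<A> x. \<forall>v\<in>tangent_space \<A> x. g x (J x u) (J x v) = g x u v) \<and>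
     (\<forall>x. \<forall>u\<in>tangent_space \<A> x. \<forall>v\<in>tangent_space \<A> x.
        u \<noteq> 0 \<and> v \<notin> span {u, J x u} \<longrightarrow> positive_basis \<A> x (vector [u, J x u, v, J x v]))"

text \<open>Orientation-preserving linear isometries from the tangent space at \<open>x\<close> onto the quaternions.\<close>

definition oriented_isometry :: "'a chart set \<Rightarrow> 'a metric \<Rightarrow> 'a \<Rightarrow> ('a tvec \<Rightarrow> quat) \<Rightarrow> bool" where
  "oriented_isometry \<A> g x F \<longleftrightarrow>
     lin_on (tangent_space \<A> x) F \<and> F ` tangent_space \<A> x = UNIV \<and>
     (\<forall>u\<in>tangent_space \<A> x. \<forall>v\<in>tangent_space \<A> x. F u \<bullet> F v = g x u v) \<and>
     (\<forall>e. positive_basis \<A> x e \<longrightarrow> 0 < det (\<chi> k. F (e $ k)))"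


section \<open>Connections\<close>

text \<open>A connection on a real vector bundle with fibres in \<open>'f\<close>, whose smooth sections over open
  sets are given by \<open>\<Gamma>\<close>, is an operator on local sections: \<open>D s x v\<close> is the derivative of the
  section \<open>s\<close> at \<open>x\<close> in direction \<open>v\<close>, and it only depends on \<open>s\<close> near \<open>x\<close>.\<close>

type_synonym ('a, 'f) conn = "('a \<Rightarrow> 'f) \<Rightarrow> 'a \<Rightarrow> 'a tvec \<Rightarrow> 'f"

definition connection ::
  "'a::topological_space chart set \<Rightarrow> ('a set \<Rightarrow> ('a \<Rightarrow> 'f::real_vector) \<Rightarrow> bool) \<Rightarrow> ('a, 'f) conn \<Rightarrow> bool"
  where
  "connection \<A> \<Gamma> D \<longleftrightarrow> (\<forall>U. open U \<longrightarrow>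
     (\<forall>s X. \<Gamma> U s \<and> vector_field \<A> U X \<longrightarrow> \<Gamma> U (\<lambda>x. D s x (X x))) \<and>
     (\<forall>s. \<Gamma> U s \<longrightarrow> (\<forall>x\<in>U. lin_on (tangent_space \<A> x) (D s x))) \<and>
     (\<forall>s t. \<Gamma> U s \<and> \<Gamma> U t \<longrightarrow> (\<forall>x\<in>U. \<forall>v\<in>tangent_space \<A> x.
        D (\<lambda>y. s y + t y) x v = D s x v + D t x v)) \<and>
     (\<forall>f s. smooth_fun \<A> U f \<and> \<Gamma> U s \<longrightarrow> (\<forall>x\<in>U. \<forall>v\<in>tangent_space \<A> x.
        D (\<lambda>y. f y *\<^sub>R s y) x v = dir_deriv \<A> f x v *\<^sub>R s x + f x *\<^sub>R D s x v)) \<and>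
     (\<forall>s t. \<Gamma> U s \<and> (\<forall>x\<in>U. s x = t x) \<longrightarrow> (\<forall>x\<in>U. \<forall>v\<in>tangent_space \<A> x.
        D s x v = D t x v)))"

definition levi_civita ::
  "'a::topological_space chart set \<Rightarrow> 'a metric \<Rightarrow> ('a, 'a tvec) conn \<Rightarrow> bool" where
  "levi_civita \<A> g nab \<longleftrightarrow> connection \<A> (vector_field \<A>) nab \<and>
     (\<forall>U Y Z. open U \<and> vector_field \<A> U Y \<and> vector_field \<A> U Z \<longrightarrow>
        (\<forall>x\<in>U. \<forall>v\<in>tangent_space \<A> x.
           dir_deriv \<A> (\<lambda>y. g y (Y y) (Z y)) x v = g x (nab Y x v) (Z x) + g x (Y x) (nab Z x v)) \<and>
        (\<forall>x\<in>U. nab Z x (Y x) - nab Y x (Z x) = lie_bracket \<A> Y Z x))"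


section \<open>The anticanonical bundle and its unitary connections\<close>

text \<open>The complex line of alternating \<open>(2,0)\<close>-forms on the tangent space at \<open>x\<close>.\<close>

type_synonym 'a cform = "'a tvec \<Rightarrow> 'a tvec \<Rightarrow> complex"

definition cforms :: "'a chart set \<Rightarrow> 'a endo \<Rightarrow> 'a \<Rightarrow> 'a cform set" where
  "cforms \<A> J x = {\<omega>.
     (\<forall>u v. u \<notin> tangent_space \<A> x \<or> v \<notin> tangent_space \<A> x \<longrightarrow> \<omega> u v = 0) \<and>
     (\<forall>u\<in>tangent_space \<A> x. lin_on (tangent_space \<A> x) (\<omega> u)) \<and>
     (\<forall>u\<in>tangent_space \<A> x. \<forall>v\<in>tangent_space \<A> x.
        \<omega> v u = - \<omega> u v \<and> \<omega> (J x u) v = \<i> * \<omega> u v)}"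

text \<open>The fibre of \<open>K\<^sup>*\<close>, the second exterior power over the complex numbers of the tangent space
  with complex structure \<open>J\<close>, is realized as the complex dual of the space of \<open>(2,0)\<close>-forms:
  the bivector \<open>u \<and> v\<close> is evaluation of forms at \<open>(u, v)\<close>.\<close>

type_synonym 'a kvec = "'a cform \<Rightarrow> complex"

definition cscale :: "complex \<Rightarrow> ('b \<Rightarrow> complex) \<Rightarrow> 'b \<Rightarrow> complex" where
  "cscale a \<zeta> = (\<lambda>\<omega>. a * \<zeta> \<omega>)"

definition kstar :: "'a chart set \<Rightarrow> 'a endo \<Rightarrow> 'a \<Rightarrow> 'a kvec set" where
  "kstar \<A> J x = {\<zeta>. (\<forall>\<omega>. \<omega> \<notin> cforms \<A> J x \<longrightarrow> \<zeta> \<omega> = 0) \<and>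
     (\<forall>\<omega>\<in>cforms \<A> J x. \<forall>\<eta>\<in>cforms \<A> J x. \<zeta> (\<omega> + \<eta>) = \<zeta> \<omega> + \<zeta> \<eta>) \<and>
     (\<forall>a. \<forall>\<omega>\<in>cforms \<A> J x. \<zeta> (\<lambda>u. cscale a (\<omega> u)) = a * \<zeta> \<omega>)}"

definition wedge :: "'a chart set \<Rightarrow> 'a endo \<Rightarrow> 'a \<Rightarrow> 'a tvec \<Rightarrow> 'a tvec \<Rightarrow> 'a kvec" where
  "wedge \<A> J x u v = (\<lambda>\<omega>. if \<omega> \<in> cforms \<A> J x then \<omega> u v else 0)"

definition smooth_cform ::
  "'a::topological_space chart set \<Rightarrow> 'a endo \<Rightarrow> 'a set \<Rightarrow> ('a \<Rightarrow> 'a cform) \<Rightarrow> bool" where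
  "smooth_cform \<A> J U \<omega> \<longleftrightarrow> (\<forall>x\<in>U. \<omega> x \<in> cforms \<A> J x) \<and>
     (\<forall>V X Y. open V \<and> V \<subseteq> U \<and> vector_field \<A> V X \<and> vector_field \<A> V Y \<longrightarrow>
        smooth_fun \<A> V (\<lambda>x. \<omega> x (X x) (Y x)))"

definition kstar_section ::
  "'a::topological_space chart set \<Rightarrow> 'a endo \<Rightarrow> 'a set \<Rightarrow> ('a \<Rightarrow> 'a kvec) \<Rightarrow> bool" where
  "kstar_section \<A> J U \<zeta> \<longleftrightarrow> (\<forall>x\<in>U. \<zeta> x \<in> kstar \<A> J x) \<and>
     (\<forall>V \<omega>. open V \<and> V \<subseteq> U \<and> smooth_cform \<A> J V \<omega> \<longrightarrow> smooth_fun \<A> V (\<lambda>x. \<zeta> x (\<omega> x)))"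

text \<open>The Hermitian metric on the tangent bundle, complex linear in the first argument, and the
  induced one on \<open>K\<^sup>*\<close>, determined by
  \<open>\<langle>a \<and> b, u \<and> v\<rangle> = h(a,u) h(b,v) - h(a,v) h(b,u)\<close>.  As a function of \<open>(a, b)\<close> the right-hand side
  is the form \<open>det_form u v\<close>, and every element of \<open>K\<^sup>*\<close> is decomposable.\<close>

definition herm :: "'a metric \<Rightarrow> 'a endo \<Rightarrow> 'a \<Rightarrow> 'a tvec \<Rightarrow> 'a tvec \<Rightarrow> complex" where
  "herm g J x u v = Complex (g x u v) (g x u (J x v))"

definition det_form ::
  "'a chart set \<Rightarrow> 'a metric \<Rightarrow> 'a endo \<Rightarrow> 'a \<Rightarrow> 'a tvec \<Rightarrow> 'a tvec \<Rightarrow> 'a cform" where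
  "det_form \<A> g J x u v = (\<lambda>a b. if a \<in> tangent_space \<A> x \<and> b \<in> tangent_space \<A> x
     then herm g J x a u * herm g J x b v - herm g J x a v * herm g J x b u else 0)"

definition kstar_herm ::
  "'a chart set \<Rightarrow> 'a metric \<Rightarrow> 'a endo \<Rightarrow> 'a \<Rightarrow> 'a kvec \<Rightarrow> 'a kvec \<Rightarrow> complex" where
  "kstar_herm \<A> g J x \<zeta> \<eta> =
     (let (u, v) = (SOME (u, v). u \<in> tangent_space \<A> x \<and> v \<in> tangent_space \<A> x \<and>
                      \<eta> = wedge \<A> J x u v)
      in \<zeta> (det_form \<A> g J x u v))"

definition unitary_connection ::
  "'a::topological_space chart set \<Rightarrow> 'a metric \<Rightarrow> 'a endo \<Rightarrow> ('a, 'a kvec) conn \<Rightarrow> bool" where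
  "unitary_connection \<A> g J A \<longleftrightarrow> connection \<A> (kstar_section \<A> J) A \<and>
     (\<forall>U \<zeta>. open U \<and> kstar_section \<A> J U \<zeta> \<longrightarrow> (\<forall>x\<in>U. \<forall>v\<in>tangent_space \<A> x.
        A (\<lambda>y. cscale \<i> (\<zeta> y)) x v = cscale \<i> (A \<zeta> x v))) \<and>
     (\<forall>U \<zeta> \<eta>. open U \<and> kstar_section \<A> J U \<zeta> \<and> kstar_section \<A> J U \<eta> \<longrightarrow>
        (\<forall>x\<in>U. \<forall>v\<in>tangent_space \<A> x.
           dir_deriv \<A> (\<lambda>y. kstar_herm \<A> g J y (\<zeta> y) (\<eta> y)) x v =
             kstar_herm \<A> g J x (A \<zeta> x v) (\<eta> x) + kstar_herm \<A> g J x (\<zeta> x) (A \<eta> x v)))"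


section \<open>Spinor bundles and spinorial connections\<close>

text \<open>The fibre of \<open>W\<^sup>+\<close> at \<open>x\<close>.  Only the restriction of \<open>\<phi>\<close> to the tangent space matters.\<close>

definition wplus :: "'a chart set \<Rightarrow> 'a metric \<Rightarrow> 'a \<Rightarrow> ('a tvec \<Rightarrow> 'a tvec) set" where
  "wplus \<A> g x = {\<phi>. \<exists>F q. oriented_isometry \<A> g x F \<and>
     (\<forall>v\<in>tangent_space \<A> x. \<phi> v \<in> tangent_space \<A> x \<and> F (\<phi> v) = qmult q (F v))}"

definition self_dual_spinor_field ::
  "'a::topological_space chart set \<Rightarrow> 'a metric \<Rightarrow> 'a endo \<Rightarrow> bool" where
  "self_dual_spinor_field \<A> g \<phi> \<longleftrightarrow> endomorphism_field \<A> \<phi> \<and> (\<forall>x. \<phi> x \<in> wplus \<A> g x)"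

definition wplus_inner ::
  "'a chart set \<Rightarrow> 'a metric \<Rightarrow> 'a \<Rightarrow> ('a tvec \<Rightarrow> 'a tvec) \<Rightarrow> ('a tvec \<Rightarrow> 'a tvec) \<Rightarrow> real" where
  "wplus_inner \<A> g x \<phi> \<psi> = (THE r. \<forall>v\<in>tangent_space \<A> x. g x (\<phi> v) (\<psi> v) = r * g x v v)"

definition clifford :: "'a tvec \<Rightarrow> ('a tvec \<Rightarrow> 'a tvec) \<Rightarrow> 'a tvec" where
  "clifford v \<phi> = \<phi> v"

text \<open>U(2)-charts: the trivialization over \<open>U\<close> is given by its restrictions \<open>F x\<close> to the fibres.\<close>

type_synonym 'a triv = "'a \<Rightarrow> 'a tvec \<Rightarrow> quat"

definition u2_chart ::
  "'a::topological_space chart set \<Rightarrow> 'a metric \<Rightarrow> 'a endo \<Rightarrow> 'a set \<Rightarrow> 'a triv \<Rightarrow> bool" where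
  "u2_chart \<A> g J U F \<longleftrightarrow> open U \<and>
     (\<forall>x\<in>U. oriented_isometry \<A> g x (F x) \<and>
        (\<forall>v\<in>tangent_space \<A> x. F x (J x v) = qmult q_i (F x v))) \<and>
     (\<forall>V X. open V \<and> V \<subseteq> U \<and> vector_field \<A> V X \<longrightarrow> smooth_fun \<A> V (\<lambda>x. F x (X x)))"

definition triv_inv :: "'a chart set \<Rightarrow> 'a triv \<Rightarrow> 'a \<Rightarrow> quat \<Rightarrow> 'a tvec" where
  "triv_inv \<A> F x = inv_into (tangent_space \<A> x) (F x)"

text \<open>The values \<open>(\<aa>\<^sub>+(v), \<aa>\<^sub>-(v))\<close> at \<open>x\<close> of the connection forms of \<open>nab\<close> in a U(2)-chart.\<close>

definition lc_forms :: "'a::topological_space chart set \<Rightarrow> ('a, 'a tvec) conn \<Rightarrow>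
    'a set \<Rightarrow> 'a triv \<Rightarrow> 'a \<Rightarrow> 'a tvec \<Rightarrow> quat \<times> quat" where
  "lc_forms \<A> nab U F x v = (THE (ap, am). ap \<in> im_quat \<and> am \<in> im_quat \<and>
     (\<forall>V Y. open V \<and> x \<in> V \<and> V \<subseteq> U \<and> vector_field \<A> V Y \<longrightarrow>
        F x (nab Y x v) =
          dir_deriv \<A> (\<lambda>y. F y (Y y)) x v + qmult ap (F x (Y x)) - qmult (F x (Y x)) am))"

text \<open>The value \<open>\<alpha>(v)\<close> at \<open>x\<close> of the real 1-form describing \<open>A\<close> in the frame \<open>1 \<and> j\<close> of \<open>K\<^sup>*\<close>.\<close>

definition det_conn_form :: "'a::topological_space chart set \<Rightarrow> 'a endo \<Rightarrow> ('a, 'a kvec) conn \<Rightarrow>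
    'a set \<Rightarrow> 'a triv \<Rightarrow> 'a \<Rightarrow> 'a tvec \<Rightarrow> real" where
  "det_conn_form \<A> J A U F x v =
     (let \<sigma> = (\<lambda>y. wedge \<A> J y (triv_inv \<A> F y q_one) (triv_inv \<A> F y q_j)) in
      THE a. \<forall>V (z :: 'a \<Rightarrow> complex). open V \<and> x \<in> V \<and> V \<subseteq> U \<and> smooth_fun \<A> V z \<longrightarrow>
        A (\<lambda>y. cscale (z y) (\<sigma> y)) x v =
          cscale (dir_deriv \<A> z x v + 2 * \<i> * complex_of_real a * z x) (\<sigma> x))"

text \<open>The induced connection on \<open>W\<^sup>-\<close>, in a given U(2)-chart and then in any U(2)-chart around
  the point; the value is the same in all of them.\<close>

definition spin_conn_minus_in :: "'a::topological_space chart set \<Rightarrow> 'a endo \<Rightarrow>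
    ('a, 'a tvec) conn \<Rightarrow> ('a, 'a kvec) conn \<Rightarrow> 'a set \<Rightarrow> 'a triv \<Rightarrow> ('a, 'a tvec) conn" where
  "spin_conn_minus_in \<A> J nab A U F w x v = triv_inv \<A> F x
     (dir_deriv \<A> (\<lambda>y. F y (w y)) x v
      + det_conn_form \<A> J A U F x v *\<^sub>R qmult q_i (F x (w x))
      - qmult (F x (w x)) (snd (lc_forms \<A> nab U F x v)))"

definition spin_conn_minus :: "'a::topological_space chart set \<Rightarrow> 'a metric \<Rightarrow> 'a endo \<Rightarrow>
    ('a, 'a tvec) conn \<Rightarrow> ('a, 'a kvec) conn \<Rightarrow> ('a, 'a tvec) conn" where
  "spin_conn_minus \<A> g J nab A w x v =
     (let (U, F) = (SOME (U, F). u2_chart \<A> g J U F \<and> x \<in> U)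
      in spin_conn_minus_in \<A> J nab A U F w x v)"

text \<open>The derivative at \<open>x\<close> in direction \<open>v\<close> of the \<open>W\<^sup>+\<close>-section \<open>\<phi>\<close>, as an endomorphism of the
  tangent space.  It is tensorial in \<open>u\<close>, so any local vector field extending \<open>u\<close> may be used.\<close>

definition spin_conn_plus :: "'a::topological_space chart set \<Rightarrow> 'a metric \<Rightarrow> 'a endo \<Rightarrow>
    ('a, 'a tvec) conn \<Rightarrow> ('a, 'a kvec) conn \<Rightarrow> ('a, 'a tvec \<Rightarrow> 'a tvec) conn" where
  "spin_conn_plus \<A> g J nab A \<phi> x v u =
     (let Y = (SOME Y. Y x = u \<and> (\<exists>U. open U \<and> x \<in> U \<and> vector_field \<A> U Y))
      in spin_conn_minus \<A> g J nab A (\<lambda>y. \<phi> y (Y y)) x v - \<phi> x (nab Y x v))"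


section \<open>The tensors and their minimality\<close>

type_synonym 'a tensor = "'a tvec \<Rightarrow> 'a tvec \<Rightarrow> 'a tvec"

definition B_tensor :: "'a::topological_space chart set \<Rightarrow> 'a metric \<Rightarrow> 'a endo \<Rightarrow>
    ('a, 'a tvec) conn \<Rightarrow> 'a endo \<Rightarrow> 'a \<Rightarrow> ('a, 'a kvec) conn \<Rightarrow> 'a tensor" where
  "B_tensor \<A> g J nab \<phi> x A = (\<lambda>X Y. clifford Y (spin_conn_plus \<A> g J nab A \<phi> x X))"

definition Sym_tensor :: "'a tensor \<Rightarrow> 'a tensor" where
  "Sym_tensor T = (\<lambda>X Y. (1/2) *\<^sub>R (T X Y + T Y X))"

definition Alt_tensor :: "'a tensor \<Rightarrow> 'a tensor" where
  "Alt_tensor T = (\<lambda>X Y. (1/2) *\<^sub>R (T X Y - T Y X))"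

definition tr_tensor :: "'a chart set \<Rightarrow> 'a metric \<Rightarrow> 'a \<Rightarrow> 'a tensor \<Rightarrow> 'a tvec" where
  "tr_tensor \<A> g x T = (let e = (SOME e. orthonormal_basis \<A> g x e) in \<Sum>k\<in>UNIV. T (e $ k) (e $ k))"

definition dirac :: "'a::topological_space chart set \<Rightarrow> 'a metric \<Rightarrow> 'a endo \<Rightarrow>
    ('a, 'a tvec) conn \<Rightarrow> 'a endo \<Rightarrow> 'a \<Rightarrow> ('a, 'a kvec) conn \<Rightarrow> 'a tvec" where
  "dirac \<A> g J nab \<phi> x A = tr_tensor \<A> g x (B_tensor \<A> g J nab \<phi> x A)"

definition metric_tensor :: "'a metric \<Rightarrow> 'a \<Rightarrow> 'a tvec \<Rightarrow> 'a tensor" where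
  "metric_tensor g x w = (\<lambda>X Y. g x X Y *\<^sub>R w)"

definition tensor_norm :: "'a chart set \<Rightarrow> 'a metric \<Rightarrow> 'a \<Rightarrow> 'a tensor \<Rightarrow> real" where
  "tensor_norm \<A> g x T = (let e = (SOME e. orthonormal_basis \<A> g x e) in
     sqrt (\<Sum>j\<in>UNIV. \<Sum>k\<in>UNIV. g x (T (e $ j) (e $ k)) (T (e $ j) (e $ k))))"

definition minimal_at :: "'a::topological_space chart set \<Rightarrow> 'a metric \<Rightarrow> 'a endo \<Rightarrow> 'a \<Rightarrow>
    (('a, 'a kvec) conn \<Rightarrow> 'a tensor) \<Rightarrow> ('a, 'a kvec) conn \<Rightarrow> bool" where
  "minimal_at \<A> g J x \<T> A0 \<longleftrightarrow>
     (\<forall>A. unitary_connection \<A> g J A \<longrightarrow> tensor_norm \<A> g x (\<T> A0) \<le> tensor_norm \<A> g x (\<T> A))"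

end

theory Submission
  imports Defs
begin

text \<open>In a U(2)-chart \<open>F\<close> the spinor field is left multiplication by a quaternion-valued function
  \<open>q\<close>, and the connection forms give \<open>F (B X Y) = Q(X) F(Y)\<close> with
  \<open>Q(X) = \<partial>\<^sub>X q + \<alpha>(X) i q - q \<aa>\<^sub>+(X)\<close>.  Passing from \<open>A0\<close> to another unitary connection
  replaces \<open>\<alpha>\<close> by \<open>\<alpha> + \<beta>\<close>, where every covector \<open>\<beta>\<close> at \<open>x\<close> occurs: extend the dual vector to a
  global vector field with a bump function.  Hence each squared norm is a quadratic polynomial in
  \<open>\<beta>\<close> whose quadratic part is nonnegative, so minimality means that its linear part vanishes.
  For an orthonormal frame with images \<open>f\<^sub>k\<close>, the linear parts for the symmetric and alternating
  tensors follow from \<open>\<langle>a u, p v\<rangle> + \<langle>a v, p u\<rangle> = 2 \<langle>a, p\<rangle> \<langle>u, v\<rangle>\<close>.  The trace is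
  \<open>D + p b\<close> with \<open>p = i q\<close> and \<open>b\<close> an arbitrary quaternion, which vanishes for some \<open>b\<close> if
  \<open>p\<close> is nonzero.\<close>

section \<open>Smooth maps\<close>

text \<open>The definitions select by \<open>SOME\<close> a U(2)-chart, a local extension of a
  vector, an orthonormal basis and a decomposition of an element of K*, and they describe the
  connection forms and the inner product of W+ by \<open>THE\<close>. The calculation is therefore
  made in the very chart and basis that these choices return, whose existence rests on smooth
  unitary frames; each \<open>THE\<close> is resolved by a uniqueness argument. A spinor is left
  multiplication only with respect to some isometry of its fibre, so this representation must be
  carried over to the isometry of the chart. Unitary connections live on the whole manifold, so the
  variations of \<open>A0\<close> are built from global vector fields, which is why bump functions
  occur. With a = <Q(X), p> and d the pairing of the Dirac value with i phi(X), the linear part of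
  the symmetric (+) or alternating (-) problem is 4 a +- (2 a - d): the 4 counts the frame vectors,
  the bracket is the product with exchanged arguments. Its zeros are d = 6 a and d = -2 a.\<close>

lemma Ck_on_cong:
  assumes "open S" "\<And>p. p \<in> S \<Longrightarrow> f p = g p" "Ck_on k S f"
  shows "Ck_on k S g"
  using assms(2,3)
proof (induction k arbitrary: f g)
  case 0
  then show ?case using continuous_on_cong[of S S f g] by simp
next
  case (Suc k)
  have eq: "frechet_derivative f (at p) = frechet_derivative g (at p)" if "p \<in> S" for p
  proof -
    have "(f has_derivative D) (at p) \<longleftrightarrow> (g has_derivative D) (at p)" for D
      using has_derivative_transform_within_open[OF _ assms(1) that, of f D UNIV g]
        has_derivative_transform_within_open[OF _ assms(1) that, of g D UNIV f] Suc.prems(1) by auto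
    then show ?thesis by (simp add: frechet_derivative_def)
  qed
  have "f differentiable_on S" using Suc.prems(2) by simp
  then have "g differentiable_on S"
    using Suc.prems(1) by (simp add: differentiable_on_def)
      (metis differentiable_transform_within zero_less_one)
  moreover have "Ck_on k S (\<lambda>p. frechet_derivative g (at p) v)" for v
    by (rule Suc.IH[of "\<lambda>p. frechet_derivative f (at p) v"]) (use Suc.prems eq in auto)
  ultimately show ?case by simp
qed

lemma Ck_on_subset:
  assumes "Ck_on k S f" "T \<subseteq> S"
  shows "Ck_on k T f"
  using assms
  by (induction k arbitrary: f) (auto intro: continuous_on_subset differentiable_on_subset)

lemma Ck_on_has_derivative:
  assumes "open S" "Ck_on (Suc k) S f" "p \<in> S"
  shows "(f has_derivative frechet_derivative f (at p)) (at p)"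
  using assms by (metis Ck_on.simps(2) differentiable_on_eq_differentiable_at frechet_derivative_works)

text \<open>Lets an explicit derivative \<open>f'\<close> stand in for
  \<open>frechet_derivative\<close>, which the definition of \<open>Ck_on\<close> mentions; the
  closure properties below get their induction steps from it.\<close>

lemma Ck_on_SucI:
  assumes "open S" "\<And>p. p \<in> S \<Longrightarrow> (f has_derivative f' p) (at p)"
    and "\<And>v. Ck_on k S (\<lambda>p. f' p v)"
  shows "Ck_on (Suc k) S f"
proof -
  have "f differentiable_on S"
    using assms(1,2) by (meson differentiableI differentiable_on_eq_differentiable_at)
  moreover have "Ck_on k S (\<lambda>p. frechet_derivative f (at p) v)" for v
    by (rule Ck_on_cong[OF assms(1) _ assms(3)[of v]]) (use assms(2) frechet_derivative_at in metis)
  ultimately show ?thesis by simp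
qed

lemma Ck_on_SucD: "Ck_on (Suc k) S f \<Longrightarrow> Ck_on k S f"
  by (induction k arbitrary: f) (auto intro: differentiable_imp_continuous_on)

lemma Ck_on_const [simp]: "Ck_on k S (\<lambda>p. c)"
  by (induction k arbitrary: c) auto

lemma Ck_on_bounded_linear:
  assumes "bounded_linear L" "open S" "Ck_on k S f"
  shows "Ck_on k S (\<lambda>p. L (f p))"
  using assms(3)
proof (induction k arbitrary: f)
  case 0
  then show ?case using linear_continuous_on_compose assms(1)
    by (auto intro: bounded_linear.continuous_on)
next
  case (Suc k)
  show ?case
    by (rule Ck_on_SucI[OF assms(2) bounded_linear.has_derivative[OF assms(1) Ck_on_has_derivative[OF assms(2) Suc.prems]]])
      (use Suc in auto)
qed

lemma Ck_on_add:
  assumes "open S" "Ck_on k S f" "Ck_on k S g"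
  shows "Ck_on k S (\<lambda>p. f p + g p)"
  using assms(2,3)
proof (induction k arbitrary: f g)
  case 0
  then show ?case by (auto intro: continuous_intros)
next
  case (Suc k)
  show ?case
    by (rule Ck_on_SucI[OF assms(1) has_derivative_add[OF Ck_on_has_derivative[OF assms(1) Suc.prems(1)]
          Ck_on_has_derivative[OF assms(1) Suc.prems(2)]]])
      (use Suc in auto)
qed

lemma Ck_on_sum:
  assumes "open S" "finite I" "\<And>i. i \<in> I \<Longrightarrow> Ck_on k S (f i)"
  shows "Ck_on k S (\<lambda>p. \<Sum>i\<in>I. f i p)"
  using assms(2,3) by (induction I) (auto intro: Ck_on_add[OF assms(1)])

lemma Ck_on_bounded_bilinear:
  assumes "bounded_bilinear B" "open S" "Ck_on k S f" "Ck_on k S g"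
  shows "Ck_on k S (\<lambda>p. B (f p) (g p))"
  using assms(3,4)
proof (induction k arbitrary: f g)
  case 0
  then show ?case by (auto intro: bounded_bilinear.continuous_on[OF assms(1)])
next
  case (Suc k)
  show ?case
  proof (rule Ck_on_SucI[OF assms(2) bounded_bilinear.FDERIV[OF assms(1) Ck_on_has_derivative[OF assms(2) Suc.prems(1)]
          Ck_on_has_derivative[OF assms(2) Suc.prems(2)]]])
    show "Ck_on k S (\<lambda>p. B (f p) (frechet_derivative g (at p) v) + B (frechet_derivative f (at p) v) (g p))" for v
      by (intro Ck_on_add[OF assms(2)] Suc.IH) (use Suc.prems Ck_on_SucD in auto)
  qed
qed

text \<open>The chain rule yields f'(h p)(h'(p) v), where both the point and the argument of f'
  depend on p. Expanding h'(p) v in \<open>Basis\<close> separates them into scalar functions times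
  partial derivatives of f along h, to which the induction hypothesis and the product rule apply;
  this is why the middle space is Euclidean.\<close>

lemma Ck_on_compose:
  fixes f :: "'b::euclidean_space \<Rightarrow> 'c::real_normed_vector" and h :: "'a::real_normed_vector \<Rightarrow> 'b"
  assumes "open S" "open T" "h ` S \<subseteq> T" "Ck_on k T f" "Ck_on k S h"
  shows "Ck_on k S (\<lambda>p. f (h p))"
  using assms(4,5)
proof (induction k arbitrary: f)
  case 0
  then show ?case using continuous_on_compose2[of T f S h] assms(3) by simp
next
  case (Suc k)
  let ?D = "\<lambda>f. frechet_derivative f"
  have eq: "(?D f (at (h p)) \<circ> ?D h (at p)) v = (\<Sum>b\<in>Basis. (?D h (at p) v \<bullet> b) *\<^sub>R ?D f (at (h p)) b)"
    if "p \<in> S" for p v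
  proof -
    have "linear (?D f (at (h p)))"
      using Ck_on_has_derivative[OF assms(2) Suc.prems(1)] assms(3) that has_derivative_linear by blast
    then have "?D f (at (h p)) (\<Sum>b\<in>Basis. (?D h (at p) v \<bullet> b) *\<^sub>R b)
        = (\<Sum>b\<in>Basis. (?D h (at p) v \<bullet> b) *\<^sub>R ?D f (at (h p)) b)"
      by (simp add: linear_sum linear_scale)
    then show ?thesis by (simp add: euclidean_representation)
  qed
  have *: "(f \<circ> h has_derivative (\<lambda>v. \<Sum>b\<in>Basis. (?D h (at p) v \<bullet> b) *\<^sub>R ?D f (at (h p)) b)) (at p)"
    if "p \<in> S" for p
  proof -
    have "(f has_derivative ?D f (at (h p))) (at (h p))"
      using Ck_on_has_derivative[OF assms(2) Suc.prems(1)] assms(3) that by blast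
    from diff_chain_at[OF Ck_on_has_derivative[OF assms(1) Suc.prems(2) that] this]
    have "(f \<circ> h has_derivative ?D f (at (h p)) \<circ> ?D h (at p)) (at p)" .
    moreover have "?D f (at (h p)) \<circ> ?D h (at p) = (\<lambda>v. \<Sum>b\<in>Basis. (?D h (at p) v \<bullet> b) *\<^sub>R ?D f (at (h p)) b)"
      using eq[OF that] by blast
    ultimately show ?thesis by simp
  qed
  have "Ck_on (Suc k) S (f \<circ> h)"
  proof (rule Ck_on_SucI[OF assms(1) *], assumption)
    fix v
    show "Ck_on k S (\<lambda>p. \<Sum>b\<in>Basis. (?D h (at p) v \<bullet> b) *\<^sub>R ?D f (at (h p)) b)"
    proof (intro Ck_on_sum[OF assms(1)] finite_Basis Ck_on_bounded_bilinear[OF bounded_bilinear_scaleR assms(1)]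
        Ck_on_bounded_linear[OF bounded_linear_inner_left assms(1)])
      show "Ck_on k S (\<lambda>p. ?D h (at p) v)" using Suc.prems(2) by simp
      show "Ck_on k S (\<lambda>p. ?D f (at (h p)) b)" for b
        using Suc.IH[of "\<lambda>q. ?D f (at q) b"] Suc.prems Ck_on_SucD by auto
    qed
  qed
  then show ?case by (simp add: o_def)
qed

lemma Ck_on_local:
  assumes "open S" "\<And>p. p \<in> S \<Longrightarrow> \<exists>T. open T \<and> p \<in> T \<and> Ck_on k T f"
  shows "Ck_on k S f"
  using assms(2)
proof (induction k arbitrary: f)
  case 0
  then have "isCont f p" if "p \<in> S" for p
    using that continuous_on_eq_continuous_at by auto
  then show ?case by (simp add: continuous_at_imp_continuous_on)
next
  case (Suc k)
  have "f differentiable at p" if "p \<in> S" for p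
    using Suc.prems[OF that] by (auto simp: differentiable_on_eq_differentiable_at)
  then have "f differentiable_on S"
    by (simp add: differentiable_on_eq_differentiable_at assms(1))
  moreover have "Ck_on k S (\<lambda>p. frechet_derivative f (at p) v)" for v
    by (rule Suc.IH) (use Suc.prems in fastforce)
  ultimately show ?case by simp
qed

lemma smooth_on_cong: "open S \<Longrightarrow> (\<And>p. p \<in> S \<Longrightarrow> f p = g p) \<Longrightarrow> smooth_on S f \<Longrightarrow> smooth_on S g"
  unfolding smooth_on_def by (metis Ck_on_cong)

lemma smooth_on_subset: "smooth_on S f \<Longrightarrow> T \<subseteq> S \<Longrightarrow> smooth_on T f"
  unfolding smooth_on_def by (metis Ck_on_subset)

lemma smooth_on_const [simp]: "smooth_on S (\<lambda>p. c)"
  by (simp add: smooth_on_def)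

lemma smooth_on_bounded_linear: "bounded_linear L \<Longrightarrow> open S \<Longrightarrow> smooth_on S f \<Longrightarrow> smooth_on S (\<lambda>p. L (f p))"
  unfolding smooth_on_def by (metis Ck_on_bounded_linear)

lemma smooth_on_add: "open S \<Longrightarrow> smooth_on S f \<Longrightarrow> smooth_on S g \<Longrightarrow> smooth_on S (\<lambda>p. f p + g p)"
  unfolding smooth_on_def by (metis Ck_on_add)

lemma smooth_on_bounded_bilinear:
  "bounded_bilinear B \<Longrightarrow> open S \<Longrightarrow> smooth_on S f \<Longrightarrow> smooth_on S g \<Longrightarrow> smooth_on S (\<lambda>p. B (f p) (g p))"
  unfolding smooth_on_def by (metis Ck_on_bounded_bilinear)

lemma smooth_on_compose:
  fixes f :: "'b::euclidean_space \<Rightarrow> 'c::real_normed_vector"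
  shows "open S \<Longrightarrow> open T \<Longrightarrow> h ` S \<subseteq> T \<Longrightarrow> smooth_on T f \<Longrightarrow> smooth_on S h \<Longrightarrow> smooth_on S (\<lambda>p. f (h p))"
  unfolding smooth_on_def by (metis Ck_on_compose)

lemma smooth_on_local:
  assumes "open S" "\<And>p. p \<in> S \<Longrightarrow> \<exists>T. open T \<and> p \<in> T \<and> smooth_on T f"
  shows "smooth_on S f"
  unfolding smooth_on_def using Ck_on_local[OF assms(1)] assms(2) smooth_on_def by metis

lemma smooth_on_continuous: "smooth_on S f \<Longrightarrow> continuous_on S f"
  unfolding smooth_on_def by (metis Ck_on.simps(1))

lemma smooth_on_has_derivative:
  assumes "open S" "smooth_on S f" "p \<in> S"
  shows "(f has_derivative frechet_derivative f (at p)) (at p)"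
  using assms Ck_on_has_derivative[of S 0 f p] unfolding smooth_on_def by blast

lemma smooth_on_frechet_derivative:
  "smooth_on S f \<Longrightarrow> smooth_on S (\<lambda>p. frechet_derivative f (at p) v)"
  unfolding smooth_on_def by (metis Ck_on.simps(2))

lemma smooth_on_id [simp]: "open S \<Longrightarrow> smooth_on S (\<lambda>p. p)"
proof -
  assume S: "open S"
  have "Ck_on k S (\<lambda>p. p)" for k
    by (cases k) (auto intro!: Ck_on_SucI[OF S has_derivative_ident])
  then show ?thesis by (simp add: smooth_on_def)
qed

section \<open>Powers and bump functions\<close>

lemma smooth_on_powr: "smooth_on {0<..} (\<lambda>t::real. t powr a)"
proof -
  have "Ck_on k {0<..} (\<lambda>t::real. t powr a)" for k
  proof (induction k arbitrary: a)
    case 0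
    show ?case by (auto intro!: continuous_intros)
  next
    case (Suc k)
    show ?case
    proof (rule Ck_on_SucI[where f' = "\<lambda>t v. v *\<^sub>R (a *\<^sub>R t powr (a - 1))"])
      show "((\<lambda>t. t powr a) has_derivative (\<lambda>v. v *\<^sub>R (a *\<^sub>R t powr (a - 1)))) (at t)" if "t \<in> {0<..}" for t :: real
        using has_real_derivative_powr[of t a] that
        by (simp add: has_field_derivative_def mult.commute[of _ "a * t powr (a - 1)"])
      show "Ck_on k {0<..} (\<lambda>t::real. v *\<^sub>R (a *\<^sub>R t powr (a - 1)))" for v
        by (intro Ck_on_bounded_linear[OF bounded_linear_scaleR_right] Suc.IH) auto
    qed auto
  qed
  then show ?thesis by (simp add: smooth_on_def)
qed

text \<open>For n = 0 this is the classical flat function exp(-1/t), continued by 0. The factor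
  t^(-n) makes the family closed under differentiation up to linear combinations, so that smoothness
  follows by an induction over all n at once.\<close>

definition flat_exp :: "nat \<Rightarrow> real \<Rightarrow> real" where
  "flat_exp n t = (if t > 0 then inverse t ^ n * exp (- inverse t) else 0)"

lemma flat_exp_tendsto_0: "(flat_exp n \<longlongrightarrow> 0) (at 0)"
proof -
  have "((\<lambda>s::real. s ^ n / exp s) \<longlongrightarrow> 0) at_top"
    by (rule tendsto_power_div_exp_0)
  then have "((\<lambda>t::real. inverse t ^ n / exp (inverse t)) \<longlongrightarrow> 0) (at_right 0)"
    using filterlim_compose filterlim_inverse_at_top_right by blast
  then have "(flat_exp n \<longlongrightarrow> 0) (at_right 0)"
  proof (rule Lim_transform_eventually)
    show "\<forall>\<^sub>F t in at_right 0. inverse t ^ n / exp (inverse t) = flat_exp n t"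
      using eventually_at_right_less[of "0::real"]
      by eventually_elim (simp add: flat_exp_def exp_minus divide_inverse)
  qed
  moreover have "(flat_exp n \<longlongrightarrow> 0) (at_left 0)"
  proof (rule Lim_transform_eventually[OF tendsto_const])
    show "\<forall>\<^sub>F t in at_left 0. 0 = flat_exp n t"
      by (auto simp: eventually_at_filter flat_exp_def)
  qed
  ultimately show ?thesis by (simp add: filterlim_split_at)
qed

lemma flat_exp_has_derivative:
  "(flat_exp n has_real_derivative flat_exp (n + 2) t - of_nat n * flat_exp (n + 1) t) (at t)"
proof -
  consider "t > 0" | "t < 0" | "t = 0" by linarith
  then show ?thesis
  proof cases
    case 1
    have "((\<lambda>t. inverse t ^ n * exp (- inverse t)) has_real_derivative
        flat_exp (n + 2) t - of_nat n * flat_exp (n + 1) t) (at t)"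
      using 1 by (cases n) (auto intro!: derivative_eq_intros simp: flat_exp_def power2_eq_square field_simps,
          metis One_nat_def mult.commute neq0_conv power_minus_mult)
    then show ?thesis
      by (rule has_field_derivative_transform_within_open[of _ _ _ "{0<..}"]) (use 1 in \<open>auto simp: flat_exp_def\<close>)
  next
    case 2
    have "((\<lambda>t. 0) has_real_derivative 0) (at t)" by simp
    then have "(flat_exp n has_real_derivative 0) (at t)"
      by (rule has_field_derivative_transform_within_open[of _ _ _ "{..<0}"]) (use 2 in \<open>auto simp: flat_exp_def\<close>)
    then show ?thesis using 2 by (simp add: flat_exp_def)
  next
    case 3
    \<comment> \<open>At the origin the difference quotient of \<open>flat_exp n\<close> is
      \<open>flat_exp (Suc n)\<close>, which tends to 0.\<close>
    have "((\<lambda>h. flat_exp n h / h) \<longlongrightarrow> 0) (at 0)"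
    proof (rule Lim_transform_eventually[OF flat_exp_tendsto_0[of "Suc n"]])
      show "\<forall>\<^sub>F h in at 0. flat_exp (Suc n) h = flat_exp n h / h"
        by (simp add: eventually_at_filter flat_exp_def divide_inverse mult_ac)
    qed
    then show ?thesis using 3 by (simp add: DERIV_def) (simp add: flat_exp_def)
  qed
qed

lemma smooth_on_flat_exp: "smooth_on UNIV (flat_exp n)"
proof -
  have "Ck_on k UNIV (flat_exp n)" for k
  proof (induction k arbitrary: n)
    case 0
    have "continuous_on UNIV (flat_exp n)"
      by (intro continuous_at_imp_continuous_on ballI DERIV_isCont[OF flat_exp_has_derivative])
    then show ?case by simp
  next
    case (Suc k)
    show ?case
    proof (rule Ck_on_SucI[where f' = "\<lambda>t v. v *\<^sub>R flat_exp (n + 2) t + (- v * of_nat n) *\<^sub>R flat_exp (n + 1) t"])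
      show "(flat_exp n has_derivative (\<lambda>v. v *\<^sub>R flat_exp (n + 2) t + (- v * of_nat n) *\<^sub>R flat_exp (n + 1) t)) (at t)" for t
        using flat_exp_has_derivative[of n t] unfolding has_field_derivative_def
        by (rule has_derivative_eq_rhs) (simp add: fun_eq_iff algebra_simps)
      show "Ck_on k UNIV (\<lambda>t. v *\<^sub>R flat_exp (n + 2) t + (- v * of_nat n) *\<^sub>R flat_exp (n + 1) t)" for v
        by (intro Ck_on_add Ck_on_bounded_linear[OF bounded_linear_scaleR_right] Suc.IH open_UNIV)
    qed auto
  qed
  then show ?thesis by (simp add: smooth_on_def)
qed

text \<open>Compose \<open>flat_exp 0\<close> with r^2 - |q - p|^2 and divide by the value at p. The
  squared norm is taken because it is smooth at p as well.\<close>

lemma bump_function: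
  fixes p :: "'a::euclidean_space"
  assumes "r > 0"
  obtains \<psi> :: "'a \<Rightarrow> real" where "smooth_on UNIV \<psi>" "\<psi> p = 1" "\<And>q. q \<notin> cball p r \<Longrightarrow> \<psi> q = 0"
proof
  let ?h = "\<lambda>q. r\<^sup>2 - (q - p) \<bullet> (q - p)"
  let ?\<psi> = "\<lambda>q. (1 / flat_exp 0 (r\<^sup>2)) *\<^sub>R flat_exp 0 (?h q)"
  have l: "smooth_on UNIV (\<lambda>q. q - p)"
    using smooth_on_add[OF open_UNIV smooth_on_id smooth_on_const[of _ "-p"]] by simp
  have "smooth_on UNIV ?h"
    using smooth_on_add[OF open_UNIV smooth_on_const[of _ "r\<^sup>2"]
        smooth_on_bounded_linear[OF bounded_linear_minus[OF bounded_linear_ident] open_UNIV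
          smooth_on_bounded_bilinear[OF bounded_bilinear_inner open_UNIV l l]]] by simp
  then show "smooth_on UNIV ?\<psi>"
    by (intro smooth_on_bounded_linear[OF bounded_linear_scaleR_right]
        smooth_on_compose[OF _ _ _ smooth_on_flat_exp]) auto
  show "?\<psi> p = 1" using assms by (simp add: flat_exp_def)
  show "?\<psi> q = 0" if "q \<notin> cball p r" for q
  proof -
    have "r\<^sup>2 < (norm (q - p))\<^sup>2"
      using that assms by (intro power_strict_mono) (auto simp: dist_norm norm_minus_commute)
    then show ?thesis by (simp add: flat_exp_def power2_norm_eq_inner)
  qed
qed

section \<open>Calculus on manifolds\<close>

lemma lin_onD:
  assumes "lin_on V f"
  shows "u \<in> V \<Longrightarrow> v \<in> V \<Longrightarrow> f (u + v) = f u + f v" and "u \<in> V \<Longrightarrow> f (r *\<^sub>R u) = r *\<^sub>R f u"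
  using assms by (auto simp: lin_on_def)

lemma lin_on_uminus: "lin_on V f \<Longrightarrow> u \<in> V \<Longrightarrow> f (- u) = - f u"
  using lin_onD(2)[of V f u "-1"] by simp

lemma lin_on_zero: "lin_on V f \<Longrightarrow> u \<in> V \<Longrightarrow> f 0 = 0"
  using lin_onD(2)[of V f u 0] by simp

lemma lin_on_diff: "subspace V \<Longrightarrow> lin_on V f \<Longrightarrow> u \<in> V \<Longrightarrow> v \<in> V \<Longrightarrow> f (u - v) = f u - f v"
  using lin_onD(1)[of V f u "- v"] lin_on_uminus[of V f v] by (simp add: subspace_neg)

lemma lin_on_sum:
  assumes "subspace V" "lin_on V f" "finite I" "\<And>i. i \<in> I \<Longrightarrow> u i \<in> V"
  shows "f (\<Sum>i\<in>I. u i) = (\<Sum>i\<in>I. f (u i))"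
  using assms(3,4)
proof (induction I)
  case empty
  then show ?case using lin_on_zero[OF assms(2) subspace_0[OF assms(1)]] by simp
next
  case (insert i I)
  have "sum u I \<in> V" using insert.prems by (intro subspace_sum[OF assms(1)]) auto
  then show ?case using insert lin_onD(1)[OF assms(2), of "u i" "sum u I"] by simp
qed

locale oriented_manifold =
  fixes \<A> :: "'a::t2_space chart set"
  assumes atlas: "oriented_atlas \<A>"
begin

abbreviation T where "T \<equiv> tangent_space \<A>"

section \<open>Charts, and tangent spaces in coordinates\<close>

lemma chart_props:
  assumes "c \<in> \<A>"
  shows "open (fst c)" "open (snd c ` fst c)" "homeomorphism (fst c) (snd c ` fst c) (snd c) (chart_inv c)"
  using atlas assms by (auto simp: oriented_atlas_def is_chart_def)

lemma chart_inv_snd [simp]: "c \<in> \<A> \<Longrightarrow> x \<in> fst c \<Longrightarrow> chart_inv c (snd c x) = x"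
  using chart_props(3) by (auto simp: homeomorphism_def)

lemma ex_chart: "\<exists>c. c \<in> \<A> \<and> x \<in> fst c"
proof -
  have "(\<Union>c\<in>\<A>. fst c) = UNIV" using atlas unfolding oriented_atlas_def by blast
  then show ?thesis by blast
qed

lemma open_chart_image:
  assumes "c \<in> \<A>" "open V"
  shows "open (snd c ` (V \<inter> fst c))"
proof -
  have "openin (top_of_set (fst c)) (V \<inter> fst c)"
    using assms(2) by (metis inf_commute openin_open_Int)
  then have "openin (top_of_set (snd c ` fst c)) (snd c ` (V \<inter> fst c))"
    using homeomorphism_imp_open_map chart_props(3)[OF assms(1)] by blast
  then show ?thesis using chart_props(2)[OF assms(1)] openin_open_trans by blast
qed

lemma smooth_transition:
  assumes "c \<in> \<A>" "d \<in> \<A>" shows "smooth_on (snd c ` (fst c \<inter> fst d)) (transition c d)"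
  using atlas assms by (auto simp: oriented_atlas_def)

lemma open_overlap: "c \<in> \<A> \<Longrightarrow> d \<in> \<A> \<Longrightarrow> open (snd c ` (fst c \<inter> fst d))"
  using open_chart_image[of c "fst d"] chart_props(1)[of d] by (simp add: Int_commute)

lemma transition_has_derivative:
  assumes "c \<in> \<A>" "d \<in> \<A>" "x \<in> fst c" "x \<in> fst d"
  shows "(transition c d has_derivative frechet_derivative (transition c d) (at (snd c x))) (at (snd c x))"
  using smooth_on_has_derivative[OF open_overlap smooth_transition] assms by blast

lemma transition_self:
  assumes "c \<in> \<A>" "x \<in> fst c"
  shows "frechet_derivative (transition c c) (at (snd c x)) w = w"
proof -
  have "(transition c c has_derivative (\<lambda>w. w)) (at (snd c x))"
    by (rule has_derivative_transform_within_open[OF has_derivative_ident chart_props(2)[OF assms(1)]])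
      (use assms in \<open>auto simp: transition_def\<close>)
  then show ?thesis by (metis frechet_derivative_at)
qed

text \<open>The chain rule; the composite of two transition maps equals the third one only on the
  overlap, which is open, and that suffices for the derivative at the point.\<close>

lemma transition_cocycle:
  assumes "c \<in> \<A>" "d \<in> \<A>" "e \<in> \<A>" "x \<in> fst c" "x \<in> fst d" "x \<in> fst e"
  shows "frechet_derivative (transition d e) (at (snd d x)) (frechet_derivative (transition c d) (at (snd c x)) w)
    = frechet_derivative (transition c e) (at (snd c x)) w"
proof -
  have eq: "transition c d (snd c x) = snd d x" using assms by (simp add: transition_def)
  have "(transition d e \<circ> transition c d has_derivative
     frechet_derivative (transition d e) (at (snd d x)) \<circ> frechet_derivative (transition c d) (at (snd c x))) (at (snd c x))"
    using diff_chain_at[OF transition_has_derivative[of c d x] , of "transition d e"]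
      transition_has_derivative[of d e x] assms eq by simp
  then have "(transition c e has_derivative
     frechet_derivative (transition d e) (at (snd d x)) \<circ> frechet_derivative (transition c d) (at (snd c x))) (at (snd c x))"
    by (rule has_derivative_transform_within_open[OF _ open_overlap[of c d]])
      (use assms in \<open>auto simp: transition_def\<close>)
  then have "frechet_derivative (transition c e) (at (snd c x)) = frechet_derivative (transition d e) (at (snd d x)) \<circ> frechet_derivative (transition c d) (at (snd c x))"
    using frechet_derivative_at by metis
  then show ?thesis by simp
qed

text \<open>Inverse of reading off coordinates in the chart \<open>c\<close>: a tangent vector is
  determined by one coordinate vector, and the transition derivatives supply the others.\<close>

definition from_coords :: "'a chart \<Rightarrow> 'a \<Rightarrow> real ^ 4 \<Rightarrow> 'a tvec" where
  "from_coords c x w = (\<lambda>d. if d \<in> \<A> \<and> x \<in> fst d then frechet_derivative (transition c d) (at (snd c x)) w else 0)"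

lemma from_coords_in [simp]: "c \<in> \<A> \<Longrightarrow> x \<in> fst c \<Longrightarrow> from_coords c x w \<in> T x"
  by (auto simp: tangent_space_def from_coords_def transition_cocycle)

lemma from_coords_same [simp]: "c \<in> \<A> \<Longrightarrow> x \<in> fst c \<Longrightarrow> from_coords c x w c = w"
  by (simp add: from_coords_def transition_self)

lemma from_coords_of:
  assumes "c \<in> \<A>" "x \<in> fst c" "v \<in> T x"
  shows "from_coords c x (v c) = v"
proof
  fix d
  show "from_coords c x (v c) d = v d"
  proof (cases "d \<in> \<A> \<and> x \<in> fst d")
    case True
    then have "v d = frechet_derivative (transition c d) (at (snd c x)) (v c)"
      using assms unfolding tangent_space_def by blast
    then show ?thesis using True by (simp add: from_coords_def)
  next
    case False
    then have "v d = 0" using assms(3) unfolding tangent_space_def by blast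
    then show ?thesis unfolding from_coords_def using False by auto
  qed
qed

lemma tangent_eqI: "c \<in> \<A> \<Longrightarrow> x \<in> fst c \<Longrightarrow> u \<in> T x \<Longrightarrow> v \<in> T x \<Longrightarrow> u c = v c \<Longrightarrow> u = v"
  by (metis from_coords_of)

lemma linear_from_coords:
  assumes "c \<in> \<A>" "x \<in> fst c"
  shows "linear (from_coords c x)"
proof -
  have lin: "linear (frechet_derivative (transition c d) (at (snd c x)))"
    if "d \<in> \<A>" "x \<in> fst d" for d
    using transition_has_derivative[of c d x] assms that has_derivative_linear by blast
  show ?thesis
    by (rule linearI) (auto simp: from_coords_def fun_eq_iff linear_add[OF lin] linear_scale[OF lin])
qed

lemma tangent_space_eq_range:
  assumes "c \<in> \<A>" "x \<in> fst c"
  shows "T x = range (from_coords c x)"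
proof
  show "T x \<subseteq> range (from_coords c x)"
    using from_coords_of[OF assms] by (metis rangeI subsetI)
qed (use assms in auto)

lemma subspace_T: "subspace (T x)"
proof -
  obtain c where c: "c \<in> \<A>" "x \<in> fst c" using ex_chart by blast
  show ?thesis
    unfolding tangent_space_eq_range[OF c] by (rule linear_subspace_image[OF linear_from_coords[OF c] subspace_UNIV])
qed

lemmas T_closed [simp] = subspace_0[OF subspace_T] subspace_add[OF subspace_T] subspace_scale[OF subspace_T]
  subspace_neg[OF subspace_T] subspace_diff[OF subspace_T]

lemma T_sum [simp]: "(\<And>i. i \<in> I \<Longrightarrow> u i \<in> T x) \<Longrightarrow> (\<Sum>i\<in>I. u i) \<in> T x"
  by (rule subspace_sum[OF subspace_T])

section \<open>Smooth functions on a manifold and their directional derivatives\<close>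

lemma smooth_fun_cong:
  assumes "open U" "\<And>x. x \<in> U \<Longrightarrow> f x = h x" "smooth_fun \<A> U f"
  shows "smooth_fun \<A> U h"
  unfolding smooth_fun_def
proof
  fix c assume c: "c \<in> \<A>"
  show "smooth_on (snd c ` (U \<inter> fst c)) (h \<circ> chart_inv c)"
    by (rule smooth_on_cong[OF open_chart_image[OF c assms(1)], of "f \<circ> chart_inv c"])
      (use assms c in \<open>auto simp: smooth_fun_def\<close>)
qed

lemma smooth_fun_subset: "smooth_fun \<A> U f \<Longrightarrow> V \<subseteq> U \<Longrightarrow> smooth_fun \<A> V f"
  unfolding smooth_fun_def by (meson Int_mono image_mono order_refl smooth_on_subset)

lemma smooth_fun_const [simp]: "smooth_fun \<A> U (\<lambda>x. a)"
  by (simp add: smooth_fun_def o_def)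

lemma smooth_fun_add: "open U \<Longrightarrow> smooth_fun \<A> U f \<Longrightarrow> smooth_fun \<A> U h \<Longrightarrow> smooth_fun \<A> U (\<lambda>x. f x + h x)"
  using smooth_on_add[OF open_chart_image] by (fastforce simp: smooth_fun_def o_def)

lemma smooth_fun_bounded_linear:
  "bounded_linear L \<Longrightarrow> open U \<Longrightarrow> smooth_fun \<A> U f \<Longrightarrow> smooth_fun \<A> U (\<lambda>x. L (f x))"
  using smooth_on_bounded_linear[OF _ open_chart_image] by (fastforce simp: smooth_fun_def o_def)

lemma smooth_fun_bounded_bilinear:
  "bounded_bilinear L \<Longrightarrow> open U \<Longrightarrow> smooth_fun \<A> U f \<Longrightarrow> smooth_fun \<A> U h \<Longrightarrow> smooth_fun \<A> U (\<lambda>x. L (f x) (h x))"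
  using smooth_on_bounded_bilinear[OF _ open_chart_image] by (fastforce simp: smooth_fun_def o_def)

lemma smooth_fun_sum:
  assumes "open U" "finite I" "\<And>i. i \<in> I \<Longrightarrow> smooth_fun \<A> U (f i)"
  shows "smooth_fun \<A> U (\<lambda>x. \<Sum>i\<in>I. f i x)"
  using assms(2,3) by (induction I) (auto intro: smooth_fun_add[OF assms(1)])

lemma smooth_fun_compose:
  fixes h :: "'b::euclidean_space \<Rightarrow> 'c::real_normed_vector"
  assumes "open U" "smooth_fun \<A> U f" "open S" "smooth_on S h" "f ` U \<subseteq> S"
  shows "smooth_fun \<A> U (\<lambda>x. h (f x))"
  unfolding smooth_fun_def o_def
proof
  fix c assume c: "c \<in> \<A>"
  show "smooth_on (snd c ` (U \<inter> fst c)) (\<lambda>x. h (f (chart_inv c x)))"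
    by (rule smooth_on_compose[OF open_chart_image[OF c assms(1)] assms(3) _ assms(4)])
      (use assms c in \<open>auto simp: smooth_fun_def o_def\<close>)
qed

text \<open>Serves to shrink a neighbourhood to the set where a Gram-Schmidt remainder does not
  vanish. Continuity is available only in charts, so openness is shown on each chart domain and the
  pieces are united.\<close>

lemma open_positive_set:
  fixes f :: "'a \<Rightarrow> real"
  assumes "open U" "smooth_fun \<A> U f"
  shows "open {x \<in> U. 0 < f x}"
proof -
  have "open {x \<in> U \<inter> fst c. 0 < f x}" if c: "c \<in> \<A>" for c
  proof -
    let ?I = "snd c ` (U \<inter> fst c)"
    have "continuous_on ?I (f \<circ> chart_inv c)"
      by (rule smooth_on_continuous) (use assms(2) c in \<open>auto simp: smooth_fun_def\<close>)
    then have "open (?I \<inter> (f \<circ> chart_inv c) -` {0<..})"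
      by (rule continuous_open_preimage[OF _ open_chart_image[OF c assms(1)]]) auto
    moreover have "continuous_on (fst c) (snd c)"
      using chart_props(3)[OF c] by (simp add: homeomorphism_def)
    ultimately have "open (fst c \<inter> snd c -` (?I \<inter> (f \<circ> chart_inv c) -` {0<..}))"
      using continuous_open_preimage[OF _ chart_props(1)[OF c]] by blast
    moreover have "fst c \<inter> snd c -` (?I \<inter> (f \<circ> chart_inv c) -` {0<..}) = {x \<in> U \<inter> fst c. 0 < f x}"
      using c by auto (metis chart_inv_snd)+
    ultimately show ?thesis by simp
  qed
  then have "open (\<Union>c\<in>\<A>. {x \<in> U \<inter> fst c. 0 < f x})" by blast
  moreover have "(\<Union>c\<in>\<A>. {x \<in> U \<inter> fst c. 0 < f x}) = {x \<in> U. 0 < f x}"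
    using ex_chart by blast
  ultimately show ?thesis by simp
qed

text \<open>All rules for \<open>dir_deriv\<close> are computed in the one chart that its definition
  selects at \<open>x\<close>; \<open>from_coords\<close> turns the coordinate vector back into a
  tangent vector.\<close>

lemma dir_deriv_eq:
  assumes "open V" "x \<in> V" "smooth_fun \<A> V f"
  defines "c \<equiv> SOME c. c \<in> \<A> \<and> x \<in> fst c"
  shows "((\<lambda>p. f (chart_inv c p)) has_derivative (\<lambda>w. dir_deriv \<A> f x (from_coords c x w))) (at (snd c x))"
proof -
  have c: "c \<in> \<A>" "x \<in> fst c" using someI_ex[OF ex_chart[of x]] by (auto simp: c_def)
  have "((f \<circ> chart_inv c) has_derivative frechet_derivative (f \<circ> chart_inv c) (at (snd c x))) (at (snd c x))"
    using smooth_on_has_derivative[OF open_chart_image[OF c(1) assms(1)]] assms c by (auto simp: smooth_fun_def)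
  then show ?thesis using c by (simp add: dir_deriv_def Let_def c_def[symmetric] o_def)
qed

lemma dir_derivI:
  fixes x
  defines "c \<equiv> SOME c. c \<in> \<A> \<and> x \<in> fst c"
  assumes "((\<lambda>p. f (chart_inv c p)) has_derivative D) (at (snd c x))"
  shows "dir_deriv \<A> f x v = D (v c)"
  using frechet_derivative_at[OF assms(2)] by (simp add: dir_deriv_def Let_def c_def[symmetric] o_def)

lemma some_chart:
  fixes x
  defines "c \<equiv> SOME c. c \<in> \<A> \<and> x \<in> fst c"
  shows "c \<in> \<A>" "x \<in> fst c"
  using someI_ex[OF ex_chart[of x]] by (auto simp: c_def)

lemma dir_deriv_const [simp]: "dir_deriv \<A> (\<lambda>x. a) x v = 0"
  by (subst dir_derivI[where D = "\<lambda>_. 0"]) auto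

lemma dir_deriv_cong:
  assumes "open V" "x \<in> V" "smooth_fun \<A> V f" "\<And>y. y \<in> V \<Longrightarrow> f y = h y" "v \<in> T x"
  shows "dir_deriv \<A> f x v = dir_deriv \<A> h x v"
proof -
  let ?c = "SOME c. c \<in> \<A> \<and> x \<in> fst c"
  have "((\<lambda>p. h (chart_inv ?c p)) has_derivative (\<lambda>w. dir_deriv \<A> f x (from_coords ?c x w))) (at (snd ?c x))"
    by (rule has_derivative_transform_within_open[OF dir_deriv_eq[OF assms(1-3)] open_chart_image[OF some_chart(1)[of x] assms(1)]])
      (use assms some_chart in auto)
  from dir_derivI[OF this] show ?thesis using some_chart assms by (simp add: from_coords_of)
qed

lemma dir_deriv_bounded_linear:
  assumes "bounded_linear L" "open V" "x \<in> V" "smooth_fun \<A> V f" "v \<in> T x"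
  shows "dir_deriv \<A> (\<lambda>y. L (f y)) x v = L (dir_deriv \<A> f x v)"
  using dir_derivI[OF bounded_linear.has_derivative[OF assms(1) dir_deriv_eq[OF assms(2,3,4)]]]
    some_chart assms by (simp add: from_coords_of)

lemma dir_deriv_bounded_bilinear:
  assumes "bounded_bilinear L" "open V" "x \<in> V" "smooth_fun \<A> V f" "smooth_fun \<A> V h" "v \<in> T x"
  shows "dir_deriv \<A> (\<lambda>y. L (f y) (h y)) x v = L (f x) (dir_deriv \<A> h x v) + L (dir_deriv \<A> f x v) (h x)"
  using dir_derivI[OF bounded_bilinear.FDERIV[OF assms(1) dir_deriv_eq[OF assms(2,3,4)] dir_deriv_eq[OF assms(2,3,5)]]]
    some_chart assms by (simp add: from_coords_of)

lemma lin_on_dir_deriv: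
  assumes "open V" "x \<in> V" "smooth_fun \<A> V f"
  shows "lin_on (T x) (dir_deriv \<A> f x)"
proof -
  let ?c = "SOME c. c \<in> \<A> \<and> x \<in> fst c"
  note D = has_derivative_linear[OF dir_deriv_eq[OF assms]]
  have *: "from_coords ?c x (v ?c) = v" if "v \<in> T x" for v
    using that some_chart by (simp add: from_coords_of)
  have "dir_deriv \<A> f x (u + v) = dir_deriv \<A> f x u + dir_deriv \<A> f x v" if "u \<in> T x" "v \<in> T x" for u v
    using linear_add[OF D, of "u ?c" "v ?c"] *[OF that(1)] *[OF that(2)] *[of "u + v"] that by simp
  moreover have "dir_deriv \<A> f x (r *\<^sub>R u) = r *\<^sub>R dir_deriv \<A> f x u" if "u \<in> T x" for r u
    using linear_scale[OF D, of r "u ?c"] *[OF that] *[of "r *\<^sub>R u"] that by simp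
  ultimately show ?thesis by (simp add: lin_on_def)
qed

section \<open>Vector fields: algebra, gluing and global extension\<close>

lemma vector_fieldD: "vector_field \<A> U X \<Longrightarrow> x \<in> U \<Longrightarrow> X x \<in> T x"
  by (simp add: vector_field_def)

lemma vector_field_cong:
  assumes "open U" "\<And>x. x \<in> U \<Longrightarrow> X x = Y x" "vector_field \<A> U X"
  shows "vector_field \<A> U Y"
  unfolding vector_field_def
proof (intro conjI ballI)
  fix c assume c: "c \<in> \<A>"
  show "smooth_on (snd c ` (U \<inter> fst c)) (\<lambda>p. Y (chart_inv c p) c)"
    by (rule smooth_on_cong[OF open_chart_image[OF c assms(1)], of "\<lambda>p. X (chart_inv c p) c"])
      (use assms c in \<open>auto simp: vector_field_def\<close>)
qed (use assms in \<open>auto simp: vector_field_def\<close>)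

lemma vector_field_subset: "vector_field \<A> U X \<Longrightarrow> V \<subseteq> U \<Longrightarrow> vector_field \<A> V X"
  unfolding vector_field_def by (meson Int_mono image_mono order_refl smooth_on_subset subsetD)

lemma vector_field_zero [simp]: "vector_field \<A> U (\<lambda>x. 0)"
  by (simp add: vector_field_def)

lemma vector_field_add:
  "open U \<Longrightarrow> vector_field \<A> U X \<Longrightarrow> vector_field \<A> U Y \<Longrightarrow> vector_field \<A> U (\<lambda>x. X x + Y x)"
  using smooth_on_add[OF open_chart_image] by (fastforce simp: vector_field_def)

lemma vector_field_scaleR:
  "open U \<Longrightarrow> smooth_fun \<A> U f \<Longrightarrow> vector_field \<A> U Y \<Longrightarrow> vector_field \<A> U (\<lambda>x. f x *\<^sub>R Y x)"
  using smooth_on_bounded_bilinear[OF bounded_bilinear_scaleR open_chart_image]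
  by (fastforce simp: vector_field_def smooth_fun_def o_def)

lemma vector_field_sum:
  assumes "open U" "finite I" "\<And>i. i \<in> I \<Longrightarrow> vector_field \<A> U (X i)"
  shows "vector_field \<A> U (\<lambda>x. \<Sum>i\<in>I. X i x)"
  using assms(2,3) by (induction I) (auto intro: vector_field_add[OF assms(1)])

lemma vector_field_local:
  assumes "open U" "\<And>x. x \<in> U \<Longrightarrow> \<exists>V. open V \<and> x \<in> V \<and> vector_field \<A> V X"
  shows "vector_field \<A> U X"
  unfolding vector_field_def
proof (intro conjI ballI)
  fix c assume c: "c \<in> \<A>"
  show "smooth_on (snd c ` (U \<inter> fst c)) (\<lambda>p. X (chart_inv c p) c)"
  proof (rule smooth_on_local[OF open_chart_image[OF c assms(1)]])
    fix p assume "p \<in> snd c ` (U \<inter> fst c)"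
    then obtain x where x: "x \<in> U" "x \<in> fst c" "p = snd c x" by auto
    then obtain V where "open V" "x \<in> V" "vector_field \<A> V X" using assms(2) by blast
    then show "\<exists>W. open W \<and> p \<in> W \<and> smooth_on W (\<lambda>p. X (chart_inv c p) c)"
      using x c by (intro exI[of _ "snd c ` (V \<inter> fst c)"]) (auto simp: open_chart_image vector_field_def)
  qed
qed (use assms(2) vector_fieldD in blast)

lemma smooth_fun_chart_compose:
  assumes "c \<in> \<A>" "smooth_on (snd c ` fst c) h"
  shows "smooth_fun \<A> (fst c) (\<lambda>x. h (snd c x))"
  unfolding smooth_fun_def
proof
  fix d assume d: "d \<in> \<A>"
  have "smooth_on (snd d ` (fst d \<inter> fst c)) (\<lambda>p. h (transition d c p))"
    by (rule smooth_on_compose[OF open_overlap[OF d assms(1)] chart_props(2)[OF assms(1)] _ assms(2) smooth_transition[OF d assms(1)]])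
      (use d in \<open>auto simp: transition_def\<close>)
  then show "smooth_on (snd d ` (fst c \<inter> fst d)) ((\<lambda>x. h (snd c x)) \<circ> chart_inv d)"
    by (simp add: o_def transition_def Int_commute)
qed

lemma vector_field_from_coords:
  assumes "c \<in> \<A>"
  shows "vector_field \<A> (fst c) (\<lambda>x. from_coords c x w)"
  unfolding vector_field_def
proof (intro conjI ballI)
  fix d assume d: "d \<in> \<A>"
  let ?D = "\<lambda>q. frechet_derivative (transition c d) (at q) w"
  have op: "open (snd d ` (fst d \<inter> fst c))" using open_overlap d assms by blast
  have "smooth_on (snd d ` (fst d \<inter> fst c)) (\<lambda>p. ?D (transition d c p))"
    by (rule smooth_on_compose[OF op open_overlap[OF assms d] _ smooth_on_frechet_derivative[OF smooth_transition[OF assms d]]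
          smooth_transition[OF d assms]])
      (use d in \<open>auto simp: transition_def\<close>)
  then have "smooth_on (snd d ` (fst d \<inter> fst c)) (\<lambda>p. from_coords c (chart_inv d p) w d)"
    by (rule smooth_on_cong[OF op, rotated]) (use d in \<open>auto simp: transition_def from_coords_def\<close>)
  then show "smooth_on (snd d ` (fst c \<inter> fst d)) (\<lambda>p. from_coords c (chart_inv d p) w d)"
    by (simp add: Int_commute)
qed (simp add: assms)

text \<open>Multiply the field with constant coordinates \<open>v c\<close> by a bump function
  supported in a closed ball inside the chart image. The result extends by 0, because the chart
  domain and the complement of the ball's preimage \<open>?K\<close> cover the manifold and the
  field is smooth on each of them.\<close>

lemma vector_field_extension:
  assumes "v \<in> T x"
  obtains Y where "vector_field \<A> UNIV Y" "Y x = v"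
proof -
  obtain c where c: "c \<in> \<A>" "x \<in> fst c" using ex_chart by blast
  have "snd c x \<in> snd c ` fst c" using c by blast
  then obtain r where r: "r > 0" "cball (snd c x) r \<subseteq> snd c ` fst c"
    using chart_props(2)[OF c(1)] open_contains_cball by meson
  obtain \<psi> where \<psi>: "smooth_on UNIV \<psi>" "\<psi> (snd c x) = (1::real)" "\<And>q. q \<notin> cball (snd c x) r \<Longrightarrow> \<psi> q = 0"
    using bump_function[OF r(1)] by blast
  let ?K = "chart_inv c ` cball (snd c x) r"
  have "continuous_on (cball (snd c x) r) (chart_inv c)"
    using chart_props(3)[OF c(1)] r(2) by (meson continuous_on_subset homeomorphism_def)
  then have "compact ?K" using compact_continuous_image compact_cball by blast
  \<comment> \<open>The Hausdorff property enters here: the compact set \<open>?K\<close> is closed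
    in the whole manifold and not just in the chart domain.\<close>
  then have K: "open (- ?K)" by (rule open_Compl[OF compact_imp_closed])
  define Y where "Y = (\<lambda>y. if y \<in> fst c then \<psi> (snd c y) *\<^sub>R from_coords c y (v c) else 0)"
  have "vector_field \<A> (fst c) Y"
    by (rule vector_field_cong[OF chart_props(1)[OF c(1)] _
        vector_field_scaleR[OF chart_props(1)[OF c(1)] smooth_fun_chart_compose[OF c(1) smooth_on_subset[OF \<psi>(1)]]
         vector_field_from_coords[OF c(1), of "v c"]]])
      (auto simp: Y_def)
  moreover have "vector_field \<A> (- ?K) Y"
  proof (rule vector_field_cong[OF K _ vector_field_zero])
    fix y assume "y \<in> - ?K"
    then have "snd c y \<notin> cball (snd c x) r" if "y \<in> fst c"
      using that c by (metis ComplD chart_inv_snd image_eqI)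
    then show "0 = Y y" using \<psi>(3) by (auto simp: Y_def)
  qed
  moreover have "y \<in> fst c \<or> y \<in> - ?K" for y
    using c r(2) chart_props(3)[OF c(1)] by (auto simp: homeomorphism_def)
  ultimately have "vector_field \<A> UNIV Y"
    by (intro vector_field_local) (use K chart_props(1)[OF c(1)] in auto)
  moreover have "Y x = v" using c \<psi> assms by (simp add: Y_def from_coords_of)
  ultimately show ?thesis by (rule that)
qed

end

section \<open>Quaternions\<close>

lemma vector_4 [simp]:
  "(vector [a, b, c, d] :: 'a::zero ^ 4) $ 1 = a" "(vector [a, b, c, d] :: 'a ^ 4) $ 2 = b"
  "(vector [a, b, c, d] :: 'a ^ 4) $ 3 = c" "(vector [a, b, c, d] :: 'a ^ 4) $ 4 = d"
  by (simp_all add: vector_def)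

lemma axis_4 [simp]:
  "axis (1::4) (a::real) $ 1 = a" "axis (1::4) (a::real) $ 2 = 0" "axis (1::4) (a::real) $ 3 = 0" "axis (1::4) (a::real) $ 4 = 0"
  "axis (2::4) (a::real) $ 1 = 0" "axis (2::4) (a::real) $ 2 = a" "axis (2::4) (a::real) $ 3 = 0" "axis (2::4) (a::real) $ 4 = 0"
  "axis (3::4) (a::real) $ 1 = 0" "axis (3::4) (a::real) $ 2 = 0" "axis (3::4) (a::real) $ 3 = a" "axis (3::4) (a::real) $ 4 = 0"
  "axis (4::4) (a::real) $ 1 = 0" "axis (4::4) (a::real) $ 2 = 0" "axis (4::4) (a::real) $ 3 = 0" "axis (4::4) (a::real) $ 4 = a"
  by (simp_all add: axis_def)

lemma quat_eq_iff: "(p :: quat) = q \<longleftrightarrow> p$1 = q$1 \<and> p$2 = q$2 \<and> p$3 = q$3 \<and> p$4 = q$4"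
  by (simp add: vec_eq_iff forall_4)

lemma quat_inner: "(p :: quat) \<bullet> q = p$1 * q$1 + p$2 * q$2 + p$3 * q$3 + p$4 * q$4"
  by (simp add: inner_vec_def sum_4)

lemma qmult_nth [simp]:
  "qmult p q $ 1 = p$1 * q$1 - p$2 * q$2 - p$3 * q$3 - p$4 * q$4"
  "qmult p q $ 2 = p$1 * q$2 + p$2 * q$1 + p$3 * q$4 - p$4 * q$3"
  "qmult p q $ 3 = p$1 * q$3 - p$2 * q$4 + p$3 * q$1 + p$4 * q$2"
  "qmult p q $ 4 = p$1 * q$4 + p$2 * q$3 - p$3 * q$2 + p$4 * q$1"
  by (simp_all add: qmult_def)

lemma q_units: "q_one = axis 1 1" "q_i = axis 2 1" "q_j = axis 3 1"
  by (simp_all add: quat_eq_iff q_one_def q_i_def q_j_def)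

lemma bounded_bilinear_qmult: "bounded_bilinear qmult"
proof -
  have "bilinear qmult"
    by (auto simp: bilinear_def quat_eq_iff algebra_simps intro!: linearI)
  then show ?thesis by (simp add: bilinear_conv_bounded_bilinear)
qed

interpretation qmult: bounded_bilinear qmult
  by (rule bounded_bilinear_qmult)

lemma qmult_assoc: "qmult (qmult p q) r = qmult p (qmult q r)"
  by (simp add: quat_eq_iff algebra_simps)

lemma qmult_one [simp]: "qmult (axis 1 1) p = p" "qmult p (axis 1 1) = p"
  by (simp_all add: quat_eq_iff)

lemma qmult_inner_left: "qmult a p \<bullet> qmult a q = (a \<bullet> a) * (p \<bullet> q)"
  by (simp add: quat_inner algebra_simps)

lemma qmult_inner_right: "qmult p a \<bullet> qmult q a = (p \<bullet> q) * (a \<bullet> a)"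
  by (simp add: quat_inner algebra_simps)

text \<open>Polarisation of \<open>qmult_inner_right\<close> in the common right factor.\<close>

lemma qmult_inner_polar: "qmult a u \<bullet> qmult p v + qmult a v \<bullet> qmult p u = 2 * (a \<bullet> p) * (u \<bullet> v)"
  by (simp add: quat_inner algebra_simps)

lemma quat_expand: "(y :: quat) = (\<Sum>k\<in>UNIV. y $ k *\<^sub>R axis k 1)"
  by (simp add: quat_eq_iff sum_4)

subsection \<open>Skew endomorphisms\<close>

text \<open>The splitting of so(4) into two copies of su(2). If l k is the image of the k-th unit
  under y \<mapsto> p y - y m with imaginary p and m, then l 1 = p - m, while l 3 $ 4, l 4 $ 2 and l
  2 $ 3 are the components of p + m. Half the sum gives p, which is this definition, and half the
  difference gives m, which is \<open>skew_minus\<close>.\<close>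

definition skew_plus :: "(4 \<Rightarrow> quat) \<Rightarrow> quat" where
  "skew_plus l = vector [0, (l 1 $ 2 + l 3 $ 4) / 2, (l 1 $ 3 - l 2 $ 4) / 2, (l 1 $ 4 + l 2 $ 3) / 2]"

definition skew_minus :: "(4 \<Rightarrow> quat) \<Rightarrow> quat" where
  "skew_minus l = vector [0, (l 3 $ 4 - l 1 $ 2) / 2, (- l 2 $ 4 - l 1 $ 3) / 2, (l 2 $ 3 - l 1 $ 4) / 2]"

lemma skew_im [simp]: "skew_plus l \<in> im_quat" "skew_minus l \<in> im_quat"
  by (simp_all add: skew_plus_def skew_minus_def im_quat_def)

lemma skew_decomposition:
  assumes "\<And>j k. l j $ k = - (l k $ j)"
  shows "qmult (skew_plus l) (axis k 1) - qmult (axis k 1) (skew_minus l) = l k"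
proof -
  have d: "l j $ j = 0" for j using assms[of j j] by simp
  show ?thesis
    using exhaust_4[of k] assms[of 2 1] assms[of 3 1] assms[of 4 1] assms[of 3 2] assms[of 4 2] assms[of 4 3]
    by (elim disjE) (simp_all add: quat_eq_iff d skew_plus_def skew_minus_def field_simps)
qed

lemma skew_decomposition_unique:
  assumes "p \<in> im_quat" "m \<in> im_quat" "p' \<in> im_quat" "m' \<in> im_quat"
    and "\<And>k. qmult p (axis k 1) - qmult (axis k 1) m = qmult p' (axis k 1) - qmult (axis k 1) m'"
  shows "p = p'" "m = m'"
  using assms(1-4) assms(5)[of 1] assms(5)[of 2] assms(5)[of 3]
  by (auto simp: quat_eq_iff im_quat_def)

subsection \<open>Rotations of the quaternions\<close>

lemma det_4:
  "det (A::real^4^4) =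
    A$1$1 * (A$2$2 * (A$3$3 * A$4$4 - A$3$4 * A$4$3) - A$2$3 * (A$3$2 * A$4$4 - A$3$4 * A$4$2) + A$2$4 * (A$3$2 * A$4$3 - A$3$3 * A$4$2))
  - A$1$2 * (A$2$1 * (A$3$3 * A$4$4 - A$3$4 * A$4$3) - A$2$3 * (A$3$1 * A$4$4 - A$3$4 * A$4$1) + A$2$4 * (A$3$1 * A$4$3 - A$3$3 * A$4$1))
  + A$1$3 * (A$2$1 * (A$3$2 * A$4$4 - A$3$4 * A$4$2) - A$2$2 * (A$3$1 * A$4$4 - A$3$4 * A$4$1) + A$2$4 * (A$3$1 * A$4$2 - A$3$2 * A$4$1))
  - A$1$4 * (A$2$1 * (A$3$2 * A$4$3 - A$3$3 * A$4$2) - A$2$2 * (A$3$1 * A$4$3 - A$3$3 * A$4$1) + A$2$3 * (A$3$1 * A$4$2 - A$3$2 * A$4$1))"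
proof -
  have f1: "finite {2::4, 3, 4}" "1 \<notin> {2::4, 3, 4}" by auto
  have f2: "finite {3::4, 4}" "2 \<notin> {3::4, 4}" by auto
  have f3: "finite {4::4}" "3 \<notin> {4::4}" by auto
  show ?thesis
    unfolding det_def UNIV_4
    unfolding sum_over_permutations_insert[OF f1]
    unfolding sum_over_permutations_insert[OF f2]
    unfolding sum_over_permutations_insert[OF f3]
    unfolding permutes_sing
    by (simp add: sign_swap_id sign_compose permutation_compose permutation_swap_id sign_id swap_id_eq algebra_simps)
qed

definition qcnj :: "quat \<Rightarrow> quat" where
  "qcnj q = vector [q$1, - q$2, - q$3, - q$4]"

lemma qcnj_nth [simp]: "qcnj q $ 1 = q$1" "qcnj q $ 2 = - q$2" "qcnj q $ 3 = - q$3" "qcnj q $ 4 = - q$4"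
  by (simp_all add: qcnj_def)

text \<open>Right multiplication by c has determinant |c|^4. As this is positive for nonzero c, a
  rotation may be divided by its value at 1 without losing the orientation.\<close>

lemma det_qmult_right: "det (\<chi> k. qmult (a k) c :: real^4^4) = (c \<bullet> c)\<^sup>2 * det (\<chi> k. a k)"
proof -
  let ?R = "\<chi> k. qmult (axis k 1) c :: real^4^4"
  have "(\<chi> k. qmult (a k) c) = (\<chi> k. a k) ** ?R"
  proof -
    have "qmult (a k) c $ i = (\<Sum>j\<in>UNIV. a k $ j * qmult (axis j 1) c $ i)" for k i
      using exhaust_4[of i] by (elim disjE) (simp_all add: sum_4 algebra_simps)
    then show ?thesis by (simp add: vec_eq_iff matrix_matrix_mult_def)
  qed
  then have "det (\<chi> k. qmult (a k) c :: real^4^4) = det (\<chi> k. a k) * det ?R" by (simp add: det_mul)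
  moreover have "det ?R = (c \<bullet> c)\<^sup>2"
    by (simp add: det_4 quat_inner power2_eq_square algebra_simps)
  ultimately show ?thesis by simp
qed

text \<open>For imaginary orthogonal P and Q the product N = P Q is their cross product, and the
  determinant is the triple product <S, N>. Since S is orthogonal to P and Q, it is parallel to N;
  both have length 1, so S = N or S = -N, and the orientation decides.\<close>

lemma im_orthonormal_product:
  fixes P Q S :: quat
  assumes "P$1 = 0" "Q$1 = 0" "S$1 = 0"
    and on: "P \<bullet> P = 1" "Q \<bullet> Q = 1" "S \<bullet> S = 1" "P \<bullet> Q = 0" "S \<bullet> P = 0" "S \<bullet> Q = 0"
    and pos: "0 < det (\<chi> k::4. if k = 1 then axis 1 1 else if k = 2 then P else if k = 3 then Q else S)"
  shows "qmult P Q = S"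
proof -
  define N where "N = qmult P Q"
  have "det (\<chi> k::4. if k = 1 then axis 1 1 else if k = 2 then P else if k = 3 then Q else S) = S \<bullet> N"
    using assms(1-3) by (simp add: det_4 quat_inner N_def algebra_simps)
  then have SN: "0 < S \<bullet> N" using pos by simp
  have N1: "N $ 1 = 0" using on(4) assms by (simp add: N_def quat_inner)
  have NN: "N \<bullet> N = 1" using qmult_inner_left[of P Q Q] on by (simp add: N_def)
  \<comment> \<open>The identity S x (P x Q) = P <S, Q> - Q <S, P>, whose right-hand side vanishes
    here. It feeds the Lagrange identity for S and N in the next step.\<close>
  have c: "S$3 * N$4 - S$4 * N$3 = P$2 * (S \<bullet> Q) - Q$2 * (S \<bullet> P)"
    "S$4 * N$2 - S$2 * N$4 = P$3 * (S \<bullet> Q) - Q$3 * (S \<bullet> P)"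
    "S$2 * N$3 - S$3 * N$2 = P$4 * (S \<bullet> Q) - Q$4 * (S \<bullet> P)"
    using assms(1-3) by (simp_all add: N_def quat_inner algebra_simps)
  have "(S \<bullet> N)\<^sup>2 = (S \<bullet> S) * (N \<bullet> N) - (S$3 * N$4 - S$4 * N$3)\<^sup>2 - (S$4 * N$2 - S$2 * N$4)\<^sup>2 - (S$2 * N$3 - S$3 * N$2)\<^sup>2"
    using assms(3) N1 by (simp add: quat_inner power2_eq_square algebra_simps)
  then have "(S \<bullet> N)\<^sup>2 = 1" unfolding c by (simp add: on NN)
  then have "S \<bullet> N = 1" using SN by (simp add: power2_eq_1_iff)
  then have "(N - S) \<bullet> (N - S) = 0" by (simp add: inner_diff_left inner_diff_right NN on inner_commute)
  then show ?thesis by (simp add: N_def)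
qed

text \<open>A rotation \<open>G\<close> has the form \<open>G y = \<rho>(y) G(1)\<close>, where orientation makes \<open>\<rho>\<close> an algebra
  automorphism.\<close>

lemma rotation_conjugates_left_mult:
  fixes G :: "quat \<Rightarrow> quat"
  assumes lin: "linear G" and iso: "\<And>u v. G u \<bullet> G v = u \<bullet> v"
    and pos: "0 < det (\<chi> k. G (axis k 1))"
  obtains q' where "\<And>y. G (qmult q' y) = qmult q (G y)"
proof -
  define a where "a k = G (axis k 1)" for k
  have on: "a j \<bullet> a k = (if j = k then 1 else 0)" for j k
    by (simp add: a_def iso inner_axis_axis)
  have inv: "qmult (qmult x (qcnj (a 1))) (a 1) = x" for x
  proof -
    have "qmult (qcnj (a 1)) (a 1) = axis 1 1"
      using on[of 1 1] by (simp add: quat_eq_iff quat_inner)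
    then show ?thesis by (simp add: qmult_assoc)
  qed
  \<comment> \<open>Division by the unit quaternion G(1) on the right, which makes the image of 1
    equal to 1 and those of i, j, k imaginary.\<close>
  define b where "b k = qmult (a k) (qcnj (a 1))" for k
  have cc: "qcnj (a 1) \<bullet> qcnj (a 1) = 1" using on[of 1 1] by (simp add: quat_inner)
  have bon: "b j \<bullet> b k = (if j = k then 1 else 0)" for j k
    by (simp add: b_def qmult_inner_right cc on)
  have b1: "b 1 = axis 1 1" using on[of 1 1] by (simp add: b_def quat_eq_iff quat_inner)
  have b0: "b k $ 1 = 0" if "k \<noteq> 1" for k
    using bon[of k 1] that by (simp add: b1 quat_inner)
  have "0 < det (\<chi> k. b k)"
    using pos unfolding b_def det_qmult_right cc a_def[symmetric] by simp
  also have "(\<chi> k. b k) = (\<chi> k::4. if k = 1 then axis 1 1 else if k = 2 then b 2 else if k = 3 then b 3 else b 4)"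
    using b1 by (simp add: vec_eq_iff forall_4)
  finally have b4: "qmult (b 2) (b 3) = b 4"
    by (intro im_orthonormal_product) (simp_all add: b0 bon)
  have sq: "qmult x x = - axis 1 1" if "x $ 1 = 0" "x \<bullet> x = 1" for x
    using that by (simp add: quat_eq_iff quat_inner algebra_simps)
  have s2: "qmult (b 2) (b 2) = - axis 1 1" and s3: "qmult (b 3) (b 3) = - axis 1 1"
    by (simp_all add: sq b0 bon)
  have anti: "qmult (b 3) (b 2) = - b 4"
    using bon[of 2 3] b0[of 2] b0[of 3] by (simp add: b4[symmetric] quat_eq_iff quat_inner algebra_simps)
  have t24: "qmult (b 2) (b 4) = - b 3"
    using qmult_assoc[of "b 2" "b 2" "b 3"] by (simp add: b4 s2 qmult.minus_left)
  have t43: "qmult (b 4) (b 3) = - b 2"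
    using qmult_assoc[of "b 2" "b 3" "b 3"] by (simp add: b4 s3 qmult.minus_right)
  have t34: "qmult (b 3) (b 4) = b 2"
    using qmult_assoc[of "b 3" "b 2" "b 3"] by (simp add: b4 anti t43 qmult.minus_left)
  have t42: "qmult (b 4) (b 2) = b 3"
    using qmult_assoc[of "b 2" "b 3" "b 2"] by (simp add: b4 anti t24 qmult.minus_right)
  have t44: "qmult (b 4) (b 4) = - axis 1 1" by (simp add: sq b0 bon)
  define \<rho> where "\<rho> y = y$1 *\<^sub>R axis 1 1 + y$2 *\<^sub>R b 2 + y$3 *\<^sub>R b 3 + y$4 *\<^sub>R b 4" for y :: quat
  have hom: "\<rho> (qmult x y) = qmult (\<rho> x) (\<rho> y)" for x y
    by (simp add: \<rho>_def qmult.add_left qmult.add_right qmult.scaleR_left qmult.scaleR_right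
        s2 s3 t24 t43 t34 t42 t44 b4 anti algebra_simps)
  have G: "G y = qmult (\<rho> y) (a 1)" for y
  proof -
    have "G y = (\<Sum>k\<in>UNIV. y $ k *\<^sub>R a k)"
      by (subst quat_expand) (simp add: linear_sum[OF lin] linear_scale[OF lin] a_def)
    also have "\<dots> = (\<Sum>k\<in>UNIV. y $ k *\<^sub>R qmult (b k) (a 1))"
      by (simp add: b_def inv)
    also have "\<dots> = qmult (\<rho> y) (a 1)"
      by (simp add: \<rho>_def sum_4 b1 qmult.add_left qmult.scaleR_left)
    finally show ?thesis .
  qed
  have "inj G"
  proof (rule injI)
    fix u v assume "G u = G v"
    then have "(u - v) \<bullet> (u - v) = 0"
      by (metis iso[of "u - v" "u - v"] linear_diff[OF lin] diff_self inner_zero_left)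
    then show "u = v" by simp
  qed
  then have "surj G" using lin linear_injective_imp_surjective by blast
  \<comment> \<open>This q' is the preimage of q under \<rho>; cancelling G(1), by multiplicativity
    of the norm, shows it.\<close>
  then obtain q' where "G q' = qmult q (a 1)" by (metis surjD)
  then have "qmult (\<rho> q') (a 1) = qmult q (a 1)" by (simp add: G)
  then have "qmult (\<rho> q' - q) (a 1) = 0" by (simp add: qmult.diff_left)
  then have "((\<rho> q' - q) \<bullet> (\<rho> q' - q)) * (a 1 \<bullet> a 1) = 0" by (metis inner_zero_left qmult_inner_right)
  then have "\<rho> q' = q" using on[of 1 1] by simp
  then have "G (qmult q' y) = qmult q (G y)" for y
    by (simp add: G hom qmult_assoc)
  then show ?thesis by (rule that)
qed

subsection \<open>Minimizing the norms over the shift of the connection form\<close>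

text \<open>If the linear part l were nonzero, moving from 0 a little in the direction -l would
  lower the value, because \<open>R\<close> is of second order there. Homogeneity along rays is the
  only quadratic property of \<open>R\<close> in play.\<close>

lemma quadratic_minimum_iff:
  fixes l :: "'n::finite \<Rightarrow> real" and R :: "('n \<Rightarrow> real) \<Rightarrow> real"
  assumes "\<And>b. 0 \<le> R b" "\<And>t b. R (\<lambda>j. t * b j) = t\<^sup>2 * R b"
  shows "(\<forall>b. N \<le> N + (\<Sum>j\<in>UNIV. b j * l j) + R b) \<longleftrightarrow> (\<forall>j. l j = 0)"
proof
  assume min: "\<forall>b. N \<le> N + (\<Sum>j\<in>UNIV. b j * l j) + R b"
  let ?s = "\<Sum>j\<in>UNIV. (l j)\<^sup>2"
  have *: "0 \<le> t * ?s + t\<^sup>2 * R l" for t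
    using min[rule_format, of "\<lambda>j. t * l j"] by (simp add: assms(2) sum_distrib_left power2_eq_square mult.assoc)
  have "?s \<le> 0"
  proof (rule ccontr)
    assume s: "\<not> ?s \<le> 0"
    \<comment> \<open>The polynomial t s + t^2 R l has its minimum at -s / (2 R l); adding 1 in the
      denominator admits R l = 0 and keeps the value negative.\<close>
    define t where "t = - ?s / (2 * (R l + 1))"
    have R: "R l \<ge> 0" by (rule assms)
    have "t * ?s + t\<^sup>2 * R l = t * (?s + t * R l)" by (simp add: power2_eq_square algebra_simps)
    also have "\<dots> < 0"
    proof (rule mult_neg_pos)
      show "t < 0" using s R by (simp add: t_def field_simps)
      have "t * R l = - ?s * (R l / (2 * (R l + 1)))" by (simp add: t_def)
      moreover have "R l / (2 * (R l + 1)) < 1" using R by simp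
      ultimately show "0 < ?s + t * R l"
        using s mult_strict_left_mono[of "R l / (2 * (R l + 1))" 1 ?s] by linarith
    qed
    finally show False using *[of t] by simp
  qed
  then have "?s = 0" using sum_nonneg[of UNIV "\<lambda>j. (l j)\<^sup>2"] by simp
  then show "\<forall>j. l j = 0" by (simp add: sum_nonneg_eq_0_iff)
qed (use assms(1) in auto)

text \<open>The squared tensor norm in a frame, after a chart isometry has carried the values to the
  quaternions.\<close>

definition sqn :: "(4 \<Rightarrow> 4 \<Rightarrow> quat) \<Rightarrow> real" where
  "sqn S = (\<Sum>j\<in>UNIV. \<Sum>k\<in>UNIV. S j k \<bullet> S j k)"

lemma sqn_add: "sqn (\<lambda>j k. S j k + R j k) = sqn S + (\<Sum>j\<in>UNIV. \<Sum>k\<in>UNIV. 2 * (S j k \<bullet> R j k)) + sqn R"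
  by (simp add: sqn_def inner_add_left inner_add_right inner_commute sum.distrib)

lemma sqn_minimum_iff:
  fixes l :: "'n::finite \<Rightarrow> real"
  assumes "\<And>b. (\<Sum>j\<in>UNIV. \<Sum>k\<in>UNIV. 2 * (S j k \<bullet> R b j k)) = (\<Sum>j\<in>UNIV. b j * l j)"
    and "\<And>t b j k. R (\<lambda>j. t * b j) j k = t *\<^sub>R R b j k"
  shows "(\<forall>b. sqn S \<le> sqn (\<lambda>j k. S j k + R b j k)) \<longleftrightarrow> (\<forall>j. l j = 0)"
  unfolding sqn_add assms(1)
  by (rule quadratic_minimum_iff[where R = "\<lambda>b. sqn (R b)"])
    (simp_all add: assms(2) sqn_def sum_nonneg sum_distrib_left power2_eq_square mult.assoc)

context
  fixes f Q :: "4 \<Rightarrow> quat" and p :: quat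
  assumes on: "\<And>j k. f j \<bullet> f k = (if j = k then 1 else 0)"
begin

lemma B_minimum_iff:
  "(\<forall>b. sqn (\<lambda>j k. qmult (Q j) (f k)) \<le> sqn (\<lambda>j k. qmult (Q j + b j *\<^sub>R p) (f k))) \<longleftrightarrow> (\<forall>j. Q j \<bullet> p = 0)"
proof -
  \<comment> \<open>Each of the four unit vectors f k contributes <Q j, p>; with the factor 2 of the
    cross term this makes 8.\<close>
  have "(\<Sum>j\<in>UNIV. \<Sum>k\<in>UNIV. 2 * (qmult (Q j) (f k) \<bullet> (b j *\<^sub>R qmult p (f k)))) = (\<Sum>j\<in>UNIV. b j * (8 * (Q j \<bullet> p)))" for b
    by (simp add: qmult_inner_right on sum_4 algebra_simps)
  from sqn_minimum_iff[OF this] show ?thesis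
    by (simp add: qmult.add_left qmult.scaleR_left)
qed

text \<open>Exchange f j and f k by \<open>qmult_inner_polar\<close>. The symmetric term survives
  only for k = j by orthonormality, and the exchanged terms add up to the trace, which is how the
  Dirac operator enters the criteria.\<close>

lemma trace_cross:
  "(\<Sum>k\<in>UNIV. qmult (Q k) (f j) \<bullet> qmult p (f k)) = 2 * (Q j \<bullet> p) - (\<Sum>k\<in>UNIV. qmult (Q k) (f k)) \<bullet> qmult p (f j)"
proof -
  have "(\<Sum>k\<in>UNIV. qmult (Q k) (f j) \<bullet> qmult p (f k)) = (\<Sum>k\<in>UNIV. 2 * (Q k \<bullet> p) * (f j \<bullet> f k) - qmult (Q k) (f k) \<bullet> qmult p (f j))"
    by (intro sum.cong) (auto simp flip: qmult_inner_polar)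
  also have "\<dots> = (\<Sum>k\<in>UNIV. 2 * (Q k \<bullet> p) * (f j \<bullet> f k)) - (\<Sum>k\<in>UNIV. qmult (Q k) (f k)) \<bullet> qmult p (f j)"
    by (simp add: sum_subtractf inner_sum_left)
  also have "(\<Sum>k\<in>UNIV. 2 * (Q k \<bullet> p) * (f j \<bullet> f k)) = 2 * (Q j \<bullet> p)"
    using exhaust_4[of j] by (auto simp: on sum_4)
  finally show ?thesis .
qed

text \<open>One computation for both cases: \<epsilon> = 1 is symmetrisation and \<epsilon> = -1
  alternation, which is all that \<epsilon> * \<epsilon> = 1 allows.\<close>

lemma twisted_cross:
  fixes \<epsilon> :: real
  assumes "\<epsilon> * \<epsilon> = 1"
  shows "(\<Sum>j\<in>UNIV. \<Sum>k\<in>UNIV. 2 * (((1/2) *\<^sub>R (qmult (Q j) (f k) + \<epsilon> *\<^sub>R qmult (Q k) (f j)))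
      \<bullet> ((1/2) *\<^sub>R (b j *\<^sub>R qmult p (f k) + \<epsilon> *\<^sub>R (b k *\<^sub>R qmult p (f j))))))
    = (\<Sum>j\<in>UNIV. b j * (4 * (Q j \<bullet> p) + \<epsilon> * (2 * (Q j \<bullet> p) - (\<Sum>k\<in>UNIV. qmult (Q k) (f k)) \<bullet> qmult p (f j))))"
    (is "?L = _")
proof -
  let ?u = "\<lambda>j k. b j * (qmult (Q j) (f k) \<bullet> qmult p (f k) + \<epsilon> * (qmult (Q k) (f j) \<bullet> qmult p (f k)))"
  have \<epsilon>: "\<epsilon> * (\<epsilon> * z) = z" for z by (metis assms mult.assoc mult_1)
  \<comment> \<open>Of the four products in a summand, the two with the factor b j form
    \<open>?u j k\<close> and the two with b k form \<open>?u k j\<close>. Renaming the indices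
    merges both halves.\<close>
  have "?L = (\<Sum>j\<in>UNIV. \<Sum>k\<in>UNIV. (1/2) * ?u j k + (1/2) * ?u k j)"
    by (intro sum.cong refl) (simp add: inner_add_left inner_add_right \<epsilon> algebra_simps)
  also have "\<dots> = (1/2) * (\<Sum>j\<in>UNIV. \<Sum>k\<in>UNIV. ?u j k) + (1/2) * (\<Sum>j\<in>UNIV. \<Sum>k\<in>UNIV. ?u k j)"
    by (simp only: sum.distrib sum_distrib_left)
  also have "(\<Sum>j\<in>UNIV. \<Sum>k\<in>UNIV. ?u k j) = (\<Sum>j\<in>UNIV. \<Sum>k\<in>UNIV. ?u j k)"
    by (rule sum.swap)
  also have "(1/2) * (\<Sum>j\<in>UNIV. \<Sum>k\<in>UNIV. ?u j k) + (1/2) * (\<Sum>j\<in>UNIV. \<Sum>k\<in>UNIV. ?u j k) = (\<Sum>j\<in>UNIV. \<Sum>k\<in>UNIV. ?u j k)"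
    by simp
  also have "\<dots> = (\<Sum>j\<in>UNIV. b j * ((\<Sum>k\<in>UNIV. qmult (Q j) (f k) \<bullet> qmult p (f k)) + \<epsilon> * (\<Sum>k\<in>UNIV. qmult (Q k) (f j) \<bullet> qmult p (f k))))"
    by (simp only: sum.distrib sum_distrib_left distrib_left)
  also have "\<dots> = (\<Sum>j\<in>UNIV. b j * (4 * (Q j \<bullet> p) + \<epsilon> * (2 * (Q j \<bullet> p) - (\<Sum>k\<in>UNIV. qmult (Q k) (f k)) \<bullet> qmult p (f j))))"
    by (simp add: trace_cross) (simp add: qmult_inner_right on)
  finally show ?thesis .
qed

lemma twisted_minimum_iff:
  fixes \<epsilon> :: real
  assumes "\<epsilon> * \<epsilon> = 1"
  shows "(\<forall>b. sqn (\<lambda>j k. (1/2) *\<^sub>R (qmult (Q j) (f k) + \<epsilon> *\<^sub>R qmult (Q k) (f j)))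
      \<le> sqn (\<lambda>j k. (1/2) *\<^sub>R (qmult (Q j + b j *\<^sub>R p) (f k) + \<epsilon> *\<^sub>R qmult (Q k + b k *\<^sub>R p) (f j))))
    \<longleftrightarrow> (\<forall>j. 4 * (Q j \<bullet> p) + \<epsilon> * (2 * (Q j \<bullet> p) - (\<Sum>k\<in>UNIV. qmult (Q k) (f k)) \<bullet> qmult p (f j)) = 0)"
proof -
  have eq: "(1/2) *\<^sub>R (qmult (Q j + b j *\<^sub>R p) (f k) + \<epsilon> *\<^sub>R qmult (Q k + b k *\<^sub>R p) (f j)) =
     (1/2) *\<^sub>R (qmult (Q j) (f k) + \<epsilon> *\<^sub>R qmult (Q k) (f j)) + (1/2) *\<^sub>R (b j *\<^sub>R qmult p (f k) + \<epsilon> *\<^sub>R (b k *\<^sub>R qmult p (f j)))" for b j k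
    by (simp add: qmult.add_left qmult.scaleR_left scaleR_add_right)
  show ?thesis
    unfolding eq by (rule sqn_minimum_iff[OF twisted_cross[OF assms]]) (simp add: scaleR_add_right algebra_simps)
qed

end

section \<open>Unitary frames and U(2)-charts\<close>

locale almost_hermitian_manifold = oriented_manifold \<A> for \<A> :: "'a::t2_space chart set" +
  fixes g :: "'a metric" and J :: "'a endo"
  assumes riemannian: "riemannian_metric \<A> g"
    and almost_complex: "almost_complex_structure \<A> J"
    and compat: "compatible \<A> g J"
begin

lemmas riemannian_conj = riemannian[unfolded riemannian_metric_def]

lemma lin_on_g: "u \<in> T x \<Longrightarrow> lin_on (T x) (g x u)"
  by (rule riemannian_conj[THEN conjunct1, rule_format])

lemma g_commute: "u \<in> T x \<Longrightarrow> v \<in> T x \<Longrightarrow> g x u v = g x v u"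
  by (rule riemannian_conj[THEN conjunct2, THEN conjunct1, rule_format])

lemma g_pos: "u \<in> T x \<Longrightarrow> u \<noteq> 0 \<Longrightarrow> 0 < g x u u"
  by (rule riemannian_conj[THEN conjunct2, THEN conjunct2, THEN conjunct1, rule_format])

lemma smooth_g: "open U \<Longrightarrow> vector_field \<A> U X \<Longrightarrow> vector_field \<A> U Y \<Longrightarrow> smooth_fun \<A> U (\<lambda>x. g x (X x) (Y x))"
  by (rule riemannian_conj[THEN conjunct2, THEN conjunct2, THEN conjunct2, rule_format]) simp

lemma g_add_right: "u \<in> T x \<Longrightarrow> v \<in> T x \<Longrightarrow> w \<in> T x \<Longrightarrow> g x u (v + w) = g x u v + g x u w"
  by (rule lin_onD(1)[OF lin_on_g])

lemma g_scaleR_right: "u \<in> T x \<Longrightarrow> v \<in> T x \<Longrightarrow> g x u (r *\<^sub>R v) = r * g x u v"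
  using lin_onD(2)[OF lin_on_g] by simp

lemma g_add_left: "u \<in> T x \<Longrightarrow> v \<in> T x \<Longrightarrow> w \<in> T x \<Longrightarrow> g x (v + w) u = g x v u + g x w u"
  using g_add_right g_commute by simp

lemma g_scaleR_left: "u \<in> T x \<Longrightarrow> v \<in> T x \<Longrightarrow> g x (r *\<^sub>R v) u = r * g x v u"
  using g_scaleR_right g_commute by simp

lemma g_minus_right: "u \<in> T x \<Longrightarrow> v \<in> T x \<Longrightarrow> g x u (- v) = - g x u v"
  by (rule lin_on_uminus[OF lin_on_g])

lemma g_minus_left: "u \<in> T x \<Longrightarrow> v \<in> T x \<Longrightarrow> g x (- v) u = - g x v u"
  using g_minus_right g_commute by simp

lemma g_diff_right: "u \<in> T x \<Longrightarrow> v \<in> T x \<Longrightarrow> w \<in> T x \<Longrightarrow> g x u (v - w) = g x u v - g x u w"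
  by (rule lin_on_diff[OF subspace_T lin_on_g])

lemma g_diff_left: "u \<in> T x \<Longrightarrow> v \<in> T x \<Longrightarrow> w \<in> T x \<Longrightarrow> g x (v - w) u = g x v u - g x w u"
  using g_diff_right g_commute by simp

lemma g_zero_right [simp]: "u \<in> T x \<Longrightarrow> g x u 0 = 0"
  by (rule lin_on_zero[OF lin_on_g])

lemma g_zero_left [simp]: "u \<in> T x \<Longrightarrow> g x 0 u = 0"
  using g_commute[of 0 x u] by simp

lemma g_sum_right:
  "u \<in> T x \<Longrightarrow> finite I \<Longrightarrow> (\<And>i. i \<in> I \<Longrightarrow> v i \<in> T x) \<Longrightarrow> g x u (\<Sum>i\<in>I. v i) = (\<Sum>i\<in>I. g x u (v i))"
  by (rule lin_on_sum[OF subspace_T lin_on_g])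

lemma g_eq_0D: "u \<in> T x \<Longrightarrow> g x u u = 0 \<Longrightarrow> u = 0"
  using g_pos by fastforce

lemmas J_conj = almost_complex[unfolded almost_complex_structure_def endomorphism_field_def]

lemma J_in [simp]: "u \<in> T x \<Longrightarrow> J x u \<in> T x"
  using J_conj[THEN conjunct1, THEN conjunct1, rule_format, THEN conjunct1] by (rule subsetD) simp

lemma J_J [simp]: "u \<in> T x \<Longrightarrow> J x (J x u) = - u"
  by (rule J_conj[THEN conjunct2, rule_format])

lemma vector_field_J: "open U \<Longrightarrow> vector_field \<A> U X \<Longrightarrow> vector_field \<A> U (\<lambda>x. J x (X x))"
  by (rule J_conj[THEN conjunct1, THEN conjunct2, rule_format]) simp

lemma g_J_J [simp]: "u \<in> T x \<Longrightarrow> v \<in> T x \<Longrightarrow> g x (J x u) (J x v) = g x u v"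
  by (rule compat[unfolded compatible_def, THEN conjunct1, rule_format])

lemma g_J_left: "u \<in> T x \<Longrightarrow> v \<in> T x \<Longrightarrow> g x (J x u) v = - g x u (J x v)"
  using g_J_J[of u x "J x v"] by (simp add: g_minus_right)

lemma g_J_self [simp]: "u \<in> T x \<Longrightarrow> g x u (J x u) = 0"
  using g_J_left[of u x u] g_commute[of u x "J x u"] by simp

section \<open>Orthonormal frames and the isometries they define\<close>

definition frame_at :: "'a \<Rightarrow> (4 \<Rightarrow> 'a tvec) \<Rightarrow> bool" where
  "frame_at x e \<longleftrightarrow> (\<forall>k. e k \<in> T x) \<and> (\<forall>j k. g x (e j) (e k) = (if j = k then 1 else 0))"

text \<open>Linear combinations of the frame, read in a chart, give a linear map of
  \<open>real ^ 4\<close> to itself. Pairing with the frame recovers the coefficients, so the map is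
  injective, hence onto, and the frame spans the tangent space.\<close>

lemma frame_expand:
  assumes "frame_at x e" "v \<in> T x"
  shows "v = (\<Sum>k\<in>UNIV. g x v (e k) *\<^sub>R e k)"
proof -
  obtain c where c: "c \<in> \<A>" "x \<in> fst c" using ex_chart by blast
  have e: "e k \<in> T x" and on: "g x (e j) (e k) = (if j = k then 1 else 0)" for j k
    using assms(1) by (auto simp: frame_at_def)
  have coeff: "g x (\<Sum>j\<in>UNIV. a $ j *\<^sub>R e j) (e k) = a $ k" for k and a :: quat
    using exhaust_4[of k] by (auto simp: g_add_left e g_scaleR_left on sum_4)
  let ?\<Phi> = "\<lambda>a :: quat. (\<Sum>k\<in>UNIV. a $ k *\<^sub>R e k) c"
  have sum_c: "?\<Phi> a = (\<Sum>k\<in>UNIV. a $ k *\<^sub>R e k c)" for a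
    by (simp add: sum_4)
  have "linear ?\<Phi>"
    unfolding sum_c by (intro linearI) (simp_all add: scaleR_add_left sum.distrib scaleR_sum_right)
  moreover have "inj ?\<Phi>"
  proof (rule injI)
    fix a b assume "?\<Phi> a = ?\<Phi> b"
    then have "(\<Sum>k\<in>UNIV. a $ k *\<^sub>R e k) = (\<Sum>k\<in>UNIV. b $ k *\<^sub>R e k)"
      by (intro tangent_eqI[OF c]) (simp_all add: e)
    then have "a $ k = b $ k" for k using coeff[of a k] coeff[of b k] by simp
    then show "a = b" by (simp add: vec_eq_iff)
  qed
  ultimately have "surj ?\<Phi>" using linear_injective_imp_surjective by blast
  then obtain a where "v c = ?\<Phi> a" by (rule surjE)
  then have "(\<Sum>k\<in>UNIV. a $ k *\<^sub>R e k) = v"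
    by (intro tangent_eqI[OF c]) (simp_all add: e assms(2) del: scaleR_fun_apply plus_fun_apply)
  then show ?thesis using coeff[of a] by auto
qed

lemma frame_inner:
  assumes "frame_at x e" "u \<in> T x" "v \<in> T x"
  shows "g x u v = (\<Sum>k\<in>UNIV. g x u (e k) * g x v (e k))"
proof -
  have e: "e k \<in> T x" for k using assms(1) by (auto simp: frame_at_def)
  have "g x u v = g x u (\<Sum>k\<in>UNIV. g x v (e k) *\<^sub>R e k)"
    using frame_expand[OF assms(1,3)] by simp
  also have "\<dots> = (\<Sum>k\<in>UNIV. g x v (e k) * g x u (e k))"
    by (simp add: g_sum_right g_scaleR_right assms e)
  finally show ?thesis by (simp add: mult.commute)
qed

text \<open>The orientation clause of \<open>compatible\<close> applies to \<open>e 1\<close> and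
  \<open>e 3\<close>, as \<open>e 3\<close> is a unit vector orthogonal to \<open>e 1\<close> and to
  \<open>J x (e 1) = e 2\<close>.\<close>

lemma positive_frame:
  assumes "frame_at x e" "J x (e 1) = e 2" "J x (e 3) = e 4"
  shows "positive_basis \<A> x (vector [e 1, e 2, e 3, e 4])"
proof -
  have e: "e k \<in> T x" and on: "g x (e j) (e k) = (if j = k then 1 else 0)" for j k
    using assms(1) by (auto simp: frame_at_def)
  have "e 1 \<noteq> 0" using on[of 1 1] e[of 1] by auto
  moreover have "e 3 \<notin> span {e 1, J x (e 1)}"
  proof
    assume "e 3 \<in> span {e 1, J x (e 1)}"
    then obtain a b where "e 3 = a *\<^sub>R e 1 + b *\<^sub>R e 2"
      unfolding assms(2) span_insert span_empty by (auto simp: algebra_simps)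
    then have "g x (e 3) (e 3) = g x (e 3) (a *\<^sub>R e 1 + b *\<^sub>R e 2)" by simp
    then show False by (simp add: g_add_right g_scaleR_right e on)
  qed
  ultimately show ?thesis
    using compat[unfolded compatible_def, THEN conjunct2, rule_format, of "e 1" x "e 3"] e assms(2,3) by simp
qed

text \<open>Coordinates in a unitary frame give an isometry by Parseval. They turn J into left
  multiplication by i because J is skew and sends \<open>e 1\<close>, \<open>e 3\<close> to
  \<open>e 2\<close>, \<open>e 4\<close>.\<close>

lemma frame_oriented_isometry:
  assumes fr: "frame_at x e" "J x (e 1) = e 2" "J x (e 3) = e 4"
  shows "oriented_isometry \<A> g x (\<lambda>v. \<chi> k. g x v (e k))"
    and "v \<in> T x \<Longrightarrow> (\<chi> k. g x (J x v) (e k)) = qmult q_i (\<chi> k. g x v (e k))"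
proof -
  have e: "e k \<in> T x" and on: "g x (e j) (e k) = (if j = k then 1 else 0)" for j k
    using fr(1) by (auto simp: frame_at_def)
  let ?F = "\<lambda>v. \<chi> k. g x v (e k)"
  have J: "J x (e 2) = - e 1" "J x (e 4) = - e 3" using J_J[OF e] fr by metis+
  show "(\<chi> k. g x (J x v) (e k)) = qmult q_i (\<chi> k. g x v (e k))" if "v \<in> T x"
    using that e by (simp add: quat_eq_iff q_i_def g_J_left fr J g_minus_right)
  show "oriented_isometry \<A> g x ?F"
    unfolding oriented_isometry_def
  proof (intro conjI allI impI ballI)
    show "lin_on (T x) ?F"
      by (simp add: lin_on_def vec_eq_iff g_add_left g_scaleR_left e)
    show "?F ` T x = UNIV"
    proof (intro set_eqI iffI)
      fix q :: quat
      have "?F (\<Sum>j\<in>UNIV. q $ j *\<^sub>R e j) = q"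
        by (simp add: quat_eq_iff g_add_left g_scaleR_left e on sum_4)
      moreover have "(\<Sum>j\<in>UNIV. q $ j *\<^sub>R e j) \<in> T x" by (simp add: e)
      ultimately show "q \<in> ?F ` T x" by force
    qed simp
    show "?F u \<bullet> ?F v = g x u v" if "u \<in> T x" "v \<in> T x" for u v
      using frame_inner[OF fr(1) that] by (simp add: inner_vec_def)
    fix b assume b: "positive_basis \<A> x b"
    obtain c where c: "c \<in> \<A>" "x \<in> fst c" using ex_chart by blast
    have bT: "b $ k \<in> T x" for k using b by (simp add: positive_basis_def)
    have "(b $ k) c = (\<Sum>j\<in>UNIV. ?F (b $ k) $ j *\<^sub>R e j c)" for k
      by (subst frame_expand[OF fr(1) bT]) (simp add: sum_4)
    then have "(\<chi> k. (b $ k) c) = (\<chi> k. ?F (b $ k)) ** (\<chi> k. e k c)"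
      by (simp add: vec_eq_iff matrix_matrix_mult_def)
    \<comment> \<open>Change of basis in a chart: the left side is positive by assumption and the
      last factor by \<open>positive_frame\<close>, so the remaining factor is positive too.\<close>
    then have "det (\<chi> k. (b $ k) c) = det (\<chi> k. ?F (b $ k)) * det (\<chi> k. e k c)"
      by (simp add: det_mul)
    moreover have "(\<chi> k. e k c) = (\<chi> k. (vector [e 1, e 2, e 3, e 4] $ k) c)"
      by (simp add: vec_eq_iff forall_4)
    then have "0 < det (\<chi> k. e k c)"
      using positive_frame[OF fr] c by (simp add: positive_basis_def)
    moreover have "0 < det (\<chi> k. (b $ k) c)" using b c by (simp add: positive_basis_def)
    ultimately show "0 < det (\<chi> k. ?F (b $ k))" by (simp add: zero_less_mult_iff)
  qed
qed

lemma smooth_normalize: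
  assumes "open U" "vector_field \<A> U X" "\<And>y. y \<in> U \<Longrightarrow> X y \<noteq> 0"
  obtains Y where "vector_field \<A> U Y" "\<And>y. y \<in> U \<Longrightarrow> g y (Y y) (Y y) = 1"
    "\<And>y. y \<in> U \<Longrightarrow> \<exists>r. Y y = r *\<^sub>R X y"
proof
  let ?n = "\<lambda>y. g y (X y) (X y)"
  let ?r = "\<lambda>y. ?n y powr (- 1/2)"
  have X: "X y \<in> T y" if "y \<in> U" for y using vector_fieldD[OF assms(2) that] .
  have n: "0 < ?n y" if "y \<in> U" for y using g_pos X assms(3) that by blast
  have "smooth_fun \<A> U ?r"
    by (rule smooth_fun_compose[OF assms(1) smooth_g[OF assms(1,2,2)] _ smooth_on_powr]) (use n in auto)
  then show "vector_field \<A> U (\<lambda>y. ?r y *\<^sub>R X y)"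
    by (rule vector_field_scaleR[OF assms(1) _ assms(2)])
  show "g y (?r y *\<^sub>R X y) (?r y *\<^sub>R X y) = 1" if "y \<in> U" for y
  proof -
    have "g y (?r y *\<^sub>R X y) (?r y *\<^sub>R X y) = ?r y * ?r y * ?n y"
      using X[OF that] by (simp add: g_scaleR_left g_scaleR_right)
    also have "?r y * ?r y = ?n y powr (-1)" by (simp flip: powr_add)
    also have "?n y powr (-1) * ?n y = 1" using n[OF that] by (simp add: powr_minus)
    finally show ?thesis .
  qed
qed auto

text \<open>Complex Gram-Schmidt on two coordinate fields. Only \<open>E 1\<close> and
  \<open>E 3\<close> need normalising, since J is an isometry with J v orthogonal to v and hence
  supplies \<open>E 2\<close> and \<open>E 4\<close>.\<close>

lemma exists_unitary_frame:
  obtains U E where "open U" "x \<in> U" "\<And>k::4. vector_field \<A> U (E k)"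
    "\<And>y. y \<in> U \<Longrightarrow> frame_at y (\<lambda>k. E k y)" "\<And>y. y \<in> U \<Longrightarrow> J y (E 1 y) = E 2 y"
    "\<And>y. y \<in> U \<Longrightarrow> J y (E 3 y) = E 4 y"
proof -
  obtain c where c: "c \<in> \<A>" "x \<in> fst c" using ex_chart by blast
  let ?U0 = "fst c"
  have U0: "open ?U0" using chart_props(1)[OF c(1)] .
  let ?X = "\<lambda>y. from_coords c y (axis 1 1)"
  have X: "vector_field \<A> ?U0 ?X" by (rule vector_field_from_coords[OF c(1)])
  have "?X y \<noteq> 0" if "y \<in> ?U0" for y
  proof
    assume "?X y = 0"
    then have "?X y c = 0" by simp
    then show False using c that by (simp add: axis_eq_0_iff)
  qed
  from smooth_normalize[OF U0 X this]
  obtain E1 where E1: "vector_field \<A> ?U0 E1" "\<And>y. y \<in> ?U0 \<Longrightarrow> g y (E1 y) (E1 y) = 1" by metis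
  let ?E2 = "\<lambda>y. J y (E1 y)"
  have E2: "vector_field \<A> ?U0 ?E2" by (rule vector_field_J[OF U0 E1(1)])
  have E1T: "E1 y \<in> T y" if "y \<in> ?U0" for y using vector_fieldD[OF E1(1) that] .
  \<comment> \<open>A dimension count yields coordinates \<open>w\<close> outside the complex line
    of \<open>E1\<close> at \<open>x\<close>, so that the projected field \<open>Z\<close> is
    nonzero there.\<close>
  have "dim {E1 x c, ?E2 x c} \<le> card {E1 x c, ?E2 x c}" by (rule dim_le_card') simp
  also have "\<dots> \<le> 2" by (simp add: card_insert_if)
  finally have "dim (span {E1 x c, ?E2 x c}) < DIM(real ^ 4)" by simp
  then have "span {E1 x c, ?E2 x c} \<noteq> UNIV" by (metis dim_UNIV less_irrefl)
  then obtain w where w: "w \<notin> span {E1 x c, ?E2 x c}" by blast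
  let ?W = "\<lambda>y. from_coords c y w"
  have W: "vector_field \<A> ?U0 ?W" by (rule vector_field_from_coords[OF c(1)])
  have WT: "?W y \<in> T y" if "y \<in> ?U0" for y using vector_fieldD[OF W that] .
  define Z where "Z y = ?W y + ((- g y (?W y) (E1 y)) *\<^sub>R E1 y + (- g y (?W y) (?E2 y)) *\<^sub>R ?E2 y)" for y
  have Z: "vector_field \<A> ?U0 Z"
    unfolding Z_def
    by (intro vector_field_add vector_field_scaleR U0 W E1(1) E2
        smooth_fun_bounded_linear[OF bounded_linear_minus[OF bounded_linear_ident]] smooth_g)
  have ZT: "Z y \<in> T y" if "y \<in> ?U0" for y using vector_fieldD[OF Z that] .
  have Z1: "g y (Z y) (E1 y) = 0" and Z2: "g y (Z y) (?E2 y) = 0" if "y \<in> ?U0" for y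
    using that E1T[OF that] WT[OF that] E1(2)[OF that] g_commute[of "?E2 y" y "E1 y"]
    by (simp_all add: Z_def g_add_left g_diff_left g_scaleR_left g_minus_left)
  \<comment> \<open>Independence of \<open>w\<close> was arranged only at \<open>x\<close>; it
    persists on this open set, the domain of the frame.\<close>
  define U where "U = {y \<in> ?U0. 0 < g y (Z y) (Z y)}"
  have U: "open U" unfolding U_def by (rule open_positive_set[OF U0 smooth_g[OF U0 Z Z]])
  have sub: "U \<subseteq> ?U0" by (auto simp: U_def)
  have "Z x \<noteq> 0"
  proof
    assume "Z x = 0"
    then have "Z x c = 0" by simp
    then have "w = g x (?W x) (E1 x) *\<^sub>R E1 x c + g x (?W x) (?E2 x) *\<^sub>R ?E2 x c"
      using c by (simp add: Z_def algebra_simps add_eq_0_iff)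
    also have "\<dots> \<in> span {E1 x c, ?E2 x c}"
      by (intro span_add span_scale span_base) auto
    finally show False using w by simp
  qed
  then have "x \<in> U" using c g_pos ZT by (simp add: U_def)
  have "Z y \<noteq> 0" if "y \<in> U" for y
    using that ZT[of y] by (auto simp: U_def)
  from smooth_normalize[OF U vector_field_subset[OF Z sub] this]
  obtain E3 where E3: "vector_field \<A> U E3" "\<And>y. y \<in> U \<Longrightarrow> g y (E3 y) (E3 y) = 1"
    "\<And>y. y \<in> U \<Longrightarrow> \<exists>r. E3 y = r *\<^sub>R Z y" by blast
  let ?E4 = "\<lambda>y. J y (E3 y)"
  have E4: "vector_field \<A> U ?E4" by (rule vector_field_J[OF U E3(1)])
  define E where "E k = (if k = 1 then E1 else if k = 2 then ?E2 else if k = 3 then E3 else ?E4)" for k :: 4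
  have Evals: "E 1 = E1" "E 2 = ?E2" "E 3 = E3" "E 4 = ?E4" by (simp_all add: E_def)
  show ?thesis
  proof (rule that[OF U \<open>x \<in> U\<close>])
    show "vector_field \<A> U (E k)" for k
      using exhaust_4[of k] vector_field_subset[OF E1(1) sub] vector_field_subset[OF E2 sub] E3(1) E4
      by (auto simp: Evals)
    show "J y (E 1 y) = E 2 y" "J y (E 3 y) = E 4 y" for y by (simp_all add: Evals)
    show "frame_at y (\<lambda>k. E k y)" if y: "y \<in> U" for y
    proof -
      have y0: "y \<in> ?U0" using sub y by blast
      have T13: "E1 y \<in> T y" "E3 y \<in> T y" using E1T[OF y0] vector_fieldD[OF E3(1) y] by auto
      obtain r where r: "E3 y = r *\<^sub>R Z y" using E3(3)[OF y] by blast
      have o: "g y (E3 y) (E1 y) = 0" "g y (E3 y) (?E2 y) = 0"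
        using Z1[OF y0] Z2[OF y0] ZT[OF y0] T13 by (simp_all add: r g_scaleR_left)
      have o': "g y (?E4 y) (E1 y) = 0" "g y (?E4 y) (?E2 y) = 0"
        using T13 o by (simp_all add: g_J_left g_minus_right)
      have cm: "g y (E1 y) (E3 y) = g y (E3 y) (E1 y)" "g y (?E2 y) (E3 y) = g y (E3 y) (?E2 y)"
        "g y (E1 y) (?E4 y) = g y (?E4 y) (E1 y)" "g y (?E2 y) (?E4 y) = g y (?E4 y) (?E2 y)"
        "g y (?E2 y) (E1 y) = g y (E1 y) (?E2 y)" "g y (?E4 y) (E3 y) = g y (E3 y) (?E4 y)"
        using g_commute T13 J_in by blast+
      show ?thesis
        unfolding frame_at_def forall_4 Evals
        using T13 o o' cm E1(2)[OF y0] E3(2)[OF y] by simp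
    qed
  qed
qed

lemma exists_u2_chart: "\<exists>U F. u2_chart \<A> g J U F \<and> x \<in> U"
proof -
  obtain U E where U: "open U" "x \<in> U" and E: "\<And>k::4. vector_field \<A> U (E k)"
    and fr: "\<And>y. y \<in> U \<Longrightarrow> frame_at y (\<lambda>k. E k y)" "\<And>y. y \<in> U \<Longrightarrow> J y (E 1 y) = E 2 y"
      "\<And>y. y \<in> U \<Longrightarrow> J y (E 3 y) = E 4 y"
    using exists_unitary_frame[of x] by metis
  let ?F = "\<lambda>y v. \<chi> k. g y v (E k y)"
  have "u2_chart \<A> g J U ?F"
    unfolding u2_chart_def
  proof (intro conjI ballI allI impI U(1))
    show "oriented_isometry \<A> g y (?F y)" if "y \<in> U" for y
      using frame_oriented_isometry(1)[OF fr[OF that]] .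
    show "?F y (J y v) = qmult q_i (?F y v)" if "y \<in> U" "v \<in> T y" for y v
      using frame_oriented_isometry(2)[OF fr[OF that(1)] that(2)] .
    fix V X assume V: "open V \<and> V \<subseteq> U \<and> vector_field \<A> V X"
    have eq: "?F y (X y) = (\<Sum>k\<in>UNIV. g y (X y) (E k y) *\<^sub>R axis k 1)" for y
      by (simp add: quat_eq_iff sum_4)
    show "smooth_fun \<A> V (\<lambda>y. ?F y (X y))"
      unfolding eq
      by (intro smooth_fun_sum smooth_fun_bounded_linear[OF bounded_linear_scaleR_left] smooth_g)
        (use V vector_field_subset[OF E] in auto)
  qed
  then show ?thesis using U by blast
qed

lemma oriented_isometryD:
  assumes "oriented_isometry \<A> g x F"
  shows "lin_on (T x) F" "F ` T x = UNIV" "u \<in> T x \<Longrightarrow> v \<in> T x \<Longrightarrow> F u \<bullet> F v = g x u v"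
    "positive_basis \<A> x e \<Longrightarrow> 0 < det (\<chi> k. F (e $ k))"
  using assms by (auto simp: oriented_isometry_def)

lemma oriented_isometry_inj:
  assumes "oriented_isometry \<A> g x F" "u \<in> T x" "v \<in> T x" "F u = F v"
  shows "u = v"
proof -
  note F = oriented_isometryD[OF assms(1)]
  have "F (u - v) = 0" using lin_on_diff[OF subspace_T F(1) assms(2,3)] assms(4) by simp
  then have "g x (u - v) (u - v) = 0" using F(3)[of "u - v" "u - v"] assms(2,3) by simp
  then show ?thesis using g_eq_0D[of "u - v" x] assms(2,3) by simp
qed

end

locale u2_chart_manifold = almost_hermitian_manifold \<A> g J
  for \<A> :: "'a::t2_space chart set" and g J +
  fixes U :: "'a set" and F :: "'a triv"
  assumes chart: "u2_chart \<A> g J U F"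
begin

lemma open_U: "open U" using chart by (simp add: u2_chart_def)

lemma isometry: "y \<in> U \<Longrightarrow> oriented_isometry \<A> g y (F y)"
  using chart by (simp add: u2_chart_def)

lemma F_J: "y \<in> U \<Longrightarrow> v \<in> T y \<Longrightarrow> F y (J y v) = qmult q_i (F y v)"
  using chart by (simp add: u2_chart_def)

lemma smooth_F: "open V \<Longrightarrow> V \<subseteq> U \<Longrightarrow> vector_field \<A> V X \<Longrightarrow> smooth_fun \<A> V (\<lambda>y. F y (X y))"
  using chart by (simp add: u2_chart_def)

lemmas lin_on_F = oriented_isometryD(1)[OF isometry]
  and F_inner = oriented_isometryD(3)[OF isometry]
  and F_inj = oriented_isometry_inj[OF isometry]

abbreviation Finv where "Finv \<equiv> triv_inv \<A> F"

lemma Finv_in [simp]: "y \<in> U \<Longrightarrow> Finv y q \<in> T y"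
  using oriented_isometryD(2)[OF isometry[of y]] inv_into_into[of q "F y" "T y"] by (simp add: triv_inv_def)

lemma F_Finv [simp]: "y \<in> U \<Longrightarrow> F y (Finv y q) = q"
  using oriented_isometryD(2)[OF isometry[of y]] f_inv_into_f[of q "F y" "T y"] by (simp add: triv_inv_def)

lemma Finv_F [simp]: "y \<in> U \<Longrightarrow> v \<in> T y \<Longrightarrow> Finv y (F y v) = v"
  using F_inj[of y "Finv y (F y v)" v] by simp

lemma linear_Finv:
  assumes "y \<in> U" shows "linear (Finv y)"
  by (rule linearI; rule F_inj[OF assms])
    (simp_all add: assms lin_onD(1)[OF lin_on_F[OF assms]] lin_onD(2)[OF lin_on_F[OF assms]])

text \<open>The vectors that the chart sends to 1, i, j, k, in the order of the indices 1 to
  4.\<close>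

definition E :: "4 \<Rightarrow> 'a \<Rightarrow> 'a tvec" where
  "E k y = Finv y (axis k 1)"

lemma E_in [simp]: "y \<in> U \<Longrightarrow> E k y \<in> T y"
  by (simp add: E_def)

lemma F_E [simp]: "y \<in> U \<Longrightarrow> F y (E k y) = axis k 1"
  by (simp add: E_def)

lemma frame_E: "y \<in> U \<Longrightarrow> frame_at y (\<lambda>k. E k y)"
proof -
  assume y: "y \<in> U"
  have "g y (E j y) (E k y) = axis j 1 \<bullet> axis k (1::real)" for j k
    using F_inner[OF y, of "E j y" "E k y"] y by simp
  then show ?thesis using y by (simp add: frame_at_def inner_axis_axis)
qed

lemma J_E: "y \<in> U \<Longrightarrow> J y (E 1 y) = E 2 y" "y \<in> U \<Longrightarrow> J y (E 3 y) = E 4 y"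
proof -
  show "J y (E 1 y) = E 2 y" if "y \<in> U"
    by (rule F_inj[OF that]) (use that in \<open>simp_all add: F_J quat_eq_iff q_i_def\<close>)
  show "J y (E 3 y) = E 4 y" if "y \<in> U"
    by (rule F_inj[OF that]) (use that in \<open>simp_all add: F_J quat_eq_iff q_i_def\<close>)
qed

lemma E_expand:
  assumes "y \<in> U" "v \<in> T y"
  shows "v = (\<Sum>k\<in>UNIV. F y v $ k *\<^sub>R E k y)"
proof -
  have "g y v (E k y) = F y v $ k" for k
    using F_inner[of y v "E k y"] assms by (simp add: inner_axis)
  then show ?thesis using frame_expand[OF frame_E[OF assms(1)] assms(2)] by simp
qed

text \<open>A U(2)-chart promises only that F maps smooth fields to smooth functions, which says
  nothing directly about its inverse. Against a local smooth orthonormal frame e, the coefficient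
  g(E k, e j) is the k-th component of F(e j) and thus smooth.\<close>

lemma vector_field_E: "vector_field \<A> U (E k)"
proof (rule vector_field_local[OF open_U])
  fix x assume x: "x \<in> U"
  obtain W e where W: "open W" "x \<in> W" and e: "\<And>k::4. vector_field \<A> W (e k)"
    and fr: "\<And>y. y \<in> W \<Longrightarrow> frame_at y (\<lambda>k. e k y)"
    using exists_unitary_frame[of x] by metis
  let ?V = "U \<inter> W"
  have V: "open ?V" using open_U W by blast
  have ev: "vector_field \<A> ?V (e j)" for j by (rule vector_field_subset[OF e]) blast
  have "vector_field \<A> ?V (\<lambda>y. \<Sum>j\<in>UNIV. F y (e j y) $ k *\<^sub>R e j y)"
    by (intro vector_field_sum vector_field_scaleR V ev smooth_fun_bounded_linear[OF bounded_linear_vec_nth] smooth_F) auto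
  then have "vector_field \<A> ?V (E k)"
  proof (rule vector_field_cong[OF V, rotated])
    fix y assume y: "y \<in> ?V"
    have "F y (e j y) $ k = g y (E k y) (e j y)" for j
      using F_inner[of y "E k y" "e j y"] y vector_fieldD[OF e, of y j] by (simp add: inner_axis')
    then show "(\<Sum>j\<in>UNIV. F y (e j y) $ k *\<^sub>R e j y) = E k y"
      using frame_expand[OF fr, of y "E k y"] y by simp
  qed
  then show "\<exists>V. open V \<and> x \<in> V \<and> vector_field \<A> V (E k)" using V x W by blast
qed

text \<open>Membership in \<open>wplus\<close> supplies an isometry \<open>F'\<close> of its own.
  Composed with the inverse of the chart it is a rotation of the quaternions, and rotations
  conjugate left multiplications into left multiplications; the quaternion changes with the
  isometry.\<close>

lemma wplus_left_mult:
  assumes x: "x \<in> U" and "\<psi> \<in> wplus \<A> g x"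
  obtains q where "\<And>v. v \<in> T x \<Longrightarrow> F x (\<psi> v) = qmult q (F x v)"
proof -
  obtain F' q where F': "oriented_isometry \<A> g x F'"
    and \<psi>: "\<And>v. v \<in> T x \<Longrightarrow> \<psi> v \<in> T x" "\<And>v. v \<in> T x \<Longrightarrow> F' (\<psi> v) = qmult q (F' v)"
    using assms(2) unfolding wplus_def by blast
  note F'_props = oriented_isometryD[OF F']
  define G where "G y = F' (Finv x y)" for y
  have lin: "linear G"
    by (rule linearI) (simp_all add: G_def linear_add[OF linear_Finv[OF x]] linear_scale[OF linear_Finv[OF x]]
        lin_onD(1)[OF F'_props(1)] lin_onD(2)[OF F'_props(1)] x)
  have iso: "G u \<bullet> G v = u \<bullet> v" for u v
    using F'_props(3)[of "Finv x u" "Finv x v"] F_inner[OF x, of "Finv x u" "Finv x v"] x by (simp add: G_def)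
  have "positive_basis \<A> x (vector [E 1 x, E 2 x, E 3 x, E 4 x])"
    by (rule positive_frame[OF frame_E[OF x] J_E[OF x]])
  from F'_props(4)[OF this]
  have "0 < det (\<chi> k. F' ((vector [E 1 x, E 2 x, E 3 x, E 4 x] :: ('a tvec) ^ 4) $ k))" .
  also have "(\<chi> k. F' ((vector [E 1 x, E 2 x, E 3 x, E 4 x] :: ('a tvec) ^ 4) $ k)) = (\<chi> k. G (axis k 1))"
    by (simp add: vec_eq_iff forall_4 G_def E_def)
  finally obtain q' where q': "\<And>y. G (qmult q' y) = qmult q (G y)"
    using rotation_conjugates_left_mult[OF lin iso] by metis
  show ?thesis
  proof (rule that)
    fix v assume v: "v \<in> T x"
    have "F' (\<psi> v) = F' (Finv x (qmult q' (F x v)))"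
      using q'[of "F x v"] \<psi>(2)[OF v] v x by (simp add: G_def)
    then have "\<psi> v = Finv x (qmult q' (F x v))"
      by (rule oriented_isometry_inj[OF F' \<psi>(1)[OF v] Finv_in[OF x]])
    then show "F x (\<psi> v) = qmult q' (F x v)" using x by simp
  qed
qed

end

section \<open>Connection forms\<close>

lemma connection_section:
  "connection \<A> \<Gamma> D \<Longrightarrow> open U \<Longrightarrow> \<Gamma> U s \<Longrightarrow> vector_field \<A> U X \<Longrightarrow> \<Gamma> U (\<lambda>x. D s x (X x))"
  by (drule connection_def[THEN iffD1, rule_format], assumption) (elim conjE, simp)

lemma connection_lin:
  "connection \<A> \<Gamma> D \<Longrightarrow> open U \<Longrightarrow> \<Gamma> U s \<Longrightarrow> x \<in> U \<Longrightarrow> lin_on (tangent_space \<A> x) (D s x)"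
  by (drule connection_def[THEN iffD1, rule_format], assumption) (elim conjE, simp)

lemma connection_add:
  "connection \<A> \<Gamma> D \<Longrightarrow> open U \<Longrightarrow> \<Gamma> U s \<Longrightarrow> \<Gamma> U t \<Longrightarrow> x \<in> U \<Longrightarrow> v \<in> tangent_space \<A> x \<Longrightarrow>
    D (\<lambda>y. s y + t y) x v = D s x v + D t x v"
  by (drule connection_def[THEN iffD1, rule_format], assumption) (elim conjE, simp)

lemma connection_leibniz:
  "connection \<A> \<Gamma> D \<Longrightarrow> open U \<Longrightarrow> smooth_fun \<A> U f \<Longrightarrow> \<Gamma> U s \<Longrightarrow> x \<in> U \<Longrightarrow> v \<in> tangent_space \<A> x \<Longrightarrow>
    D (\<lambda>y. f y *\<^sub>R s y) x v = dir_deriv \<A> f x v *\<^sub>R s x + f x *\<^sub>R D s x v"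
  by (drule connection_def[THEN iffD1, rule_format], assumption) (elim conjE, simp)

lemma connection_local:
  "connection \<A> \<Gamma> D \<Longrightarrow> open U \<Longrightarrow> \<Gamma> U s \<Longrightarrow> (\<And>y. y \<in> U \<Longrightarrow> s y = t y) \<Longrightarrow> x \<in> U \<Longrightarrow> v \<in> tangent_space \<A> x \<Longrightarrow>
    D s x v = D t x v"
  by (drule connection_def[THEN iffD1, rule_format], assumption) (elim conjE, blast)

context oriented_manifold
begin

lemmas vf_connection_section = connection_section[where \<A> = \<A> and \<Gamma> = "vector_field \<A>"]
  and vf_connection_lin = connection_lin[where \<A> = \<A> and \<Gamma> = "vector_field \<A>"]
  and vf_connection_add = connection_add[where \<A> = \<A> and \<Gamma> = "vector_field \<A>"]
  and vf_connection_leibniz = connection_leibniz[where \<A> = \<A> and \<Gamma> = "vector_field \<A>"]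
  and vf_connection_local = connection_local[where \<A> = \<A> and \<Gamma> = "vector_field \<A>"]

text \<open>The axioms of \<open>connection\<close> speak of values along vector fields, so a single
  vector is extended to a field before its value is known to be tangent.\<close>

lemma vector_connection_in:
  assumes "connection \<A> (vector_field \<A>) D" "open V" "vector_field \<A> V Y" "x \<in> V" "v \<in> T x"
  shows "D Y x v \<in> T x"
proof -
  obtain X where X: "vector_field \<A> UNIV X" "X x = v" using vector_field_extension[OF assms(5)] by blast
  have "vector_field \<A> V (\<lambda>y. D Y y (X y))"
    by (rule vf_connection_section[OF assms(1-3) vector_field_subset[OF X(1)]]) simp
  then show ?thesis using vector_fieldD[of V _ x] X(2) assms(4) by fastforce
qed

lemma vector_connection_sum:
  assumes D: "connection \<A> (vector_field \<A>) D" and "open V" "x \<in> V" "v \<in> T x" "finite I"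
    and "\<And>i. i \<in> I \<Longrightarrow> vector_field \<A> V (s i)"
  shows "D (\<lambda>y. \<Sum>i\<in>I. s i y) x v = (\<Sum>i\<in>I. D (s i) x v)"
  using assms(5,6)
proof (induction I)
  case empty
  have "D (\<lambda>y. 0 + 0) x v = D (\<lambda>y. 0) x v + D (\<lambda>y. 0) x v"
    by (rule vf_connection_add[OF D assms(2) _ _ assms(3,4)]) simp_all
  then have "D (\<lambda>y. 0) x v = 0" by simp
  then show ?case unfolding sum.empty .
next
  case (insert i I)
  have "D (\<lambda>y. s i y + (\<Sum>i\<in>I. s i y)) x v = D (s i) x v + D (\<lambda>y. \<Sum>i\<in>I. s i y) x v"
    by (rule vf_connection_add[OF D assms(2) _ vector_field_sum[OF assms(2)] assms(3,4)]) (use insert in auto)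
  also have "D (\<lambda>y. \<Sum>i\<in>I. s i y) x v = (\<Sum>i\<in>I. D (s i) x v)"
    by (rule insert.IH) (use insert.prems in auto)
  finally show ?case unfolding sum.insert[OF insert.hyps] .
qed

end

lemma levi_civita_connection: "levi_civita \<A> g nab \<Longrightarrow> connection \<A> (vector_field \<A>) nab"
  by (simp add: levi_civita_def)

lemma levi_civita_metric:
  assumes "levi_civita \<A> g nab" "open U" "vector_field \<A> U Y" "vector_field \<A> U Z" "x \<in> U" "v \<in> tangent_space \<A> x"
  shows "dir_deriv \<A> (\<lambda>y. g y (Y y) (Z y)) x v = g x (nab Y x v) (Z x) + g x (Y x) (nab Z x v)"
  using assms(1)[unfolded levi_civita_def, THEN conjunct2, rule_format, of U Y Z] assms(2-6) by blast

context u2_chart_manifold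
begin

definition lc_coeff :: "('a, 'a tvec) conn \<Rightarrow> 'a \<Rightarrow> 'a tvec \<Rightarrow> 4 \<Rightarrow> quat" where
  "lc_coeff nab x v k = F x (nab (E k) x v)"

text \<open>Differentiate the constant functions g(E j, E k).\<close>

lemma lc_coeff_skew:
  assumes lc: "levi_civita \<A> g nab" and x: "x \<in> U" and v: "v \<in> T x"
  shows "lc_coeff nab x v j $ k = - (lc_coeff nab x v k $ j)"
proof -
  have nT: "nab (E k) x v \<in> T x" for k
    by (rule vector_connection_in[OF levi_civita_connection[OF lc] open_U vector_field_E x v])
  have comp: "lc_coeff nab x v j $ k = g x (nab (E j) x v) (E k x)" for j k
    using F_inner[OF x nT[of j] E_in[OF x, of k]] x by (simp add: lc_coeff_def inner_axis)
  have "dir_deriv \<A> (\<lambda>y. if j = k then 1 else 0 :: real) x v = dir_deriv \<A> (\<lambda>y. g y (E j y) (E k y)) x v"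
    by (rule dir_deriv_cong[OF open_U x _ _ v]) (use frame_E in \<open>auto simp: frame_at_def\<close>)
  then have "g x (nab (E j) x v) (E k x) + g x (E j x) (nab (E k) x v) = 0"
    using levi_civita_metric[OF lc open_U vector_field_E vector_field_E x v, of j k] by simp
  then show ?thesis
    using comp[of j k] comp[of k j] g_commute[OF E_in[OF x] nT, of j k] by simp
qed

text \<open>Expand Y in the frame E and apply the Leibniz rule. The derivatives of the coefficients
  make up the derivative of F(Y); the rest is the skew endomorphism with columns
  \<open>lc_coeff\<close>, rewritten by \<open>skew_decomposition\<close>.\<close>

lemma nab_in_chart:
  assumes lc: "levi_civita \<A> g nab" and x: "x \<in> U" and v: "v \<in> T x"
    and V: "open V" "x \<in> V" "V \<subseteq> U" and Y: "vector_field \<A> V Y"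
  shows "F x (nab Y x v) = dir_deriv \<A> (\<lambda>y. F y (Y y)) x v
    + qmult (skew_plus (lc_coeff nab x v)) (F x (Y x)) - qmult (F x (Y x)) (skew_minus (lc_coeff nab x v))"
proof -
  note D = levi_civita_connection[OF lc]
  let ?p = "skew_plus (lc_coeff nab x v)" and ?m = "skew_minus (lc_coeff nab x v)"
  let ?f = "\<lambda>k y. F y (Y y) $ k"
  have FY: "smooth_fun \<A> V (\<lambda>y. F y (Y y))" by (rule smooth_F[OF V(1,3) Y])
  have f: "smooth_fun \<A> V (?f k)" for k
    by (rule smooth_fun_bounded_linear[OF bounded_linear_vec_nth V(1) FY])
  have Ek: "vector_field \<A> V (E k)" for k by (rule vector_field_subset[OF vector_field_E V(3)])
  have fE: "vector_field \<A> V (\<lambda>y. ?f k y *\<^sub>R E k y)" for k by (rule vector_field_scaleR[OF V(1) f Ek])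
  have nT: "nab (E k) x v \<in> T x" for k
    by (rule vector_connection_in[OF D open_U vector_field_E x v])
  have "nab Y x v = nab (\<lambda>y. \<Sum>k\<in>UNIV. ?f k y *\<^sub>R E k y) x v"
    by (rule vf_connection_local[OF D V(1) Y _ V(2) v]) (use V(3) vector_fieldD[OF Y] E_expand in blast)
  also have "\<dots> = (\<Sum>k\<in>UNIV. nab (\<lambda>y. ?f k y *\<^sub>R E k y) x v)"
    by (rule vector_connection_sum[OF D V(1,2) v]) (simp_all add: fE)
  also have "\<dots> = (\<Sum>k\<in>UNIV. dir_deriv \<A> (?f k) x v *\<^sub>R E k x + ?f k x *\<^sub>R nab (E k) x v)"
    by (simp add: vf_connection_leibniz[OF D V(1) f Ek V(2) v])
  finally have "F x (nab Y x v) = F x (\<Sum>k\<in>UNIV. dir_deriv \<A> (?f k) x v *\<^sub>R E k x + ?f k x *\<^sub>R nab (E k) x v)"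
    by (rule arg_cong)
  also have "\<dots> = (\<Sum>k\<in>UNIV. F x (dir_deriv \<A> (?f k) x v *\<^sub>R E k x + ?f k x *\<^sub>R nab (E k) x v))"
    by (rule lin_on_sum[OF subspace_T lin_on_F[OF x]]) (simp_all add: x nT)
  also have "\<dots> = (\<Sum>k\<in>UNIV. dir_deriv \<A> (\<lambda>y. F y (Y y)) x v $ k *\<^sub>R axis k 1 + ?f k x *\<^sub>R lc_coeff nab x v k)"
    by (simp add: lin_onD[OF lin_on_F[OF x]] x nT lc_coeff_def
        dir_deriv_bounded_linear[OF bounded_linear_vec_nth V(1,2) FY v])
  also have "\<dots> = dir_deriv \<A> (\<lambda>y. F y (Y y)) x v + (\<Sum>k\<in>UNIV. ?f k x *\<^sub>R lc_coeff nab x v k)"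
    unfolding sum.distrib quat_expand[symmetric] ..
  finally have F_nab: "F x (nab Y x v) = dir_deriv \<A> (\<lambda>y. F y (Y y)) x v + (\<Sum>k\<in>UNIV. ?f k x *\<^sub>R lc_coeff nab x v k)" .
  have "(\<Sum>k\<in>UNIV. ?f k x *\<^sub>R lc_coeff nab x v k) = (\<Sum>k\<in>UNIV. ?f k x *\<^sub>R (qmult ?p (axis k 1) - qmult (axis k 1) ?m))"
    using skew_decomposition[OF lc_coeff_skew[OF lc x v]] by simp
  also have "\<dots> = qmult ?p (\<Sum>k\<in>UNIV. ?f k x *\<^sub>R axis k 1) - qmult (\<Sum>k\<in>UNIV. ?f k x *\<^sub>R axis k 1) ?m"
    by (simp add: qmult.sum_left qmult.sum_right qmult.scaleR_left qmult.scaleR_right sum_subtractf scaleR_diff_right)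
  finally show ?thesis unfolding F_nab quat_expand[symmetric] by simp
qed

text \<open>Resolves the \<open>THE\<close>. Uniqueness comes from testing on the fields E k, whose
  images under F are constant, so that the derivative term drops out.\<close>

lemma lc_forms_eq:
  assumes lc: "levi_civita \<A> g nab" and x: "x \<in> U" and v: "v \<in> T x"
  shows "lc_forms \<A> nab U F x v = (skew_plus (lc_coeff nab x v), skew_minus (lc_coeff nab x v))"
  unfolding lc_forms_def
proof (rule the_equality, goal_cases)
  case 1
  show ?case using nab_in_chart[OF lc x v] by auto
next
  case (2 pm)
  obtain p m where pm: "pm = (p, m)" by fastforce
  have P: "p \<in> im_quat" "m \<in> im_quat"
    and eq: "\<And>V Y. open V \<Longrightarrow> x \<in> V \<Longrightarrow> V \<subseteq> U \<Longrightarrow> vector_field \<A> V Y \<Longrightarrow>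
      F x (nab Y x v) = dir_deriv \<A> (\<lambda>y. F y (Y y)) x v + qmult p (F x (Y x)) - qmult (F x (Y x)) m"
    using 2 unfolding pm by auto
  have "qmult p (axis k 1) - qmult (axis k 1) m =
      qmult (skew_plus (lc_coeff nab x v)) (axis k 1) - qmult (axis k 1) (skew_minus (lc_coeff nab x v))" for k
    using eq[OF open_U x order_refl vector_field_E[of k]] nab_in_chart[OF lc x v open_U x order_refl vector_field_E[of k]] x
    by simp
  from skew_decomposition_unique[OF P skew_im this] show ?case by (simp add: pm)
qed

lemma lin_on_skew_plus:
  assumes lc: "levi_civita \<A> g nab" and x: "x \<in> U"
  shows "lin_on (T x) (\<lambda>v. skew_plus (lc_coeff nab x v))"
proof -
  note D = levi_civita_connection[OF lc]
  have "lin_on (T x) (nab (E k) x)" for k by (rule vf_connection_lin[OF D open_U vector_field_E x])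
  moreover have "nab (E k) x v \<in> T x" if "v \<in> T x" for k v
    by (rule vector_connection_in[OF D open_U vector_field_E x that])
  ultimately have "lin_on (T x) (\<lambda>v. lc_coeff nab x v k)" for k
    using lin_on_F[OF x] by (simp add: lin_on_def lc_coeff_def)
  then show ?thesis
    by (simp add: lin_on_def skew_plus_def quat_eq_iff add_divide_distrib diff_divide_distrib right_diff_distrib distrib_left)
qed

lemma spin_conn_plus_in_chart:
  assumes lc: "levi_civita \<A> g nab" and x: "x \<in> U" and \<phi>: "self_dual_spinor_field \<A> g \<phi>"
  obtains q Q where "lin_on (T x) Q" "\<And>v. v \<in> T x \<Longrightarrow> F x (\<phi> x v) = qmult q (F x v)"
    "\<And>A Y V v. open V \<Longrightarrow> x \<in> V \<Longrightarrow> vector_field \<A> V Y \<Longrightarrow> v \<in> T x \<Longrightarrow>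
      spin_conn_minus_in \<A> J nab A U F (\<lambda>y. \<phi> y (Y y)) x v - \<phi> x (nab Y x v) \<in> T x \<and>
      F x (spin_conn_minus_in \<A> J nab A U F (\<lambda>y. \<phi> y (Y y)) x v - \<phi> x (nab Y x v)) =
        qmult (Q v + det_conn_form \<A> J A U F x v *\<^sub>R qmult q_i q) (F x (Y x))"
proof -
  note D = levi_civita_connection[OF lc]
  have \<phi>_in: "\<phi> y v \<in> T y" if "v \<in> T y" for y v
    using \<phi>[unfolded self_dual_spinor_field_def endomorphism_field_def, THEN conjunct1, THEN conjunct1, rule_format, THEN conjunct1, of y]
      that by blast
  have \<phi>_vf: "vector_field \<A> V (\<lambda>y. \<phi> y (Y y))" if "open V" "vector_field \<A> V Y" for V Y
    using \<phi>[unfolded self_dual_spinor_field_def endomorphism_field_def, THEN conjunct1, THEN conjunct2, rule_format, of V Y]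
      that by blast
  have \<phi>_w: "\<phi> y \<in> wplus \<A> g y" for y
    using \<phi>[unfolded self_dual_spinor_field_def, THEN conjunct2] by blast
  \<comment> \<open>\<open>E 1\<close> is sent to 1, so this recovers the quaternion of the left
    multiplication and exhibits it as a smooth function.\<close>
  define q where "q y = F y (\<phi> y (E 1 y))" for y
  have q: "F y (\<phi> y v) = qmult (q y) (F y v)" if y: "y \<in> U" and v: "v \<in> T y" for y v
  proof -
    obtain r where r: "\<And>v. v \<in> T y \<Longrightarrow> F y (\<phi> y v) = qmult r (F y v)"
      using wplus_left_mult[OF y \<phi>_w] by blast
    have "q y = r" using r[of "E 1 y"] y by (simp add: q_def)
    then show ?thesis using r v by simp
  qed
  have smooth_q: "smooth_fun \<A> U q"
    unfolding q_def by (rule smooth_F[OF open_U order_refl \<phi>_vf[OF open_U vector_field_E]])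
  define Q where "Q v = dir_deriv \<A> q x v - qmult (q x) (skew_plus (lc_coeff nab x v))" for v
  show ?thesis
  proof (rule that[of Q "q x"])
    show "lin_on (T x) Q"
      using lin_on_dir_deriv[OF open_U x smooth_q] lin_on_skew_plus[OF lc x]
      by (simp add: lin_on_def Q_def qmult.add_right qmult.scaleR_right algebra_simps)
    show "F x (\<phi> x v) = qmult (q x) (F x v)" if "v \<in> T x" for v using q x that by blast
    fix A Y V v assume V0: "open V" "x \<in> V" and Y0: "vector_field \<A> V Y" and v: "v \<in> T x"
    let ?W = "V \<inter> U" and ?a = "det_conn_form \<A> J A U F x v"
    let ?p = "skew_plus (lc_coeff nab x v)" and ?m = "skew_minus (lc_coeff nab x v)"
    let ?S = "spin_conn_minus_in \<A> J nab A U F (\<lambda>y. \<phi> y (Y y)) x v"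
    \<comment> \<open>The domain of an arbitrary extension Y is unrelated to the chart domain, so
      the calculation is restricted to their intersection.\<close>
    have W: "open ?W" "x \<in> ?W" "?W \<subseteq> U" using V0 open_U x by auto
    have Y: "vector_field \<A> ?W Y" by (rule vector_field_subset[OF Y0]) simp
    have YT: "Y y \<in> T y" if "y \<in> ?W" for y by (rule vector_fieldD[OF Y that])
    have FY: "smooth_fun \<A> ?W (\<lambda>y. F y (Y y))" by (rule smooth_F[OF W(1,3) Y])
    have nT: "nab Y x v \<in> T x" by (rule vector_connection_in[OF D W(1) Y W(2) v])
    have qW: "smooth_fun \<A> ?W q" by (rule smooth_fun_subset[OF smooth_q W(3)])
    have "dir_deriv \<A> (\<lambda>y. qmult (q y) (F y (Y y))) x v = dir_deriv \<A> (\<lambda>y. F y (\<phi> y (Y y))) x v"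
      by (rule dir_deriv_cong[OF W(1,2) smooth_fun_bounded_bilinear[OF bounded_bilinear_qmult W(1) qW FY] _ v])
        (use q YT in auto)
    then have d: "dir_deriv \<A> (\<lambda>y. F y (\<phi> y (Y y))) x v =
        qmult (q x) (dir_deriv \<A> (\<lambda>y. F y (Y y)) x v) + qmult (dir_deriv \<A> q x v) (F x (Y x))"
      using dir_deriv_bounded_bilinear[OF bounded_bilinear_qmult W(1,2) qW FY v] by simp
    have ST: "?S \<in> T x" by (simp add: spin_conn_minus_in_def x)
    have "F x (?S - \<phi> x (nab Y x v)) = F x ?S - F x (\<phi> x (nab Y x v))"
      by (rule lin_on_diff[OF subspace_T lin_on_F[OF x] ST \<phi>_in[OF nT]])
    also have "F x ?S = dir_deriv \<A> (\<lambda>y. F y (\<phi> y (Y y))) x v + ?a *\<^sub>R qmult q_i (qmult (q x) (F x (Y x)))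
        - qmult (qmult (q x) (F x (Y x))) ?m"
      by (simp add: spin_conn_minus_in_def x lc_forms_eq[OF lc x v] q[OF x YT[OF W(2)]])
    also have "F x (\<phi> x (nab Y x v)) = qmult (q x) (dir_deriv \<A> (\<lambda>y. F y (Y y)) x v + qmult ?p (F x (Y x)) - qmult (F x (Y x)) ?m)"
      by (simp add: q[OF x nT] nab_in_chart[OF lc x v W Y])
    also have "dir_deriv \<A> (\<lambda>y. F y (\<phi> y (Y y))) x v + ?a *\<^sub>R qmult q_i (qmult (q x) (F x (Y x)))
        - qmult (qmult (q x) (F x (Y x))) ?m
        - qmult (q x) (dir_deriv \<A> (\<lambda>y. F y (Y y)) x v + qmult ?p (F x (Y x)) - qmult (F x (Y x)) ?m)
      = qmult (Q v + ?a *\<^sub>R qmult q_i (q x)) (F x (Y x))"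
      by (simp add: d Q_def qmult.add_left qmult.diff_left qmult.add_right qmult.diff_right qmult.scaleR_left qmult_assoc)
    finally have "F x (?S - \<phi> x (nab Y x v)) = qmult (Q v + ?a *\<^sub>R qmult q_i (q x)) (F x (Y x))" .
    then show "?S - \<phi> x (nab Y x v) \<in> T x \<and> F x (?S - \<phi> x (nab Y x v)) = qmult (Q v + ?a *\<^sub>R qmult q_i (q x)) (F x (Y x))"
      using ST \<phi>_in[OF nT] by simp
  qed
qed

end

section \<open>The anticanonical bundle\<close>

lemma cscale_apply [simp]: "cscale a z w = a * z w"
  by (simp add: cscale_def)

context almost_hermitian_manifold
begin

section \<open>Linear algebra of (2,0)-forms and of K*\<close>

abbreviation h where "h \<equiv> herm g J"

lemma herm_left:
  assumes "u \<in> T x" "v \<in> T x" "w \<in> T x"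
  shows "h x (u + v) w = h x u w + h x v w" "h x (r *\<^sub>R u) w = r *\<^sub>R h x u w" "h x (J x u) w = \<i> * h x u w"
  using assms by (simp_all add: herm_def g_add_left g_scaleR_left complex_eq_iff g_J_left g_minus_right)

lemma cnj_herm: "u \<in> T x \<Longrightarrow> v \<in> T x \<Longrightarrow> cnj (h x u v) = h x v u"
  using g_commute[of u x v] g_J_left[of u x v] g_commute[of "J x u" x v] by (simp add: herm_def complex_eq_iff)

lemma det_form_in:
  assumes "u \<in> T x" "v \<in> T x"
  shows "det_form \<A> g J x u v \<in> cforms \<A> J x"
  unfolding cforms_def mem_Collect_eq
proof (intro conjI allI impI ballI)
  fix a assume a: "a \<in> T x"
  show "lin_on (T x) (det_form \<A> g J x u v a)"
    using a assms by (simp add: lin_on_def det_form_def herm_left algebra_simps)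
qed (use assms in \<open>auto simp: det_form_def herm_left algebra_simps\<close>)

lemma cformsD:
  assumes "\<omega> \<in> cforms \<A> J x"
  shows "u \<notin> T x \<or> v \<notin> T x \<Longrightarrow> \<omega> u v = 0" "u \<in> T x \<Longrightarrow> lin_on (T x) (\<omega> u)"
    "u \<in> T x \<Longrightarrow> v \<in> T x \<Longrightarrow> \<omega> v u = - \<omega> u v" "u \<in> T x \<Longrightarrow> v \<in> T x \<Longrightarrow> \<omega> (J x u) v = \<i> * \<omega> u v"
proof -
  note * = assms[unfolded cforms_def mem_Collect_eq]
  show "\<omega> u v = 0" if "u \<notin> T x \<or> v \<notin> T x" using *[THEN conjunct1, rule_format, OF that] .
  show "lin_on (T x) (\<omega> u)" if "u \<in> T x" using *[THEN conjunct2, THEN conjunct1, rule_format, OF that] .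
  show "\<omega> v u = - \<omega> u v" "\<omega> (J x u) v = \<i> * \<omega> u v" if "u \<in> T x" "v \<in> T x"
    using *[THEN conjunct2, THEN conjunct2, rule_format, OF that] by blast+
qed

lemma cform_add_left:
  assumes \<omega>: "\<omega> \<in> cforms \<A> J x" and uvw: "u \<in> T x" "v \<in> T x" "w \<in> T x"
  shows "\<omega> (u + v) w = \<omega> u w + \<omega> v w"
  using lin_onD(1)[OF cformsD(2)[OF \<omega> uvw(3)] uvw(1,2)] cformsD(3)[OF \<omega>, of w] uvw by simp

lemma cform_scaleR_left:
  assumes \<omega>: "\<omega> \<in> cforms \<A> J x" and uw: "u \<in> T x" "w \<in> T x"
  shows "\<omega> (r *\<^sub>R u) w = r *\<^sub>R \<omega> u w"
  using lin_onD(2)[OF cformsD(2)[OF \<omega> uw(2)] uw(1)] cformsD(3)[OF \<omega>, of w] uw by simp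

lemma cforms_add:
  assumes "\<omega> \<in> cforms \<A> J x" "\<eta> \<in> cforms \<A> J x"
  shows "\<omega> + \<eta> \<in> cforms \<A> J x"
proof -
  note 1 = cformsD[OF assms(1)] and 2 = cformsD[OF assms(2)]
  show ?thesis
    unfolding cforms_def mem_Collect_eq
  proof (intro conjI allI impI ballI)
    fix u assume "u \<in> T x"
    then show "lin_on (T x) ((\<omega> + \<eta>) u)"
      using 1(2)[of u] 2(2)[of u] by (simp add: lin_on_def algebra_simps)
  next
    fix u v assume "u \<notin> T x \<or> v \<notin> T x"
    then show "(\<omega> + \<eta>) u v = 0" using 1(1)[of u v] 2(1)[of u v] by simp
  next
    fix u v assume uv: "u \<in> T x" "v \<in> T x"
    show "(\<omega> + \<eta>) v u = - (\<omega> + \<eta>) u v" using 1(3)[OF uv] 2(3)[OF uv] by simp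
    show "(\<omega> + \<eta>) (J x u) v = \<i> * (\<omega> + \<eta>) u v" using 1(4)[OF uv] 2(4)[OF uv] by (simp add: algebra_simps)
  qed
qed

lemma cforms_scale:
  assumes "\<omega> \<in> cforms \<A> J x"
  shows "(\<lambda>u. cscale a (\<omega> u)) \<in> cforms \<A> J x"
proof -
  note 1 = cformsD[OF assms(1)]
  show ?thesis
    unfolding cforms_def mem_Collect_eq
  proof (intro conjI allI impI ballI)
    fix u assume "u \<in> T x"
    then show "lin_on (T x) (cscale a (\<omega> u))"
      using 1(2)[of u] by (simp add: lin_on_def algebra_simps)
  next
    fix u v assume "u \<notin> T x \<or> v \<notin> T x"
    then show "cscale a (\<omega> u) v = 0" using 1(1)[of u v] by simp
  next
    fix u v assume uv: "u \<in> T x" "v \<in> T x"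
    show "cscale a (\<omega> v) u = - cscale a (\<omega> u) v" using 1(3)[OF uv] by simp
    show "cscale a (\<omega> (J x u)) v = \<i> * cscale a (\<omega> u) v" using 1(4)[OF uv] by (simp add: algebra_simps)
  qed
qed

lemma kstarD:
  assumes "\<zeta> \<in> kstar \<A> J x"
  shows "\<omega> \<notin> cforms \<A> J x \<Longrightarrow> \<zeta> \<omega> = 0"
    "\<omega> \<in> cforms \<A> J x \<Longrightarrow> \<eta> \<in> cforms \<A> J x \<Longrightarrow> \<zeta> (\<omega> + \<eta>) = \<zeta> \<omega> + \<zeta> \<eta>"
    "\<omega> \<in> cforms \<A> J x \<Longrightarrow> \<zeta> (\<lambda>u. cscale a (\<omega> u)) = a * \<zeta> \<omega>"
  using assms unfolding kstar_def by blast+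

lemma kstar_add: "\<zeta> \<in> kstar \<A> J x \<Longrightarrow> \<eta> \<in> kstar \<A> J x \<Longrightarrow> \<zeta> + \<eta> \<in> kstar \<A> J x"
  unfolding kstar_def mem_Collect_eq by (auto simp: algebra_simps)

lemma kstar_scale: "\<zeta> \<in> kstar \<A> J x \<Longrightarrow> cscale a \<zeta> \<in> kstar \<A> J x"
  unfolding kstar_def mem_Collect_eq by (auto simp: algebra_simps)

lemma wedge_in: "u \<in> T x \<Longrightarrow> v \<in> T x \<Longrightarrow> wedge \<A> J x u v \<in> kstar \<A> J x"
  unfolding kstar_def mem_Collect_eq by (auto simp: wedge_def cforms_add cforms_scale)

text \<open>The form dual to a vector under the Hermitian metric; unlike \<open>kstar_herm\<close>, it
  does not choose a decomposition of the vector.\<close>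

definition dual_form :: "'a \<Rightarrow> 'a kvec \<Rightarrow> 'a cform" where
  "dual_form x \<eta> = (\<lambda>a b. if a \<in> T x \<and> b \<in> T x then cnj (\<eta> (det_form \<A> g J x a b)) else 0)"

text \<open>Conjugate symmetry of the 2 by 2 determinant of Hermitian products. Since the left side
  sees only the bivector, the form \<open>det_form\<close> does not depend on the decomposition into
  u and v.\<close>

lemma dual_form_wedge:
  assumes "u \<in> T x" "v \<in> T x"
  shows "dual_form x (wedge \<A> J x u v) = det_form \<A> g J x u v"
  using assms by (intro ext) (auto simp: dual_form_def wedge_def det_form_in, simp_all add: det_form_def cnj_herm)

lemma dual_form_add: "dual_form x (\<zeta> + \<eta>) = dual_form x \<zeta> + dual_form x \<eta>"
  by (intro ext) (simp add: dual_form_def)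

lemma dual_form_scale: "dual_form x (cscale a \<eta>) = (\<lambda>u. cscale (cnj a) (dual_form x \<eta> u))"
  by (intro ext) (simp add: dual_form_def)

context
  fixes x :: 'a and e :: "4 \<Rightarrow> 'a tvec"
  assumes fr: "frame_at x e" "J x (e 1) = e 2" "J x (e 3) = e 4"
begin

lemma e_in: "e k \<in> T x"
  using fr by (simp add: frame_at_def)

lemma cform_expand_left:
  assumes \<omega>: "\<omega> \<in> cforms \<A> J x" and a: "a \<in> T x" and b: "b \<in> T x"
  shows "\<omega> a b = h x a (e 1) * \<omega> (e 1) b + h x a (e 3) * \<omega> (e 3) b"
proof -
  let ?c = "\<lambda>k. g x a (e k)"
  have "\<omega> (e 2) b = \<i> * \<omega> (e 1) b" "\<omega> (e 4) b = \<i> * \<omega> (e 3) b"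
    using cformsD(4)[OF \<omega> e_in b, of 1] cformsD(4)[OF \<omega> e_in b, of 3] fr by auto
  moreover have "\<omega> a b = \<omega> (?c 1 *\<^sub>R e 1 + ?c 2 *\<^sub>R e 2 + ?c 3 *\<^sub>R e 3 + ?c 4 *\<^sub>R e 4) b"
    using frame_expand[OF fr(1) a] unfolding sum_4 by simp
  moreover have "\<dots> = ?c 1 *\<^sub>R \<omega> (e 1) b + ?c 2 *\<^sub>R \<omega> (e 2) b + ?c 3 *\<^sub>R \<omega> (e 3) b + ?c 4 *\<^sub>R \<omega> (e 4) b"
    by (simp only: cform_add_left[OF \<omega>] cform_scaleR_left[OF \<omega>] e_in b T_closed)
  ultimately show ?thesis
    by (simp add: herm_def fr complex_eq_iff algebra_simps)
qed

text \<open>Complex linearity in each argument and alternation leave only the value on the complex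
  basis \<open>e 1\<close>, \<open>e 3\<close>: the (2,0)-forms are a complex line spanned by this
  determinant form.\<close>

lemma cform_expand:
  assumes \<omega>: "\<omega> \<in> cforms \<A> J x"
  shows "\<omega> = (\<lambda>a. cscale (\<omega> (e 1) (e 3)) (det_form \<A> g J x (e 1) (e 3) a))"
proof (intro ext)
  fix a b
  have z: "\<omega> (e k) (e k) = 0" for k using cformsD(3)[OF \<omega> e_in e_in, of k k] by (simp add: eq_neg_iff_add_eq_0)
  show "\<omega> a b = cscale (\<omega> (e 1) (e 3)) (det_form \<A> g J x (e 1) (e 3) a) b"
  proof (cases "a \<in> T x \<and> b \<in> T x")
    case True
    have "\<omega> (e 1) b = h x b (e 3) * \<omega> (e 1) (e 3)" "\<omega> (e 3) b = - h x b (e 1) * \<omega> (e 1) (e 3)"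
      using cformsD(3)[OF \<omega> _ e_in, of b 1] cformsD(3)[OF \<omega> _ e_in, of b 3] True
        cform_expand_left[OF \<omega> _ e_in, of b 1] cform_expand_left[OF \<omega> _ e_in, of b 3]
        cformsD(3)[OF \<omega> e_in e_in, of 1 3] by (simp_all add: z)
    then show ?thesis
      using True cform_expand_left[OF \<omega>, of a b] by (simp add: det_form_def algebra_simps)
  next
    case False
    then show ?thesis using cformsD(1)[OF \<omega>, of a b] by (auto simp: det_form_def)
  qed
qed

lemma kstar_expand:
  assumes "\<zeta> \<in> kstar \<A> J x"
  shows "\<zeta> = cscale (\<zeta> (det_form \<A> g J x (e 1) (e 3))) (wedge \<A> J x (e 1) (e 3))"
proof
  fix \<omega>
  show "\<zeta> \<omega> = cscale (\<zeta> (det_form \<A> g J x (e 1) (e 3))) (wedge \<A> J x (e 1) (e 3)) \<omega>"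
  proof (cases "\<omega> \<in> cforms \<A> J x")
    case True
    have "\<zeta> \<omega> = \<zeta> (\<lambda>a. cscale (\<omega> (e 1) (e 3)) (det_form \<A> g J x (e 1) (e 3) a))"
      using cform_expand[OF True] by simp
    then show ?thesis
      using kstarD(3)[OF assms det_form_in[OF e_in e_in]] True by (simp add: wedge_def)
  qed (use kstarD(1)[OF assms] in \<open>simp add: wedge_def\<close>)
qed

lemma det_form_frame: "det_form \<A> g J x (e 1) (e 3) (e 1) (e 3) = 1"
proof -
  have "g x (e j) (e k) = (if j = k then 1 else 0)" for j k
    using fr(1) by (simp add: frame_at_def)
  then show ?thesis by (simp add: det_form_def e_in herm_def fr complex_eq_iff)
qed

text \<open>K* is a complex line, and the scalar c can be absorbed into the first factor as the
  vector Re c e + Im c J e with e = \<open>e 1\<close>.\<close>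

lemma kstar_decomposable_frame:
  assumes "\<zeta> \<in> kstar \<A> J x"
  shows "\<exists>u\<in>T x. \<exists>v\<in>T x. \<zeta> = wedge \<A> J x u v"
proof -
  define c where "c = \<zeta> (det_form \<A> g J x (e 1) (e 3))"
  let ?u = "Re c *\<^sub>R e 1 + Im c *\<^sub>R J x (e 1)"
  have "cscale c (wedge \<A> J x (e 1) (e 3)) = wedge \<A> J x ?u (e 3)"
  proof
    fix \<omega>
    show "cscale c (wedge \<A> J x (e 1) (e 3)) \<omega> = wedge \<A> J x ?u (e 3) \<omega>"
    proof (cases "\<omega> \<in> cforms \<A> J x")
      case True
      have "\<omega> ?u (e 3) = Re c *\<^sub>R \<omega> (e 1) (e 3) + Im c *\<^sub>R \<omega> (J x (e 1)) (e 3)"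
        by (simp only: cform_add_left[OF True] cform_scaleR_left[OF True] e_in T_closed J_in)
      also have "\<dots> = c * \<omega> (e 1) (e 3)"
        by (simp only: cformsD(4)[OF True e_in e_in]) (simp add: complex_eq_iff)
      finally show ?thesis using True by (simp add: wedge_def)
    qed (simp add: wedge_def)
  qed
  then show ?thesis
    using kstar_expand[OF assms] e_in unfolding c_def by (metis T_closed(2,3) J_in)
qed

end

lemma kstar_decomposable:
  assumes "\<zeta> \<in> kstar \<A> J x"
  obtains u v where "u \<in> T x" "v \<in> T x" "\<zeta> = wedge \<A> J x u v"
proof -
  obtain W e where W: "x \<in> W" and e: "\<And>y. y \<in> W \<Longrightarrow> frame_at y (\<lambda>k. e k y)" "\<And>y. y \<in> W \<Longrightarrow> J y (e 1 y) = e 2 y"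
    "\<And>y. y \<in> W \<Longrightarrow> J y (e 3 y) = e 4 y"
    using exists_unitary_frame[of x] by metis
  from kstar_decomposable_frame[OF e[OF W] assms] show ?thesis using that by blast
qed

lemma dual_form_in: "\<eta> \<in> kstar \<A> J x \<Longrightarrow> dual_form x \<eta> \<in> cforms \<A> J x"
  by (erule kstar_decomposable) (simp add: dual_form_wedge det_form_in)

text \<open>Removes the \<open>SOME\<close>: a decomposition exists, and by
  \<open>dual_form_wedge\<close> whichever one is chosen yields the same form. Additivity and
  conjugate linearity in the second argument become accessible this way.\<close>

lemma kstar_herm_eq:
  assumes "\<eta> \<in> kstar \<A> J x"
  shows "kstar_herm \<A> g J x \<zeta> \<eta> = \<zeta> (dual_form x \<eta>)"
proof -
  let ?P = "\<lambda>(u, v). u \<in> T x \<and> v \<in> T x \<and> \<eta> = wedge \<A> J x u v"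
  obtain u v where uv: "(SOME p. ?P p) = (u, v)" by (rule prod.exhaust)
  obtain a b where "a \<in> T x" "b \<in> T x" "\<eta> = wedge \<A> J x a b" by (rule kstar_decomposable[OF assms])
  then have "?P (a, b)" by simp
  then have "?P (SOME p. ?P p)" by (rule someI)
  then have "u \<in> T x" "v \<in> T x" "\<eta> = wedge \<A> J x u v" unfolding uv by simp_all
  then have "dual_form x \<eta> = det_form \<A> g J x u v" by (simp only: dual_form_wedge)
  then show ?thesis unfolding kstar_herm_def uv by simp
qed

lemma kstar_herm_add_left: "kstar_herm \<A> g J x (\<zeta> + \<zeta>') \<eta> = kstar_herm \<A> g J x \<zeta> \<eta> + kstar_herm \<A> g J x \<zeta>' \<eta>"
  by (simp add: kstar_herm_def split_beta)

lemma kstar_herm_scale_left: "kstar_herm \<A> g J x (cscale a \<zeta>) \<eta> = a * kstar_herm \<A> g J x \<zeta> \<eta>"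
  by (simp add: kstar_herm_def split_beta)

lemma kstar_herm_add_right:
  assumes "\<zeta> \<in> kstar \<A> J x" "\<eta> \<in> kstar \<A> J x" "\<eta>' \<in> kstar \<A> J x"
  shows "kstar_herm \<A> g J x \<zeta> (\<eta> + \<eta>') = kstar_herm \<A> g J x \<zeta> \<eta> + kstar_herm \<A> g J x \<zeta> \<eta>'"
  using kstarD(2)[OF assms(1) dual_form_in[OF assms(2)] dual_form_in[OF assms(3)]]
  by (simp only: kstar_herm_eq assms kstar_add dual_form_add)

lemma kstar_herm_scale_right:
  assumes "\<zeta> \<in> kstar \<A> J x" "\<eta> \<in> kstar \<A> J x"
  shows "kstar_herm \<A> g J x \<zeta> (cscale a \<eta>) = cnj a * kstar_herm \<A> g J x \<zeta> \<eta>"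
  by (simp only: kstar_herm_eq assms kstar_scale dual_form_scale kstarD(3)[OF assms(1) dual_form_in[OF assms(2)]])

section \<open>Sections of K* and their unitary connections\<close>

lemma kstar_sectionD: "kstar_section \<A> J V s \<Longrightarrow> y \<in> V \<Longrightarrow> s y \<in> kstar \<A> J y"
  by (simp add: kstar_section_def)

lemma kstar_section_subset: "kstar_section \<A> J V s \<Longrightarrow> W \<subseteq> V \<Longrightarrow> kstar_section \<A> J W s"
  unfolding kstar_section_def by (meson order_trans subsetD)

lemma kstar_section_add:
  assumes "kstar_section \<A> J V s" "kstar_section \<A> J V t"
  shows "kstar_section \<A> J V (\<lambda>y. s y + t y)"
  using assms unfolding kstar_section_def by (auto simp: kstar_add intro!: smooth_fun_add)

lemma kstar_section_scale:
  assumes "smooth_fun \<A> V z" "kstar_section \<A> J V s"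
  shows "kstar_section \<A> J V (\<lambda>y. cscale (z y) (s y))"
  using assms smooth_fun_bounded_bilinear[OF bounded_bilinear_mult _ smooth_fun_subset[OF assms(1)]]
  unfolding kstar_section_def by (auto simp: kstar_scale)

lemmas ks_connection_section = connection_section[where \<A> = \<A> and \<Gamma> = "kstar_section \<A> J"]
  and ks_connection_lin = connection_lin[where \<A> = \<A> and \<Gamma> = "kstar_section \<A> J"]
  and ks_connection_add = connection_add[where \<A> = \<A> and \<Gamma> = "kstar_section \<A> J"]
  and ks_connection_leibniz = connection_leibniz[where \<A> = \<A> and \<Gamma> = "kstar_section \<A> J"]
  and ks_connection_local = connection_local[where \<A> = \<A> and \<Gamma> = "kstar_section \<A> J"]

lemma unitary_connectionD:
  assumes "unitary_connection \<A> g J A"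
  shows "connection \<A> (kstar_section \<A> J) A"
    "\<lbrakk>open V; kstar_section \<A> J V \<zeta>; x \<in> V; v \<in> T x\<rbrakk> \<Longrightarrow> A (\<lambda>y. cscale \<i> (\<zeta> y)) x v = cscale \<i> (A \<zeta> x v)"
    "\<lbrakk>open V; kstar_section \<A> J V \<zeta>; kstar_section \<A> J V \<eta>; x \<in> V; v \<in> T x\<rbrakk> \<Longrightarrow>
      dir_deriv \<A> (\<lambda>y. kstar_herm \<A> g J y (\<zeta> y) (\<eta> y)) x v =
        kstar_herm \<A> g J x (A \<zeta> x v) (\<eta> x) + kstar_herm \<A> g J x (\<zeta> x) (A \<eta> x v)"
proof -
  note * = assms[unfolded unitary_connection_def]
  show "connection \<A> (kstar_section \<A> J) A" using *[THEN conjunct1] .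
  show "A (\<lambda>y. cscale \<i> (\<zeta> y)) x v = cscale \<i> (A \<zeta> x v)"
    if "open V" "kstar_section \<A> J V \<zeta>" "x \<in> V" "v \<in> T x"
    using *[THEN conjunct2, THEN conjunct1, rule_format, of V \<zeta>] that by blast
  show "dir_deriv \<A> (\<lambda>y. kstar_herm \<A> g J y (\<zeta> y) (\<eta> y)) x v =
        kstar_herm \<A> g J x (A \<zeta> x v) (\<eta> x) + kstar_herm \<A> g J x (\<zeta> x) (A \<eta> x v)"
    if "open V" "kstar_section \<A> J V \<zeta>" "kstar_section \<A> J V \<eta>" "x \<in> V" "v \<in> T x"
    using *[THEN conjunct2, THEN conjunct2, rule_format, of V \<zeta> \<eta>] that by blast
qed

lemma kstar_connection_in:
  assumes D: "connection \<A> (kstar_section \<A> J) A" and "open V" "kstar_section \<A> J V s" "x \<in> V" "v \<in> T x"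
  shows "A s x v \<in> kstar \<A> J x"
proof -
  obtain X where X: "vector_field \<A> UNIV X" "X x = v" using vector_field_extension[OF assms(5)] by blast
  have "kstar_section \<A> J V (\<lambda>y. A s y (X y))"
    by (rule ks_connection_section[OF D assms(2,3) vector_field_subset[OF X(1)]]) simp
  from kstar_sectionD[OF this assms(4)] show ?thesis using X(2) by simp
qed

text \<open>\<open>connection\<close> provides the Leibniz rule for real functions only. Split z
  into real and imaginary part and use that A commutes with multiplication by i.\<close>

lemma kstar_connection_complex_leibniz:
  assumes A: "unitary_connection \<A> g J A" and V: "open V" "x \<in> V" and v: "v \<in> T x"
    and s: "kstar_section \<A> J V s" and z: "smooth_fun \<A> V z"
  shows "A (\<lambda>y. cscale (z y) (s y)) x v = cscale (dir_deriv \<A> z x v) (s x) + cscale (z x) (A s x v)"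
proof -
  note D = unitary_connectionD(1)[OF A]
  let ?is = "\<lambda>y. cscale \<i> (s y)"
  have ist: "kstar_section \<A> J V ?is"
    using kstar_section_scale[OF smooth_fun_const s] .
  have zr: "smooth_fun \<A> V (\<lambda>y. Re (z y))" and zi: "smooth_fun \<A> V (\<lambda>y. Im (z y))"
    using smooth_fun_bounded_linear[OF bounded_linear_Re V(1) z] smooth_fun_bounded_linear[OF bounded_linear_Im V(1) z] by auto
  have scl: "a *\<^sub>R (u :: 'a kvec) = cscale (of_real a) u" for a u
    by (rule ext) (simp add: scaleR_conv_of_real)
  have sec: "kstar_section \<A> J V (\<lambda>y. Re (z y) *\<^sub>R s y)" "kstar_section \<A> J V (\<lambda>y. Im (z y) *\<^sub>R ?is y)"
    unfolding scl
    using kstar_section_scale[OF smooth_fun_bounded_linear[OF bounded_linear_of_real V(1) zr] s]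
      kstar_section_scale[OF smooth_fun_bounded_linear[OF bounded_linear_of_real V(1) zi] ist] by blast+
  have "A (\<lambda>y. cscale (z y) (s y)) x v = A (\<lambda>y. Re (z y) *\<^sub>R s y + Im (z y) *\<^sub>R ?is y) x v"
  proof (rule ks_connection_local[OF D V(1) kstar_section_scale[OF z s] _ V(2) v])
    fix y show "cscale (z y) (s y) = Re (z y) *\<^sub>R s y + Im (z y) *\<^sub>R ?is y"
      by (rule ext) (simp add: complex_eq_iff)
  qed
  also have "\<dots> = A (\<lambda>y. Re (z y) *\<^sub>R s y) x v + A (\<lambda>y. Im (z y) *\<^sub>R ?is y) x v"
    by (rule ks_connection_add[OF D V(1) sec V(2) v])
  also have "A (\<lambda>y. Re (z y) *\<^sub>R s y) x v = Re (dir_deriv \<A> z x v) *\<^sub>R s x + Re (z x) *\<^sub>R A s x v"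
    using ks_connection_leibniz[OF D V(1) zr s V(2) v] unfolding dir_deriv_bounded_linear[OF bounded_linear_Re V z v] .
  also have "A (\<lambda>y. Im (z y) *\<^sub>R ?is y) x v = Im (dir_deriv \<A> z x v) *\<^sub>R ?is x + Im (z x) *\<^sub>R cscale \<i> (A s x v)"
    using ks_connection_leibniz[OF D V(1) zi ist V(2) v]
    unfolding dir_deriv_bounded_linear[OF bounded_linear_Im V z v] unitary_connectionD(2)[OF A V(1) s V(2) v] .
  also have "Re (dir_deriv \<A> z x v) *\<^sub>R s x + Re (z x) *\<^sub>R A s x v + (Im (dir_deriv \<A> z x v) *\<^sub>R ?is x + Im (z x) *\<^sub>R cscale \<i> (A s x v))
      = cscale (dir_deriv \<A> z x v) (s x) + cscale (z x) (A s x v)"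
    by (rule ext) (simp add: complex_eq_iff algebra_simps)
  finally show ?thesis .
qed

text \<open>Adding an imaginary 1-form keeps the connection unitary, since its value and its
  conjugate cancel in the product rule for the Hermitian metric. The factor 2 matches the
  normalisation 2 i \<alpha>, so that \<alpha> itself grows by g(X, .).\<close>

lemma unitary_connection_shift:
  assumes A: "unitary_connection \<A> g J A" and X: "vector_field \<A> UNIV X"
  shows "unitary_connection \<A> g J (\<lambda>s y v. A s y v + cscale (2 * \<i> * of_real (g y (X y) v)) (s y))"
    (is "unitary_connection \<A> g J ?B")
proof -
  note D = unitary_connectionD(1)[OF A]
  let ?c = "\<lambda>y v. 2 * \<i> * complex_of_real (g y (X y) v)"
  have XT: "X y \<in> T y" for y using vector_fieldD[OF X] by simp
  have conn: "connection \<A> (kstar_section \<A> J) ?B"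
    unfolding connection_def
  proof (intro allI impI conjI ballI; (elim conjE)?)
    fix V s Y assume V: "open V" and s: "kstar_section \<A> J V s" and Y: "vector_field \<A> V Y"
    have "smooth_fun \<A> V (\<lambda>y. g y (X y) (Y y))"
      using smooth_g[OF V vector_field_subset[OF X] Y] by simp
    from smooth_fun_bounded_linear[OF bounded_linear_mult_right V smooth_fun_bounded_linear[OF bounded_linear_of_real V this], of "2 * \<i>"]
    have "smooth_fun \<A> V (\<lambda>y. ?c y (Y y))" .
    then show "kstar_section \<A> J V (\<lambda>y. ?B s y (Y y))"
      by (intro kstar_section_add ks_connection_section[OF D V s Y] kstar_section_scale s)
  next
    fix V s y assume "open V" "kstar_section \<A> J V s" "y \<in> V"
    from ks_connection_lin[OF D this] show "lin_on (T y) (?B s y)"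
      using lin_on_g[OF XT[of y]] by (simp add: lin_on_def fun_eq_iff algebra_simps scaleR_conv_of_real)
  next
    fix V s t y v assume "open V" "kstar_section \<A> J V s" "kstar_section \<A> J V t" "y \<in> V" "v \<in> T y"
    from ks_connection_add[OF D this]
    show "?B (\<lambda>y. s y + t y) y v = ?B s y v + ?B t y v"
      by (simp only:) (rule ext, simp add: algebra_simps)
  next
    fix V s y v and f :: "'a \<Rightarrow> real" assume "open V" "smooth_fun \<A> V f" "kstar_section \<A> J V s" "y \<in> V" "v \<in> T y"
    from ks_connection_leibniz[OF D this]
    show "?B (\<lambda>y. f y *\<^sub>R s y) y v = dir_deriv \<A> f y v *\<^sub>R s y + f y *\<^sub>R ?B s y v"
      by (simp only:) (rule ext, simp add: algebra_simps)
  next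
    fix V s t y v assume "open V" "kstar_section \<A> J V s" "\<forall>y\<in>V. s y = t y" "y \<in> V" "v \<in> T y"
    then show "?B s y v = ?B t y v" using ks_connection_local[OF D, of V s t y v] by simp
  qed
  show ?thesis
    unfolding unitary_connection_def
  proof (intro conjI conn allI impI ballI; (elim conjE)?)
    fix V s y v assume "open V" "kstar_section \<A> J V s" "y \<in> V" "v \<in> T y"
    from unitary_connectionD(2)[OF A this]
    show "?B (\<lambda>y. cscale \<i> (s y)) y v = cscale \<i> (?B s y v)"
      by (simp only:) (rule ext, simp add: algebra_simps)
  next
    fix V s t y v assume *: "open V" "kstar_section \<A> J V s" "kstar_section \<A> J V t" "y \<in> V" "v \<in> T y"
    note st = kstar_sectionD[OF *(2,4)] kstar_sectionD[OF *(3,4)]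
      and At = kstar_connection_in[OF D *(1,3,4,5)]
    have "kstar_herm \<A> g J y (?B s y v) (t y) = kstar_herm \<A> g J y (A s y v) (t y) + ?c y v * kstar_herm \<A> g J y (s y) (t y)"
      by (simp only: kstar_herm_add_left kstar_herm_scale_left)
    moreover have "kstar_herm \<A> g J y (s y) (?B t y v) = kstar_herm \<A> g J y (s y) (A t y v) + cnj (?c y v) * kstar_herm \<A> g J y (s y) (t y)"
      by (simp only: kstar_herm_add_right[OF st(1) At kstar_scale[OF st(2)]] kstar_herm_scale_right[OF st])
    ultimately show "dir_deriv \<A> (\<lambda>y. kstar_herm \<A> g J y (s y) (t y)) y v =
        kstar_herm \<A> g J y (?B s y v) (t y) + kstar_herm \<A> g J y (s y) (?B t y v)"
      using unitary_connectionD(3)[OF A *] by simp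
  qed
qed

end

context u2_chart_manifold
begin

text \<open>The frame of K* given by 1 and j; the index of j is 3.\<close>

definition \<sigma> :: "'a \<Rightarrow> 'a kvec" where
  "\<sigma> y = wedge \<A> J y (E 1 y) (E 3 y)"

lemma kstar_section_\<sigma>: "kstar_section \<A> J U \<sigma>"
  unfolding kstar_section_def
proof (intro conjI ballI allI impI; (elim conjE)?)
  show "\<sigma> y \<in> kstar \<A> J y" if "y \<in> U" for y
    using that by (simp add: \<sigma>_def wedge_in)
  fix V \<omega> assume V: "open V" "V \<subseteq> U" and \<omega>: "smooth_cform \<A> J V \<omega>"
  have "smooth_fun \<A> V (\<lambda>y. \<omega> y (E 1 y) (E 3 y))"
    using \<omega>[unfolded smooth_cform_def, THEN conjunct2, rule_format, of V "E 1" "E 3"] V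
      vector_field_subset[OF vector_field_E V(2)] by blast
  then show "smooth_fun \<A> V (\<lambda>y. \<sigma> y (\<omega> y))"
    by (rule smooth_fun_cong[OF V(1), rotated]) (use \<omega> in \<open>auto simp: \<sigma>_def wedge_def smooth_cform_def\<close>)
qed

abbreviation \<omega>\<^sub>0 :: "'a \<Rightarrow> 'a cform" where
  "\<omega>\<^sub>0 y \<equiv> det_form \<A> g J y (E 1 y) (E 3 y)"

lemma \<sigma>_\<omega>\<^sub>0: "y \<in> U \<Longrightarrow> \<sigma> y (\<omega>\<^sub>0 y) = 1"
proof -
  assume y: "y \<in> U"
  show ?thesis using det_form_frame[OF frame_E[OF y] J_E[OF y]] y by (simp add: \<sigma>_def wedge_def det_form_in)
qed

text \<open>The section \<open>\<sigma>\<close> has constant length 1, so differentiating its square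
  makes the real part of the coefficient vanish.\<close>

lemma unitary_connection_\<sigma>:
  assumes A: "unitary_connection \<A> g J A" and x: "x \<in> U" and v: "v \<in> T x"
  obtains a where "A \<sigma> x v = cscale (2 * \<i> * of_real a) (\<sigma> x)"
proof -
  note D = unitary_connectionD(1)[OF A]
  define c where "c = A \<sigma> x v (\<omega>\<^sub>0 x)"
  have c: "A \<sigma> x v = cscale c (\<sigma> x)"
    unfolding c_def \<sigma>_def[of x]
    by (rule kstar_expand[OF frame_E[OF x] J_E[OF x] kstar_connection_in[OF D open_U kstar_section_\<sigma> x v]])
  have \<sigma>_in: "\<sigma> y \<in> kstar \<A> J y" if "y \<in> U" for y
    using kstar_sectionD[OF kstar_section_\<sigma> that] .
  have unit: "kstar_herm \<A> g J y (\<sigma> y) (\<sigma> y) = 1" if y: "y \<in> U" for y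
  proof -
    have "dual_form y (\<sigma> y) = \<omega>\<^sub>0 y" unfolding \<sigma>_def using y by (intro dual_form_wedge E_in)
    then show ?thesis by (simp add: kstar_herm_eq[OF \<sigma>_in[OF y]] \<sigma>_\<omega>\<^sub>0[OF y])
  qed
  have "dir_deriv \<A> (\<lambda>y. 1 :: complex) x v = dir_deriv \<A> (\<lambda>y. kstar_herm \<A> g J y (\<sigma> y) (\<sigma> y)) x v"
    by (rule dir_deriv_cong[OF open_U x _ _ v]) (simp_all add: unit)
  then have "kstar_herm \<A> g J x (A \<sigma> x v) (\<sigma> x) + kstar_herm \<A> g J x (\<sigma> x) (A \<sigma> x v) = 0"
    using unitary_connectionD(3)[OF A open_U kstar_section_\<sigma> kstar_section_\<sigma> x v] by simp
  then have "c + cnj c = 0"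
    unfolding c kstar_herm_scale_left kstar_herm_scale_right[OF \<sigma>_in[OF x] \<sigma>_in[OF x]] unit[OF x] by simp
  then have "c = 2 * \<i> * of_real (Im c / 2)" by (simp add: complex_eq_iff)
  then show ?thesis using that c by metis
qed

text \<open>Resolves the \<open>THE\<close>: the value on \<open>\<sigma>\<close> alone determines A
  on all its multiples by the complex Leibniz rule, and z = 1 gives uniqueness because
  \<open>\<sigma>\<close> does not vanish.\<close>

lemma det_conn_form_eqI:
  assumes A: "unitary_connection \<A> g J A" and x: "x \<in> U" and v: "v \<in> T x"
    and a: "A \<sigma> x v = cscale (2 * \<i> * of_real a) (\<sigma> x)"
  shows "det_conn_form \<A> J A U F x v = a"
proof -
  have \<sigma>: "\<sigma> = (\<lambda>y. wedge \<A> J y (triv_inv \<A> F y q_one) (triv_inv \<A> F y q_j))"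
    by (simp add: \<sigma>_def E_def q_units fun_eq_iff)
  show ?thesis
    unfolding det_conn_form_def \<sigma>[symmetric] Let_def
  proof (rule the_equality; (intro allI impI; elim conjE)?)
    fix V and z :: "'a \<Rightarrow> complex"
    assume V: "open V" "x \<in> V" "V \<subseteq> U" and z: "smooth_fun \<A> V z"
    have "A (\<lambda>y. cscale (z y) (\<sigma> y)) x v = cscale (dir_deriv \<A> z x v) (\<sigma> x) + cscale (z x) (A \<sigma> x v)"
      by (rule kstar_connection_complex_leibniz[OF A V(1,2) v kstar_section_subset[OF kstar_section_\<sigma> V(3)] z])
    then show "A (\<lambda>y. cscale (z y) (\<sigma> y)) x v = cscale (dir_deriv \<A> z x v + 2 * \<i> * of_real a * z x) (\<sigma> x)"
      unfolding a by (simp only:) (rule ext, simp add: algebra_simps)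
  next
    fix b
    assume b: "\<forall>V (z :: 'a \<Rightarrow> complex). open V \<and> x \<in> V \<and> V \<subseteq> U \<and> smooth_fun \<A> V z \<longrightarrow>
        A (\<lambda>y. cscale (z y) (\<sigma> y)) x v = cscale (dir_deriv \<A> z x v + 2 * \<i> * of_real b * z x) (\<sigma> x)"
    have one: "cscale 1 s = s" for s :: "'a kvec" by (rule ext) simp
    have "A \<sigma> x v = cscale (2 * \<i> * of_real b) (\<sigma> x)"
      using b[rule_format, of U "\<lambda>_. 1"] open_U x by (simp add: one)
    then have "cscale (2 * \<i> * of_real a) (\<sigma> x) (\<omega>\<^sub>0 x) = cscale (2 * \<i> * of_real b) (\<sigma> x) (\<omega>\<^sub>0 x)"
      unfolding a by simp
    then show "b = a" by (simp add: \<sigma>_\<omega>\<^sub>0[OF x])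
  qed
qed

lemma det_conn_form_eq:
  assumes A: "unitary_connection \<A> g J A" and x: "x \<in> U" and v: "v \<in> T x"
  shows "A \<sigma> x v = cscale (2 * \<i> * of_real (det_conn_form \<A> J A U F x v)) (\<sigma> x)"
proof -
  obtain a where a: "A \<sigma> x v = cscale (2 * \<i> * of_real a) (\<sigma> x)" using unitary_connection_\<sigma>[OF assms] .
  then show ?thesis using det_conn_form_eqI[OF assms a] by simp
qed

lemma lin_on_det_conn_form:
  assumes A: "unitary_connection \<A> g J A" and x: "x \<in> U"
  shows "lin_on (T x) (det_conn_form \<A> J A U F x)"
proof -
  have eq: "det_conn_form \<A> J A U F x v = Im (A \<sigma> x v (\<omega>\<^sub>0 x)) / 2" if "v \<in> T x" for v
    using det_conn_form_eq[OF A x that] \<sigma>_\<omega>\<^sub>0[OF x] by simp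
  have "lin_on (T x) (A \<sigma> x)"
    by (rule ks_connection_lin[OF unitary_connectionD(1)[OF A] open_U kstar_section_\<sigma> x])
  note L = lin_onD[OF this]
  show ?thesis
    unfolding lin_on_def
    by (intro conjI ballI allI; simp only: eq T_closed L) (simp_all add: add_divide_distrib)
qed

lemma det_conn_form_shift:
  assumes A: "unitary_connection \<A> g J A" and X: "vector_field \<A> UNIV X" and x: "x \<in> U" and v: "v \<in> T x"
  shows "det_conn_form \<A> J (\<lambda>s y v. A s y v + cscale (2 * \<i> * of_real (g y (X y) v)) (s y)) U F x v
    = det_conn_form \<A> J A U F x v + g x (X x) v"
proof (rule det_conn_form_eqI[OF unitary_connection_shift[OF A X] x v])
  show "A \<sigma> x v + cscale (2 * \<i> * of_real (g x (X x) v)) (\<sigma> x) =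
      cscale (2 * \<i> * of_real (det_conn_form \<A> J A U F x v + g x (X x) v)) (\<sigma> x)"
    unfolding det_conn_form_eq[OF A x v] by (rule ext) (simp add: algebra_simps)
qed

end

section \<open>Minimality\<close>

text \<open>Collects what the chart has delivered: the spinor derivative is multiplication by a
  quaternion in which A enters only through \<open>det_conn_form\<close>, whereas q and Q are fixed.
  Apart from \<open>\<beta>_surj\<close>, the rest is linear algebra at x.\<close>

locale spinor_at_point = u2_chart_manifold \<A> g J U F
  for \<A> :: "'a::t2_space chart set" and g J U F +
  fixes nab :: "('a, 'a tvec) conn" and \<phi> :: "'a endo" and A0 :: "('a, 'a kvec) conn" and x :: 'a
    and q :: quat and Q :: "'a tvec \<Rightarrow> quat"
  assumes x: "x \<in> U"
    and A0: "unitary_connection \<A> g J A0"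
    and lin_on_Q: "lin_on (T x) Q"
    and F_\<phi>: "v \<in> T x \<Longrightarrow> F x (\<phi> x v) = qmult q (F x v)"
    and \<phi>_in: "v \<in> T x \<Longrightarrow> \<phi> x v \<in> T x"
    and spin_in: "v \<in> T x \<Longrightarrow> u \<in> T x \<Longrightarrow> spin_conn_plus \<A> g J nab A \<phi> x v u \<in> T x"
    and F_spin: "v \<in> T x \<Longrightarrow> u \<in> T x \<Longrightarrow> F x (spin_conn_plus \<A> g J nab A \<phi> x v u) =
      qmult (Q v + det_conn_form \<A> J A U F x v *\<^sub>R qmult q_i q) (F x u)"
begin

abbreviation \<alpha> where "\<alpha> A \<equiv> det_conn_form \<A> J A U F x"
abbreviation B where "B \<equiv> B_tensor \<A> g J nab \<phi> x"

definition p :: quat where "p = qmult q_i q"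

text \<open>Absorbs the contribution of \<open>A0\<close>, so that \<open>A0\<close> itself
  corresponds to the shift 0.\<close>

definition Q0 :: "'a tvec \<Rightarrow> quat" where
  "Q0 v = Q v + \<alpha> A0 v *\<^sub>R p"

lemma lin_on_Q0: "lin_on (T x) Q0"
  using lin_on_Q lin_on_det_conn_form[OF A0 x] by (simp add: lin_on_def Q0_def algebra_simps)

text \<open>Exactly the basis that \<open>tensor_norm\<close> and \<open>tr_tensor\<close> select,
  so both unfold to sums over it; the chart frame E merely proves that such a basis exists.\<close>

definition e :: "4 \<Rightarrow> 'a tvec" where
  "e k = (SOME e. orthonormal_basis \<A> g x e) $ k"

lemma frame_e: "frame_at x e"
proof -
  have "orthonormal_basis \<A> g x (\<chi> k. E k x)"
    using frame_E[OF x] by (simp add: orthonormal_basis_def frame_at_def)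
  then have "orthonormal_basis \<A> g x (SOME e. orthonormal_basis \<A> g x e)" by (rule someI)
  then show ?thesis by (simp add: orthonormal_basis_def frame_at_def e_def)
qed

lemma e_in_T [simp]: "e k \<in> T x"
  using frame_e by (simp add: frame_at_def)

lemma g_e: "g x (e j) (e k) = (if j = k then 1 else 0)"
  using frame_e by (simp add: frame_at_def)

definition f :: "4 \<Rightarrow> quat" where
  "f k = F x (e k)"

lemma f_orthonormal: "f j \<bullet> f k = (if j = k then 1 else 0)"
  using F_inner[OF x, of "e j" "e k"] by (simp add: f_def g_e)

lemma f_expand: "y = (\<Sum>k\<in>UNIV. (y \<bullet> f k) *\<^sub>R f k)"
proof -
  have "y = F x (\<Sum>k\<in>UNIV. g x (Finv x y) (e k) *\<^sub>R e k)"
    using frame_expand[OF frame_e, of "Finv x y"] x by simp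
  also have "\<dots> = (\<Sum>k\<in>UNIV. F x (g x (Finv x y) (e k) *\<^sub>R e k))"
    by (rule lin_on_sum[OF subspace_T lin_on_F[OF x]]) simp_all
  also have "\<dots> = (\<Sum>k\<in>UNIV. (y \<bullet> f k) *\<^sub>R f k)"
    using F_inner[OF x, of "Finv x y"] x by (simp add: lin_onD(2)[OF lin_on_F[OF x]] f_def)
  finally show ?thesis .
qed

lemma lin_on_eq_0_iff:
  fixes L :: "'a tvec \<Rightarrow> real"
  assumes "lin_on (T x) L"
  shows "(\<forall>j. L (e j) = 0) \<longleftrightarrow> (\<forall>v\<in>T x. L v = 0)"
proof (intro iffI ballI)
  fix v assume z: "\<forall>j. L (e j) = 0" and v: "v \<in> T x"
  have "L v = L (\<Sum>k\<in>UNIV. g x v (e k) *\<^sub>R e k)" using frame_expand[OF frame_e v] by simp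
  also have "\<dots> = (\<Sum>k\<in>UNIV. L (g x v (e k) *\<^sub>R e k))"
    by (rule lin_on_sum[OF subspace_T assms]) simp_all
  also have "\<dots> = 0" using z by (simp add: lin_onD(2)[OF assms])
  finally show "L v = 0" .
qed simp

definition \<beta> :: "('a, 'a kvec) conn \<Rightarrow> 4 \<Rightarrow> real" where
  "\<beta> A j = \<alpha> A (e j) - \<alpha> A0 (e j)"

lemma \<beta>_surj:
  obtains A where "unitary_connection \<A> g J A" "\<beta> A = b"
proof -
  obtain X where X: "vector_field \<A> UNIV X" "X x = (\<Sum>k\<in>UNIV. b k *\<^sub>R e k)"
    by (rule vector_field_extension[of "\<Sum>k\<in>UNIV. b k *\<^sub>R e k" x]) simp
  have "g x (X x) (e j) = b j" for j
    unfolding X(2) using exhaust_4[of j] by (auto simp: sum_4 g_add_left g_scaleR_left g_e)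
  then show ?thesis
    using that[OF unitary_connection_shift[OF A0 X(1)]]
    by (simp add: \<beta>_def fun_eq_iff det_conn_form_shift[OF A0 X(1) x])
qed

text \<open>If a norm depends on A only through the shift, surjectivity of \<open>\<beta>\<close>
  turns the quantifier over connections into one over real 4-tuples, and monotonicity removes the
  root.\<close>

lemma minimal_at_iff:
  assumes "\<And>A. tensor_norm \<A> g x (\<T> A) = sqrt (N (\<beta> A))"
  shows "minimal_at \<A> g J x \<T> A0 \<longleftrightarrow> (\<forall>b. N (\<lambda>j. 0) \<le> N b)"
proof -
  have "\<beta> A0 = (\<lambda>j. 0)" by (simp add: \<beta>_def fun_eq_iff)
  then show ?thesis
    unfolding minimal_at_def assms real_sqrt_le_iff using \<beta>_surj by metis
qed

lemma tensor_norm_eq: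
  assumes "\<And>u v. u \<in> T x \<Longrightarrow> v \<in> T x \<Longrightarrow> S u v \<in> T x"
  shows "tensor_norm \<A> g x S = sqrt (sqn (\<lambda>j k. F x (S (e j) (e k))))"
  unfolding tensor_norm_def Let_def sqn_def e_def[symmetric]
  by (simp add: F_inner[OF x] assms)

lemma B_in [simp]: "u \<in> T x \<Longrightarrow> v \<in> T x \<Longrightarrow> B A u v \<in> T x"
  by (simp add: B_tensor_def clifford_def spin_in)

lemma F_B: "F x (B A (e j) (e k)) = qmult (Q0 (e j) + \<beta> A j *\<^sub>R p) (f k)"
  by (simp add: B_tensor_def clifford_def F_spin Q0_def \<beta>_def p_def f_def algebra_simps)

abbreviation D :: quat where
  "D \<equiv> \<Sum>k\<in>UNIV. qmult (Q0 (e k)) (f k)"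

lemma tr_in: "tr_tensor \<A> g x (B A) \<in> T x"
  by (simp add: tr_tensor_def Let_def e_def[symmetric])

lemma F_tr: "F x (tr_tensor \<A> g x (B A)) = D + qmult p (\<Sum>k\<in>UNIV. \<beta> A k *\<^sub>R f k)"
proof -
  have "F x (tr_tensor \<A> g x (B A)) = (\<Sum>k\<in>UNIV. F x (B A (e k) (e k)))"
    unfolding tr_tensor_def Let_def e_def[symmetric]
    by (rule lin_on_sum[OF subspace_T lin_on_F[OF x]]) simp_all
  then show ?thesis
    by (simp add: F_B qmult.add_left sum.distrib qmult.sum_right qmult.scaleR_left qmult.scaleR_right)
qed

lemma F_dirac: "F x (dirac \<A> g J nab \<phi> x A0) = D"
  by (simp add: dirac_def F_tr \<beta>_def qmult.zero_right)

lemma dirac_in: "dirac \<A> g J nab \<phi> x A0 \<in> T x"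
  by (simp add: dirac_def tr_in)

lemma dirac_eq_0_iff: "dirac \<A> g J nab \<phi> x A0 = 0 \<longleftrightarrow> D = 0"
  using F_inj[OF x dirac_in, of 0] lin_on_zero[OF lin_on_F[OF x] dirac_in] F_dirac by auto

lemma F_iphi: "v \<in> T x \<Longrightarrow> F x (J x (\<phi> x v)) = qmult p (F x v)"
  by (simp add: F_J x \<phi>_in F_\<phi> p_def qmult_assoc)

text \<open>Multiplying two quaternions by the same F(v) scales their inner product by |v|^2, so the
  required factor exists; a unit vector shows that it is unique.\<close>

lemma wplus_inner_eq:
  assumes "X \<in> T x"
  shows "wplus_inner \<A> g x (spin_conn_plus \<A> g J nab A0 \<phi> x X) (\<lambda>v. J x (\<phi> x v)) = Q0 X \<bullet> p"
proof -
  have eq: "g x (spin_conn_plus \<A> g J nab A0 \<phi> x X v) (J x (\<phi> x v)) = (Q0 X \<bullet> p) * g x v v" if "v \<in> T x" for v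
    using that assms F_inner[OF x spin_in[of X v A0] J_in[OF \<phi>_in[of v]]] F_inner[OF x, of v v]
    by (simp add: F_iphi F_spin qmult_inner_right Q0_def p_def)
  show ?thesis
    unfolding wplus_inner_def
  proof (rule the_equality)
    fix r assume "\<forall>v\<in>T x. g x (spin_conn_plus \<A> g J nab A0 \<phi> x X v) (J x (\<phi> x v)) = r * g x v v"
    then show "r = Q0 X \<bullet> p" using eq[of "e 1"] by (simp add: g_e)
  qed (simp add: eq)
qed

lemma g_dirac: "X \<in> T x \<Longrightarrow> g x (dirac \<A> g J nab \<phi> x A0) (J x (\<phi> x X)) = D \<bullet> qmult p (F x X)"
  using F_inner[OF x dirac_in J_in[OF \<phi>_in]] by (simp add: F_dirac F_iphi)

lemma minimal_B:
  "minimal_at \<A> g J x B A0 \<longleftrightarrow>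
    (\<forall>X\<in>T x. wplus_inner \<A> g x (spin_conn_plus \<A> g J nab A0 \<phi> x X) (\<lambda>v. J x (\<phi> x v)) = 0)"
proof -
  let ?N = "\<lambda>b. sqn (\<lambda>j k. qmult (Q0 (e j) + b j *\<^sub>R p) (f k))"
  have "tensor_norm \<A> g x (B A) = sqrt (?N (\<beta> A))" for A
    by (subst tensor_norm_eq) (simp_all add: F_B)
  from minimal_at_iff[of B ?N, OF this]
  have "minimal_at \<A> g J x B A0 \<longleftrightarrow> (\<forall>j. Q0 (e j) \<bullet> p = 0)"
    using B_minimum_iff[where f = f and p = p and Q = "\<lambda>j. Q0 (e j)", OF f_orthonormal] by simp
  also have "\<dots> \<longleftrightarrow> (\<forall>X\<in>T x. Q0 X \<bullet> p = 0)"
    by (rule lin_on_eq_0_iff) (use lin_on_Q0 in \<open>simp add: lin_on_def inner_add_left\<close>)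
  finally show ?thesis by (simp add: wplus_inner_eq)
qed

lemma minimal_twisted:
  fixes \<epsilon> :: real
  assumes \<epsilon>: "\<epsilon> * \<epsilon> = 1"
  shows "minimal_at \<A> g J x (\<lambda>A u v. (1/2) *\<^sub>R (B A u v + \<epsilon> *\<^sub>R B A v u)) A0 \<longleftrightarrow>
    (\<forall>X\<in>T x. 4 * (Q0 X \<bullet> p) + \<epsilon> * (2 * (Q0 X \<bullet> p) - D \<bullet> qmult p (F x X)) = 0)"
proof -
  let ?N = "\<lambda>b. sqn (\<lambda>j k. (1/2) *\<^sub>R (qmult (Q0 (e j) + b j *\<^sub>R p) (f k) + \<epsilon> *\<^sub>R qmult (Q0 (e k) + b k *\<^sub>R p) (f j)))"
  have "tensor_norm \<A> g x (\<lambda>u v. (1/2) *\<^sub>R (B A u v + \<epsilon> *\<^sub>R B A v u)) = sqrt (?N (\<beta> A))" for A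
    by (subst tensor_norm_eq) (simp_all only: T_closed B_in e_in_T lin_onD[OF lin_on_F[OF x]] F_B)
  from minimal_at_iff[of "\<lambda>A u v. (1/2) *\<^sub>R (B A u v + \<epsilon> *\<^sub>R B A v u)" ?N, OF this]
  have "minimal_at \<A> g J x (\<lambda>A u v. (1/2) *\<^sub>R (B A u v + \<epsilon> *\<^sub>R B A v u)) A0 \<longleftrightarrow> (\<forall>b. ?N (\<lambda>j. 0) \<le> ?N b)" .
  also have "\<dots> \<longleftrightarrow> (\<forall>j. 4 * (Q0 (e j) \<bullet> p) + \<epsilon> * (2 * (Q0 (e j) \<bullet> p) - D \<bullet> qmult p (f j)) = 0)"
    using twisted_minimum_iff[where f = f and p = p and Q = "\<lambda>j. Q0 (e j)", OF f_orthonormal \<epsilon>] by simp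
  also have "\<dots> \<longleftrightarrow> (\<forall>X\<in>T x. 4 * (Q0 X \<bullet> p) + \<epsilon> * (2 * (Q0 X \<bullet> p) - D \<bullet> qmult p (F x X)) = 0)"
    unfolding f_def
  proof (rule lin_on_eq_0_iff)
    have "lin_on (T x) (\<lambda>X. 4 * (Q0 X \<bullet> p) + \<epsilon> * (2 * (Q0 X \<bullet> p) - d \<bullet> qmult p (F x X)))" for d
      using lin_on_Q0 lin_on_F[OF x]
      by (simp add: lin_on_def inner_add_left inner_add_right qmult.add_right qmult.scaleR_right algebra_simps)
    then show "lin_on (T x) (\<lambda>X. 4 * (Q0 X \<bullet> p) + \<epsilon> * (2 * (Q0 X \<bullet> p) - (\<Sum>k\<in>UNIV. qmult (Q0 (e k)) (F x (e k))) \<bullet> qmult p (F x X)))" .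
  qed
  finally show ?thesis .
qed

lemma minimal_Sym:
  "minimal_at \<A> g J x (\<lambda>A. Sym_tensor (B A)) A0 \<longleftrightarrow>
    (\<forall>X\<in>T x. g x (dirac \<A> g J nab \<phi> x A0) (J x (\<phi> x X)) =
      6 * wplus_inner \<A> g x (spin_conn_plus \<A> g J nab A0 \<phi> x X) (\<lambda>v. J x (\<phi> x v)))"
proof -
  have "(\<lambda>A. Sym_tensor (B A)) = (\<lambda>A u v. (1/2) *\<^sub>R (B A u v + 1 *\<^sub>R B A v u))"
    by (simp only: Sym_tensor_def scaleR_one)
  then show ?thesis
    using minimal_twisted[of 1] by (auto simp: wplus_inner_eq g_dirac)
qed

lemma minimal_Alt:
  "minimal_at \<A> g J x (\<lambda>A. Alt_tensor (B A)) A0 \<longleftrightarrow>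
    (\<forall>X\<in>T x. g x (dirac \<A> g J nab \<phi> x A0) (J x (\<phi> x X)) =
      - 2 * wplus_inner \<A> g x (spin_conn_plus \<A> g J nab A0 \<phi> x X) (\<lambda>v. J x (\<phi> x v)))"
proof -
  have "(\<lambda>A. Alt_tensor (B A)) = (\<lambda>A u v. (1/2) *\<^sub>R (B A u v + (-1) *\<^sub>R B A v u))"
    by (simp only: Alt_tensor_def scaleR_minus1_left diff_conv_add_uminus)
  moreover have "4 * a + - 1 * (2 * a - b) = 0 \<longleftrightarrow> b = - 2 * a" for a b :: real by auto
  ultimately show ?thesis
    using minimal_twisted[of "-1"] by (simp only: wplus_inner_eq g_dirac cong: ball_cong)
qed

lemma minimal_trace:
  "minimal_at \<A> g J x (\<lambda>A. metric_tensor g x ((1/4) *\<^sub>R tr_tensor \<A> g x (B A))) A0 \<longleftrightarrow>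
    (\<forall>b. D \<bullet> D \<le> (D + qmult p (\<Sum>k\<in>UNIV. b k *\<^sub>R f k)) \<bullet> (D + qmult p (\<Sum>k\<in>UNIV. b k *\<^sub>R f k)))"
proof -
  let ?w = "\<lambda>b. D + qmult p (\<Sum>k\<in>UNIV. b k *\<^sub>R f k)"
  let ?N = "\<lambda>b. (1/4) * (?w b \<bullet> ?w b)"
  have "tensor_norm \<A> g x (metric_tensor g x ((1/4) *\<^sub>R tr_tensor \<A> g x (B A))) = sqrt (?N (\<beta> A))" for A
  proof -
    have "F x (metric_tensor g x ((1/4) *\<^sub>R tr_tensor \<A> g x (B A)) (e j) (e k)) = (if j = k then 1 else 0) *\<^sub>R ((1/4) *\<^sub>R ?w (\<beta> A))" for j k
      unfolding metric_tensor_def g_e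
      by (simp only: lin_onD[OF lin_on_F[OF x]] T_closed tr_in F_tr)
    \<comment> \<open>Four diagonal entries, each contributing 1/16.\<close>
    moreover have "sqn (\<lambda>j k. (if j = k then 1 else 0) *\<^sub>R ((1/4) *\<^sub>R w)) = (1/4) * (w \<bullet> w)" for w
      by (simp add: sqn_def sum_4)
    ultimately show ?thesis
      by (subst tensor_norm_eq) (simp_all only: metric_tensor_def T_closed tr_in)
  qed
  from minimal_at_iff[of "\<lambda>A. metric_tensor g x ((1/4) *\<^sub>R tr_tensor \<A> g x (B A))" ?N, OF this]
  show ?thesis by (simp add: qmult.zero_right)
qed

lemma minimal_trace_if: "D = 0 \<Longrightarrow> minimal_at \<A> g J x (\<lambda>A. metric_tensor g x ((1/4) *\<^sub>R tr_tensor \<A> g x (B A))) A0"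
  unfolding minimal_trace by simp

text \<open>A nonzero spinor at x makes p invertible, so as the connection varies the trace runs
  through all quaternions and the least norm is 0.\<close>

lemma minimal_trace_iff:
  assumes "v \<in> T x" "\<phi> x v \<noteq> 0"
  shows "minimal_at \<A> g J x (\<lambda>A. metric_tensor g x ((1/4) *\<^sub>R tr_tensor \<A> g x (B A))) A0 \<longleftrightarrow> D = 0"
proof
  assume min: "minimal_at \<A> g J x (\<lambda>A. metric_tensor g x ((1/4) *\<^sub>R tr_tensor \<A> g x (B A))) A0"
  have "q \<noteq> 0"
  proof
    assume "q = 0"
    then have "F x (\<phi> x v) = 0" using F_\<phi>[OF assms(1)] by (simp add: qmult.zero_left)
    then have "g x (\<phi> x v) (\<phi> x v) = 0" using F_inner[OF x \<phi>_in \<phi>_in, of v v] assms(1) by simp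
    then show False using g_eq_0D \<phi>_in assms by blast
  qed
  moreover have "p \<bullet> p = q \<bullet> q" by (simp add: p_def qmult_inner_left) (simp add: quat_inner q_i_def)
  ultimately have pp: "p \<bullet> p \<noteq> 0" by simp
  \<comment> \<open>The solution of p y = -D, by the inverse of p as conjugate over squared norm;
    its components in the basis f are the shift to be tested.\<close>
  let ?y = "(- 1 / (p \<bullet> p)) *\<^sub>R qmult (qcnj p) D"
  have "qmult p (qcnj p) = (p \<bullet> p) *\<^sub>R axis 1 1" by (simp add: quat_eq_iff quat_inner)
  then have "qmult p (qmult (qcnj p) D) = (p \<bullet> p) *\<^sub>R D"
    by (simp add: qmult_assoc[symmetric] qmult.scaleR_left)
  then have "qmult p ?y = - D" using pp by (simp add: qmult.scaleR_right qmult.minus_right)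
  then have "D + qmult p (\<Sum>k\<in>UNIV. (?y \<bullet> f k) *\<^sub>R f k) = 0"
    unfolding f_expand[symmetric] by simp
  then have "D \<bullet> D \<le> 0 \<bullet> (0 :: quat)"
    using min[unfolded minimal_trace, rule_format, of "\<lambda>k. ?y \<bullet> f k"] by (simp only:)
  moreover have "w = 0" if "w \<bullet> w \<le> 0 \<bullet> (0 :: quat)" for w :: quat
  proof (rule ccontr)
    assume "w \<noteq> 0"
    then have "0 < w \<bullet> w" by simp
    with that show False by simp
  qed
  ultimately show "D = 0" by blast
qed (rule minimal_trace_if)

end

text \<open>At a zero of \<phi> the Dirac value is the same for every A, so each connection
  minimises the trace part even if that value is nonzero. The trace criterion is therefore an
  equivalence where \<phi> is nonzero at x, together with the unconditional implication from a
  vanishing Dirac value.\<close>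

theorem lemma3p9:
  fixes \<A> :: "'a::{t2_space, second_countable_topology} chart set"
    and g :: "'a metric" and J \<phi> :: "'a endo"
    and nab :: "('a, 'a tvec) conn" and A0 :: "('a, 'a kvec) conn" and x :: 'a
  assumes "compact (UNIV :: 'a set)" and "oriented_atlas \<A>"
    and "riemannian_metric \<A> g"
    and "almost_complex_structure \<A> J" and "compatible \<A> g J"
    and "levi_civita \<A> g nab"
    and "self_dual_spinor_field \<A> g \<phi>"
    and "unitary_connection \<A> g J A0"
  defines "B \<equiv> B_tensor \<A> g J nab \<phi> x"
    and "Dir \<equiv> dirac \<A> g J nab \<phi> x A0"
    and "dphi \<equiv> spin_conn_plus \<A> g J nab A0 \<phi> x"
    and "iphi \<equiv> \<lambda>v. J x (\<phi> x v)"
  shows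
    "(minimal_at \<A> g J x B A0 \<longleftrightarrow>
        (\<forall>X\<in>tangent_space \<A> x. wplus_inner \<A> g x (dphi X) iphi = 0)) \<and>
     (minimal_at \<A> g J x (\<lambda>A. Sym_tensor (B A)) A0 \<longleftrightarrow>
        (\<forall>X\<in>tangent_space \<A> x. g x Dir (iphi X) = 6 * wplus_inner \<A> g x (dphi X) iphi)) \<and>
     (minimal_at \<A> g J x (\<lambda>A. Alt_tensor (B A)) A0 \<longleftrightarrow>
        (\<forall>X\<in>tangent_space \<A> x. g x Dir (iphi X) = - 2 * wplus_inner \<A> g x (dphi X) iphi)) \<and>
     ((\<exists>v\<in>tangent_space \<A> x. \<phi> x v \<noteq> 0) \<longrightarrow>
        (minimal_at \<A> g J x (\<lambda>A. metric_tensor g x ((1/4) *\<^sub>R tr_tensor \<A> g x (B A))) A0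
          \<longleftrightarrow> Dir = 0)) \<and>
     (Dir = 0 \<longrightarrow>
        minimal_at \<A> g J x (\<lambda>A. metric_tensor g x ((1/4) *\<^sub>R tr_tensor \<A> g x (B A))) A0)"
proof -
  interpret almost_hermitian_manifold \<A> g J
    using assms(2-5) by unfold_locales
  \<comment> \<open>The chart has to be the pair that \<open>spin_conn_minus\<close> selects at x,
    so that its definition unfolds to the chart of the interpretation.\<close>
  obtain U F where UF: "(SOME (U, F). u2_chart \<A> g J U F \<and> x \<in> U) = (U, F)"
    by (rule prod.exhaust)
  obtain U' F' where "case (U', F') of (U, F) \<Rightarrow> u2_chart \<A> g J U F \<and> x \<in> U"
    using exists_u2_chart[of x] by auto
  then have "case (SOME (U, F). u2_chart \<A> g J U F \<and> x \<in> U) of (U, F) \<Rightarrow> u2_chart \<A> g J U F \<and> x \<in> U"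
    by (rule someI)
  then have chart: "u2_chart \<A> g J U F" and x: "x \<in> U" unfolding UF by simp_all
  interpret u2_chart_manifold \<A> g J U F
    using chart by unfold_locales
  have \<phi>_in: "\<phi> x v \<in> T x" if "v \<in> T x" for v
    using assms(7)[unfolded self_dual_spinor_field_def endomorphism_field_def, THEN conjunct1, THEN conjunct1, rule_format, THEN conjunct1, of x]
      that by blast
  obtain q Q where Q: "lin_on (T x) Q" and q: "\<And>v. v \<in> T x \<Longrightarrow> F x (\<phi> x v) = qmult q (F x v)"
    and spin: "\<And>A Y V v. open V \<Longrightarrow> x \<in> V \<Longrightarrow> vector_field \<A> V Y \<Longrightarrow> v \<in> T x \<Longrightarrow>
      spin_conn_minus_in \<A> J nab A U F (\<lambda>y. \<phi> y (Y y)) x v - \<phi> x (nab Y x v) \<in> T x \<and>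
      F x (spin_conn_minus_in \<A> J nab A U F (\<lambda>y. \<phi> y (Y y)) x v - \<phi> x (nab Y x v)) =
        qmult (Q v + det_conn_form \<A> J A U F x v *\<^sub>R qmult q_i q) (F x (Y x))"
    by (rule spin_conn_plus_in_chart[OF assms(6) x assms(7)]) blast
  have plus: "spin_conn_plus \<A> g J nab A \<phi> x v u \<in> T x \<and>
      F x (spin_conn_plus \<A> g J nab A \<phi> x v u) = qmult (Q v + det_conn_form \<A> J A U F x v *\<^sub>R qmult q_i q) (F x u)"
    if v: "v \<in> T x" and u: "u \<in> T x" for A v u
  proof -
    \<comment> \<open>The extension chosen in \<open>spin_conn_plus\<close> is known only through
      \<open>?P\<close>; this suffices, as the chart formula sees only its value u at x.\<close>
    let ?P = "\<lambda>Y. Y x = u \<and> (\<exists>V. open V \<and> x \<in> V \<and> vector_field \<A> V Y)"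
    define Y where "Y = (SOME Y. ?P Y)"
    obtain Y' where "vector_field \<A> UNIV Y'" "Y' x = u" using vector_field_extension[OF u] .
    then have "?P Y'" using open_UNIV by blast
    then have "?P Y" unfolding Y_def by (rule someI[of ?P])
    then obtain V where V: "Y x = u" "open V" "x \<in> V" "vector_field \<A> V Y" by blast
    show ?thesis
      unfolding spin_conn_plus_def spin_conn_minus_def Let_def UF Y_def[symmetric] prod.case
      using spin[OF V(2-4) v, of A] unfolding V(1) .
  qed
  interpret spinor_at_point \<A> g J U F nab \<phi> A0 x q Q
    by unfold_locales (use x assms(8) Q q \<phi>_in plus in blast)+
  show ?thesis
    unfolding assms(9-12)
    using minimal_B minimal_Sym minimal_Alt minimal_trace_if minimal_trace_iff dirac_eq_0_iff by blast
qed

end
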